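(* Let $k\in\mathbb{Q}^+$, let $n\in\mathbb{Z}^+$ be arbitrarily large and let $d\in\{2,\dots,n\}$, and suppose that $kn,kd\in\mathbb{Z}^+$ with $kd\le n$. Let $Y$ and $Z$ be sets of size $n$ and $kn$ respectively, and let $G\sim G(k,n,d)$ be a random biregular bipartite directed graph on $(Y,Z)$. Take a subset $A\subseteq Y$ of size $kd$ and $y\in A$. Define $H:=G[A,\Gamma(y)]$ to be the subgraph induced by $G$ on the vertex set $(A,\Gamma(y))$. Then: (i) no perfect matching exists in $H$ with high probability when $\frac{kd^2}{n}-\log(kd)\to-\infty$ or when $d$ is a constant; (ii) a perfect matching exists in $H$ with high probability when $\frac{kd^2}{n}-\log(kd)\to+\infty$.
   Context: Given $k\in\mathbb{Q}^+$ and positive integers $n,d$ with $kn,kd\in\mathbb{Z}^+$ and $1\le d\le n$, and sets $Y,Z$ with $|Y|=n$, $|Z|=kn$, let $\mathcal{G}(k,n,d)$ be the family of biregular bipartite directed labelled graphs on vertex set $(Y,Z)$, with edges directed from $Y$ to $Z$, in which every $y\in Y$ has out-degree $kd$ and every $z\in Z$ has in-degree $d$. $G\sim G(k,n,d)$ means that $G$ is chosen uniformly at random from $\mathcal{G}(k,n,d)$. For $y\in Y$, $\Gamma(y)=\{z\in Z: yz\in E(G)\}$, so $|\Gamma(y)|=kd$. For sets $A,B$ of equal size, a perfect matching from $A$ to $B$ in a bipartite directed graph on $(A,B)$ is a collection of $|A|$ vertex-disjoint edges from $A$ to $B$. A property holds with high probability if the probability that it is satisfied tends to $1$ as $n\t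o\infty$.
   Formalization: In (i), the case where d is a constant additionally assumes kd ≠ 1; if kd = 1 then A = {y}, Γ(y) is a single vertex, and H is one edge, which is always a perfect matching, so the claim as stated fails there. *)

theory Defs
  imports "HOL-Probability.Probability"
begin

text \<open>
  A bipartite directed graph on \<open>(Y, Z)\<close> with all edges directed from \<open>Y\<close> to \<open>Z\<close> is
  represented by its edge set, a subset of \<open>Y \<times> Z\<close>. The out-neighbourhood of \<open>y\<close> in
  \<open>G\<close> is \<open>G `` {y}\<close> and the in-neighbourhood of \<open>z\<close> is \<open>G\<inverse> `` {z}\<close>. The two sides may have
  different types, so no disjointness assumption is needed.
\<close>

definition out_nbrs :: "('a \<times> 'b) set \<Rightarrow> 'a \<Rightarrow> 'b set" where
  "out_nbrs G y = G `` {y}"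

definition in_nbrs :: "('a \<times> 'b) set \<Rightarrow> 'b \<Rightarrow> 'a set" where
  "in_nbrs G z = G\<inverse> `` {z}"

text \<open>
  The parameter \<open>n\<close> of \<open>\<G>(k, n, d)\<close> is \<open>card Y\<close>; the family is only meaningful when
  \<open>card Z = k * card Y\<close>, which is required where it is used. Degrees are compared in the
  rationals, so \<open>k * d\<close> is never rounded.
\<close>

definition biregular_graphs :: "rat \<Rightarrow> nat \<Rightarrow> 'a set \<Rightarrow> 'b set \<Rightarrow> ('a \<times> 'b) set set" where
  "biregular_graphs k d Y Z =
     {G. G \<subseteq> Y \<times> Z \<and>
         (\<forall>y\<in>Y. of_nat (card (out_nbrs G y)) = k * of_nat d) \<and>
         (\<forall>z\<in>Z. card (in_nbrs G z) = d)}"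

definition random_biregular_graph :: "rat \<Rightarrow> nat \<Rightarrow> 'a set \<Rightarrow> 'b set \<Rightarrow> ('a \<times> 'b) set pmf" where
  "random_biregular_graph k d Y Z = pmf_of_set (biregular_graphs k d Y Z)"

definition induced_bipartite :: "('a \<times> 'b) set \<Rightarrow> 'a set \<Rightarrow> 'b set \<Rightarrow> ('a \<times> 'b) set" where
  "induced_bipartite G A B = G \<inter> (A \<times> B)"

definition vertex_disjoint :: "('a \<times> 'b) set \<Rightarrow> bool" where
  "vertex_disjoint M \<longleftrightarrow> (\<forall>e\<in>M. \<forall>f\<in>M. e \<noteq> f \<longrightarrow> fst e \<noteq> fst f \<and> snd e \<noteq> snd f)"

definition perfect_matching :: "'a set \<Rightarrow> 'b set \<Rightarrow> ('a \<times> 'b) set \<Rightarrow> ('a \<times> 'b) set \<Rightarrow> bool" where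
  "perfect_matching A B H M \<longleftrightarrow>
     card A = card B \<and> M \<subseteq> H \<and> M \<subseteq> A \<times> B \<and> vertex_disjoint M \<and> card M = card A"

text \<open>
  The asymptotic parameter is made explicit as the index of a sequence of probability spaces.
\<close>

definition whp :: "(nat \<Rightarrow> 'g pmf) \<Rightarrow> (nat \<Rightarrow> 'g \<Rightarrow> bool) \<Rightarrow> bool" where
  "whp P Q \<longleftrightarrow> (\<lambda>i. measure_pmf.prob (P i) {G. Q i G}) \<longlonglongrightarrow> 1"

end

theory Submission
  imports Defs "HOL-Real_Asymp.Real_Asymp"
begin

text \<open>
  Condition on \<open>\<Gamma>(y) = B\<close>. Since \<open>y\<close> is joined to all of \<open>B\<close>, a perfect matching exists iff
  \<open>A - {y}\<close> can be matched into \<open>B\<close>. Put \<open>p = d / n\<close> and \<open>l = k d\<^sup>2 / n\<close>, so that a vertex of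
  \<open>A\<close> has about \<open>l\<close> neighbours in \<open>B\<close>.

  If \<open>l \<le> 60 ln n\<close>, then \<open>p\<close> is of order at most \<open>sqrt (ln n / n)\<close>, and the odds of an edge between
  \<open>A - {y}\<close> and \<open>B\<close>, given the presence of few and the absence of arbitrarily many other such edges,
  are \<open>p\<close> up to small relative errors. The upper bound comes from switching two edges,
  the lower bound from switching three edges. The second moment method applied to the vertices of
  \<open>A - {y}\<close> without neighbours in \<open>B\<close> gives (i). A union bound over minimal violators of Hall's
  condition, on either side, gives (ii): every neighbour of a minimal violator has
  two neighbours in it, and this compensates for the number of choices of the neighbourhood.

  If \<open>l > 60 ln n\<close>, then (ii) is far from the threshold and constant factors in the exponent can be
  wasted. If \<open>S\<close> avoids \<open>U\<close>, pair the rows of (half of) \<open>S\<close> with rows carrying at least the average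
  number of edges into \<open>U\<close>; each of these edges could equally well lie in the partner row,
  so avoidance costs a factor 2 per edge. This needs no upper bound on the density.
\<close>

section \<open>Switchings\<close>

text \<open>The error analysis dictates the split at 60 ln n. A switch must spare a fraction of at
  most (4 + k) p of all edges, and \<open>y\<close> already uses one of the d in-edges of every
  vertex of B, so odds are known up to relative errors O(p) and 1/d. For a vertex with no neighbour
  in B, the exponent l is then known up to O(l p) + l/d, where l/d = k p. At the threshold this must
  be o(1); since l = k n p^2, it is whenever l = O(ln n). Beyond that range, pairing gives only a
  factor 2^(-l/8) per vertex of a violator, against three choices among O(n) objects per vertex
  (violator, other side, partners). With l > 60 ln n this factor is at most n^(-5), and n^(-2)
  remains.

  Fixing B turns the random target into a fixed set, and the condition itself only prescribes edges
  and non-edges at \<open>y\<close>, so the switching lemmas absorb it. Pairing rows other than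
  \<open>y\<close> respects the condition as well. Pairing columns could move an edge of
  \<open>y\<close>, so in the dense range the column side is treated without conditioning, with U
  ranging over subsets of Z.\<close>

definition bireg :: "'a set \<Rightarrow> 'b set \<Rightarrow> nat \<Rightarrow> nat \<Rightarrow> ('a \<times> 'b) set set" where
  "bireg Y Z D d =
     {G. G \<subseteq> Y \<times> Z \<and> (\<forall>y\<in>Y. card (G `` {y}) = D) \<and> (\<forall>z\<in>Z. card (G\<inverse> `` {z}) = d)}"

text \<open>The quotient of the sizes of \<open>cls \<G> (insert e E) F\<close> and
  \<open>cls \<G> E (insert e F)\<close> is the odds of the edge \<open>e\<close>, conditioned on
  the presence of \<open>E\<close> and the absence of \<open>F\<close>. All probability estimates
  are comparisons of such sizes.\<close>

definition cls :: "'g set set \<Rightarrow> 'g set \<Rightarrow> 'g set \<Rightarrow> 'g set set" where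
  "cls \<G> E F = {G \<in> \<G>. E \<subseteq> G \<and> F \<inter> G = {}}"

lemma finite_bireg: "finite Y \<Longrightarrow> finite Z \<Longrightarrow> finite (bireg Y Z D d)"
  unfolding bireg_def by (rule finite_subset[of _ "Pow (Y \<times> Z)"]) auto

lemma finite_cls: "finite \<G> \<Longrightarrow> finite (cls \<G> E F)"
  unfolding cls_def by auto

lemma converse_bireg: "G \<in> bireg Y Z D d \<Longrightarrow> G\<inverse> \<in> bireg Z Y d D"
  unfolding bireg_def by auto

text \<open>A switch \<open>h\<close> is counted as a map on pairs of a graph and the data
  \<open>t\<close> of the switch. Keeping \<open>t\<close> in the image makes the map injective as
  soon as \<open>g\<close> can undo the switch knowing \<open>t\<close>, so only the least number K
  of forward moves and the largest number M of backward moves matter.\<close>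

lemma double_count:
  fixes K M :: nat
  assumes "finite X" "finite X'"
    and "\<And>x. x \<in> X \<Longrightarrow> finite (T x) \<and> K \<le> card (T x)"
    and "\<And>x. x \<in> X' \<Longrightarrow> finite (T' x) \<and> card (T' x) \<le> M"
    and h: "\<And>x t. x \<in> X \<Longrightarrow> t \<in> T x \<Longrightarrow> h x t \<in> X' \<and> t \<in> T' (h x t) \<and> g (h x t) t = x"
  shows "K * card X \<le> M * card X'"
proof -
  have "K * card X \<le> (\<Sum>x\<in>X. card (T x))"
    using sum_bounded_below[of X K "\<lambda>x. card (T x)"] assms(3) by (simp add: mult.commute)
  also have "\<dots> = card (Sigma X T)"
    using assms by (simp add: card_SigmaI)
  also have "\<dots> \<le> card (Sigma X' T')"
  proof (rule card_inj_on_le[where f = "\<lambda>(x, t). (h x t, t)"])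
    show "inj_on (\<lambda>(x, t). (h x t, t)) (Sigma X T)"
      by (rule inj_on_inverseI[where g = "\<lambda>(x, t). (g x t, t)"]) (use h in auto)
    show "finite (Sigma X' T')"
      using assms by auto
  qed (use h in auto)
  also have "\<dots> = (\<Sum>x\<in>X'. card (T' x))"
    using assms by (simp add: card_SigmaI)
  also have "\<dots> \<le> M * card X'"
    using sum_bounded_above[of X' "\<lambda>x. card (T' x)" M] assms(4) by (simp add: mult.commute)
  finally show ?thesis .
qed

lemma card_switch:
  assumes "finite S" "R \<subseteq> S" "I \<inter> S = {}" "finite I" "card R = card I"
  shows "card ((S - R) \<union> I) = card S"
proof -
  have "card ((S - R) \<union> I) = card (S - R) + card I"
    by (rule card_Un_disjoint) (use assms in auto)
  also have "\<dots> = card S"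
    using assms by (metis card_Diff_subset card_mono finite_subset le_add_diff_inverse2)
  finally show ?thesis .
qed

lemma switch_bireg:
  assumes "finite Y" "finite Z" "G \<in> bireg Y Z D d" "R \<subseteq> G" "I \<inter> G = {}" "I \<subseteq> Y \<times> Z"
    and rows: "\<And>v. card (R `` {v}) = card (I `` {v})"
    and cols: "\<And>v. card (R\<inverse> `` {v}) = card (I\<inverse> `` {v})"
  shows "(G - R) \<union> I \<in> bireg Y Z D d"
proof -
  have fin: "finite G" "finite I"
    using assms finite_subset[of _ "Y \<times> Z"] by (auto simp: bireg_def)
  have "((G - R) \<union> I) `` {v} = (G `` {v} - R `` {v}) \<union> I `` {v}" for v
    by auto
  moreover have "card ((G `` {v} - R `` {v}) \<union> I `` {v}) = card (G `` {v})" for v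
    by (rule card_switch) (use fin assms in auto)
  moreover have "((G - R) \<union> I)\<inverse> `` {v} = (G\<inverse> `` {v} - R\<inverse> `` {v}) \<union> I\<inverse> `` {v}" for v
    by auto
  moreover have "card ((G\<inverse> `` {v} - R\<inverse> `` {v}) \<union> I\<inverse> `` {v}) = card (G\<inverse> `` {v})" for v
    by (rule card_switch) (use fin assms in auto)
  ultimately show ?thesis
    using assms by (auto simp: bireg_def)
qed

lemma switch2_bireg:
  assumes fin: "finite Y" "finite Z" and G: "G \<in> bireg Y Z D d"
    and e: "(a, z) \<in> G" "(w, z') \<in> G" "(a, z') \<notin> G" "(w, z) \<notin> G"
  shows "(G - {(a, z), (w, z')}) \<union> {(a, z'), (w, z)} \<in> bireg Y Z D d"
proof -
  have ne: "a \<noteq> w" "z \<noteq> z'"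
    using e by auto
  show ?thesis
  proof (rule switch_bireg[OF fin G])
    show "{(a, z'), (w, z)} \<subseteq> Y \<times> Z"
      using e G by (auto simp: bireg_def)
    fix v
    have "{(a, z), (w, z')} `` {v} = (if v = a then {z} else if v = w then {z'} else {})"
      "{(a, z'), (w, z)} `` {v} = (if v = a then {z'} else if v = w then {z} else {})"
      using ne by auto
    then show "card ({(a, z), (w, z')} `` {v}) = card ({(a, z'), (w, z)} `` {v})"
      by auto
  next
    fix v
    have "{(a, z), (w, z')}\<inverse> `` {v} = (if v = z then {a} else if v = z' then {w} else {})"
      "{(a, z'), (w, z)}\<inverse> `` {v} = (if v = z then {w} else if v = z' then {a} else {})"
      using ne by auto
    then show "card ({(a, z), (w, z')}\<inverse> `` {v}) = card ({(a, z'), (w, z)}\<inverse> `` {v})"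
      by auto
  qed (use e in auto)
qed

lemma switch3_bireg:
  assumes fin: "finite Y" "finite Z" and G: "G \<in> bireg Y Z D d"
    and e: "(a, z') \<in> G" "(w, z) \<in> G" "(v, x) \<in> G" "(a, z) \<notin> G" "(w, x) \<notin> G" "(v, z') \<notin> G"
  shows "(G - {(a, z'), (w, z), (v, x)}) \<union> {(a, z), (w, x), (v, z')} \<in> bireg Y Z D d"
proof -
  have ne: "a \<noteq> w" "z \<noteq> z'" "v \<noteq> w" "v \<noteq> a" "x \<noteq> z" "x \<noteq> z'"
    using e by auto
  show ?thesis
  proof (rule switch_bireg[OF fin G])
    show "{(a, z), (w, x), (v, z')} \<subseteq> Y \<times> Z"
      using e G by (auto simp: bireg_def)
    fix u
    have "{(a, z'), (w, z), (v, x)} `` {u} =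
        (if u = a then {z'} else if u = w then {z} else if u = v then {x} else {})"
      "{(a, z), (w, x), (v, z')} `` {u} =
        (if u = a then {z} else if u = w then {x} else if u = v then {z'} else {})"
      using ne by auto
    then show "card ({(a, z'), (w, z), (v, x)} `` {u}) = card ({(a, z), (w, x), (v, z')} `` {u})"
      by auto
  next
    fix u
    have "{(a, z'), (w, z), (v, x)}\<inverse> `` {u} =
        (if u = z' then {a} else if u = z then {w} else if u = x then {v} else {})"
      "{(a, z), (w, x), (v, z')}\<inverse> `` {u} =
        (if u = z' then {v} else if u = z then {a} else if u = x then {w} else {})"
      using ne by auto
    then show "card ({(a, z'), (w, z), (v, x)}\<inverse> `` {u}) = card ({(a, z), (w, x), (v, z')}\<inverse> `` {u})"
      by auto
  qed (use e in auto)
qed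

lemma card_edges_columns:
  assumes "finite Y" "finite Z" "G \<in> bireg Y Z D d" "X \<subseteq> Z"
  shows "card {e \<in> G. snd e \<in> X} = card X * d"
proof -
  have fX: "finite X"
    using assms finite_subset by blast
  have fG: "finite G"
    using assms finite_subset[of _ "Y \<times> Z"] by (auto simp: bireg_def)
  have "{e \<in> G. snd e \<in> X} = prod.swap ` (SIGMA x:X. G\<inverse> `` {x})"
    by force
  then have "card {e \<in> G. snd e \<in> X} = card (SIGMA x:X. G\<inverse> `` {x})"
    by (simp add: card_image)
  also have "\<dots> = (\<Sum>x\<in>X. card (G\<inverse> `` {x}))"
    by (rule card_SigmaI) (use fX fG in auto)
  also have "\<dots> = card X * d"
    using assms by (auto simp: bireg_def subset_iff)
  finally show ?thesis .
qed

lemma card_edges_columns_le: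
  assumes "finite Y" "finite Z" "G \<in> bireg Y Z D d" "finite X"
  shows "card {e \<in> G. snd e \<in> X} \<le> card X * d"
proof -
  have "{e \<in> G. snd e \<in> X} = {e \<in> G. snd e \<in> X \<inter> Z}"
    using assms by (auto simp: bireg_def)
  then have "card {e \<in> G. snd e \<in> X} = card (X \<inter> Z) * d"
    using card_edges_columns[of Y Z G D d "X \<inter> Z"] assms by simp
  also have "\<dots> \<le> card X * d"
    using assms by (simp add: card_mono)
  finally show ?thesis .
qed

lemma card_edges_rows_le:
  assumes "finite Y" "finite Z" "G \<in> bireg Y Z D d" "finite X"
  shows "card {e \<in> G. fst e \<in> X} \<le> card X * D"
proof -
  have "{e \<in> G. fst e \<in> X} = prod.swap ` {e \<in> G\<inverse>. snd e \<in> X}"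
    by force
  then show ?thesis
    using card_edges_columns_le[of Z Y "G\<inverse>" d D X] assms converse_bireg[of G Y Z D d]
    by (simp add: card_image)
qed

lemma card_bireg:
  assumes "finite Y" "finite Z" "G \<in> bireg Y Z D d"
  shows "card G = card Z * d"
proof -
  have "{e \<in> G. snd e \<in> Z} = G"
    using assms by (auto simp: bireg_def)
  then show ?thesis
    using card_edges_columns[OF assms, of Z] by simp
qed

lemma bireg_image_subset: "G \<in> bireg Y Z D d \<Longrightarrow> G `` X \<subseteq> Z"
  by (auto simp: bireg_def)

text \<open>Counts the edges available for a switch once prescribed edges, blocked columns and
  blocked rows are spared. K enters as slack in an additive inequality, which avoids truncated
  subtraction.\<close>

lemma card_free_edges:
  assumes fin: "finite Y" "finite Z" and G: "G \<in> bireg Y Z D d"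
    and "finite E" "finite X" "finite W"
    and K: "card E + card X * d + card W * D + K \<le> card Z * d"
  shows "K \<le> card {e \<in> G. e \<notin> E \<and> snd e \<notin> X \<and> fst e \<notin> W}"
proof -
  let ?F = "{e \<in> G. e \<notin> E \<and> snd e \<notin> X \<and> fst e \<notin> W}"
  have fG: "finite G"
    using fin G finite_subset[of _ "Y \<times> Z"] by (auto simp: bireg_def)
  have "G \<subseteq> ?F \<union> E \<union> {e \<in> G. snd e \<in> X} \<union> {e \<in> G. fst e \<in> W}"
    by auto
  then have "card G \<le> card (?F \<union> E \<union> {e \<in> G. snd e \<in> X} \<union> {e \<in> G. fst e \<in> W})"
    using fG assms by (intro card_mono) auto
  also have "\<dots> \<le> card ?F + card E + card {e \<in> G. snd e \<in> X} + card {e \<in> G. fst e \<in> W}"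
    by (meson add_le_mono card_Un_le le_refl le_trans)
  finally show ?thesis
    using card_bireg[OF fin G] card_edges_columns_le[OF fin G \<open>finite X\<close>]
      card_edges_rows_le[OF fin G \<open>finite W\<close>] K by linarith
qed

text \<open>The edges \<open>(a, z)\<close> and \<open>(w, z')\<close> are replaced by
  \<open>(a, z')\<close> and \<open>(w, z)\<close>. At least K edges \<open>(w, z')\<close> keep
  \<open>E\<close> present and \<open>F\<close> absent, so the odds of \<open>(a, z)\<close> are at
  most D d / K, which is close to D d / (N d) = p for N = \<open>card Z\<close>.\<close>

lemma switch_upper:
  assumes fin: "finite Y" "finite Z" and az: "a \<in> Y" "z \<in> Z" "(a, z) \<notin> E"
    and fE: "finite E" "finite F"
    and K: "card E + (D + card (F `` {a})) * d + (d + card (F\<inverse> `` {z})) * D + K \<le> card Z * d"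
  shows "K * card (cls (bireg Y Z D d) (insert (a, z) E) F)
    \<le> D * d * card (cls (bireg Y Z D d) E (insert (a, z) F))"
proof -
  let ?X = "\<lambda>G. G `` {a} \<union> F `` {a}" and ?W = "\<lambda>G. G\<inverse> `` {z} \<union> F\<inverse> `` {z}"
  let ?T = "\<lambda>G. {e \<in> G. e \<notin> E \<and> snd e \<notin> ?X G \<and> fst e \<notin> ?W G}"
  show ?thesis
  \<comment> \<open>To undo the switch, \<open>w\<close> must be a neighbour of \<open>z\<close> and
    \<open>z'\<close> a neighbour of \<open>a\<close>: at most D d choices in every graph.\<close>
  proof (rule double_count[where T = ?T and T' = "\<lambda>G. (G\<inverse> `` {z}) \<times> (G `` {a})"
        and h = "\<lambda>G e. (G - {(a, z), e}) \<union> {(a, snd e), (fst e, z)}"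
        and g = "\<lambda>G e. (G - {(a, snd e), (fst e, z)}) \<union> {(a, z), e}"])
    show "finite (cls (bireg Y Z D d) (insert (a, z) E) F)"
      "finite (cls (bireg Y Z D d) E (insert (a, z) F))"
      using finite_cls finite_bireg fin by blast+
  next
    fix G assume "G \<in> cls (bireg Y Z D d) (insert (a, z) E) F"
    then have G: "G \<in> bireg Y Z D d"
      by (simp add: cls_def)
    have fG: "finite G"
      using fin G finite_subset[of _ "Y \<times> Z"] by (auto simp: bireg_def)
    have cX: "card (?X G) \<le> D + card (F `` {a})"
      using card_Un_le[of "G `` {a}" "F `` {a}"] G az by (auto simp: bireg_def)
    have cW: "card (?W G) \<le> d + card (F\<inverse> `` {z})"
      using card_Un_le[of "G\<inverse> `` {z}" "F\<inverse> `` {z}"] G az by (auto simp: bireg_def)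
    have "card E + card (?X G) * d + card (?W G) * D + K \<le> card Z * d"
      using K mult_le_mono1[OF cX, of d] mult_le_mono1[OF cW, of D] by linarith
    then show "finite (?T G) \<and> K \<le> card (?T G)"
      using card_free_edges[OF fin G, of E "?X G" "?W G" K] fE fG by auto
  next
    fix G assume G: "G \<in> cls (bireg Y Z D d) E (insert (a, z) F)"
    then have fG: "finite G"
      using fin finite_subset[of _ "Y \<times> Z"] by (auto simp: bireg_def cls_def)
    have "card ((G\<inverse> `` {z}) \<times> (G `` {a})) = D * d"
      using G az by (auto simp: bireg_def cls_def card_cartesian_product)
    then show "finite ((G\<inverse> `` {z}) \<times> (G `` {a})) \<and> card ((G\<inverse> `` {z}) \<times> (G `` {a})) \<le> D * d"
      using fG by auto
  next
    fix G e assume G: "G \<in> cls (bireg Y Z D d) (insert (a, z) E) F" and e: "e \<in> ?T G"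
    obtain w z' where [simp]: "e = (w, z')"
      by (cases e)
    have *: "(a, z) \<in> G" "(w, z') \<in> G" "(a, z') \<notin> G" "(w, z) \<notin> G"
      using G e by (auto simp: cls_def)
    have "(G - {(a, z), e}) \<union> {(a, snd e), (fst e, z)} \<in> bireg Y Z D d"
      using switch2_bireg[OF fin _ *] G by (simp add: cls_def)
    moreover have "E \<subseteq> (G - {(a, z), e}) \<union> {(a, snd e), (fst e, z)}"
      using G e az by (auto simp: cls_def)
    moreover have "insert (a, z) F \<inter> ((G - {(a, z), e}) \<union> {(a, snd e), (fst e, z)}) = {}"
      using G e az * by (auto simp: cls_def)
    moreover have "(G - {(a, z), e} \<union> {(a, snd e), (fst e, z)} - {(a, snd e), (fst e, z)}) \<union> {(a, z), e} = G"
      using * by auto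
    ultimately show "(G - {(a, z), e}) \<union> {(a, snd e), (fst e, z)} \<in> cls (bireg Y Z D d) E (insert (a, z) F)
      \<and> e \<in> (((G - {(a, z), e}) \<union> {(a, snd e), (fst e, z)})\<inverse> `` {z}) \<times> (((G - {(a, z), e}) \<union> {(a, snd e), (fst e, z)}) `` {a})
      \<and> (G - {(a, z), e} \<union> {(a, snd e), (fst e, z)} - {(a, snd e), (fst e, z)}) \<union> {(a, z), e} = G"
      by (auto simp: cls_def)
  qed
qed

text \<open>
  With two edges, the number of switches creating the edge \<open>(a, z)\<close> would depend on the number of
  edges between the neighbourhoods of \<open>z\<close> and \<open>a\<close>. With three edges it is controlled by the
  degrees alone.
\<close>

lemma switch_lower:
  assumes fin: "finite Y" "finite Z" and az: "a \<in> Y" "z \<in> Z" "(a, z) \<notin> F"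
    and fE: "finite E" "finite F"
    and K: "\<And>w z'. w \<in> Y \<Longrightarrow> (w, z) \<notin> E \<Longrightarrow> z' \<in> Z \<Longrightarrow>
      card E + (D + card (F `` {w})) * d + (d + card (F\<inverse> `` {z'})) * D + K \<le> card Z * d"
  shows "(D - card (E `` {a})) * (d - card (E\<inverse> `` {z})) * K * card (cls (bireg Y Z D d) E (insert (a, z) F))
    \<le> (card Z * d)\<^sup>2 * card (cls (bireg Y Z D d) (insert (a, z) E) F)"
proof -
  let ?X = "\<lambda>G w. G `` {w} \<union> F `` {w}" and ?W = "\<lambda>G z'. G\<inverse> `` {z'} \<union> F\<inverse> `` {z'}"
  let ?U = "\<lambda>G (z', w). {e \<in> G. e \<notin> E \<and> snd e \<notin> ?X G w \<and> fst e \<notin> ?W G z'}"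
  \<comment> \<open>The edges \<open>(a, z')\<close> and \<open>(w, z)\<close> are removed, so both
    are taken outside \<open>E\<close>; a third edge \<open>(v, x)\<close> from \<open>?U\<close>
    closes the cycle.\<close>
  let ?T1 = "\<lambda>G. (G `` {a} - E `` {a}) \<times> (G\<inverse> `` {z} - E\<inverse> `` {z})"
  let ?T = "\<lambda>G. Sigma (?T1 G) (?U G)"
  \<comment> \<open>Undoing the switch takes two of the inserted edges, \<open>(w, x)\<close> and
    \<open>(v, z')\<close>. Allowing any pair of edges gives (N d)^2 choices with N =
    \<open>card Z\<close>, whatever the structure of the graph.\<close>
  let ?T' = "\<lambda>G. {((z', w), (v, x)). (w, x) \<in> G \<and> (v, z') \<in> G}"
  let ?h = "\<lambda>G ((z', w), (v, x)). (G - {(a, z'), (w, z), (v, x)}) \<union> {(a, z), (w, x), (v, z')}"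
  let ?g = "\<lambda>G ((z', w), (v, x)). (G - {(a, z), (w, x), (v, z')}) \<union> {(a, z'), (w, z), (v, x)}"
  show ?thesis
  proof (rule double_count[where T = ?T and T' = ?T' and h = ?h and g = ?g])
    show "finite (cls (bireg Y Z D d) (insert (a, z) E) F)"
      "finite (cls (bireg Y Z D d) E (insert (a, z) F))"
      using finite_cls finite_bireg fin by blast+
  next
    fix G assume "G \<in> cls (bireg Y Z D d) E (insert (a, z) F)"
    then have G: "G \<in> bireg Y Z D d" and EG: "E \<subseteq> G"
      by (auto simp: cls_def)
    have fG: "finite G"
      using fin G finite_subset[of _ "Y \<times> Z"] by (auto simp: bireg_def)
    have "K \<le> card (?U G t)" if t: "t \<in> ?T1 G" for t
    proof -
      obtain z' w where [simp]: "t = (z', w)"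
        by (cases t)
      have w: "w \<in> Y" "(w, z) \<notin> E" "z' \<in> Z"
        using t G by (auto simp: bireg_def)
      have cX: "card (?X G w) \<le> D + card (F `` {w})"
        using card_Un_le[of "G `` {w}" "F `` {w}"] G w by (auto simp: bireg_def)
      have cW: "card (?W G z') \<le> d + card (F\<inverse> `` {z'})"
        using card_Un_le[of "G\<inverse> `` {z'}" "F\<inverse> `` {z'}"] G w by (auto simp: bireg_def)
      have "card E + card (?X G w) * d + card (?W G z') * D + K \<le> card Z * d"
        using K[OF w] mult_le_mono1[OF cX, of d] mult_le_mono1[OF cW, of D] by linarith
      then show ?thesis
        using card_free_edges[OF fin G, of E "?X G w" "?W G z'" K] fE fG by auto
    qed
    then have "K * card (?T1 G) \<le> (\<Sum>t\<in>?T1 G. card (?U G t))"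
      using sum_bounded_below[of "?T1 G" K "\<lambda>t. card (?U G t)"] by (simp add: mult.commute)
    also have "\<dots> = card (?T G)"
      by (rule card_SigmaI[symmetric]) (use fG in auto)
    finally have *: "K * card (?T1 G) \<le> card (?T G)" .
    have "card (?T1 G) = (D - card (E `` {a})) * (d - card (E\<inverse> `` {z}))"
      using G az EG fE by (subst card_cartesian_product, subst (1 2) card_Diff_subset)
         (auto simp: bireg_def intro: finite_subset)
    then have "(D - card (E `` {a})) * (d - card (E\<inverse> `` {z})) * K \<le> card (?T G)"
      using * by (simp add: mult.commute)
    moreover have "finite (?T G)"
      using fG by auto
    ultimately show "finite (?T G) \<and> (D - card (E `` {a})) * (d - card (E\<inverse> `` {z})) * K \<le> card (?T G)"
      by blast
  next
    fix G assume "G \<in> cls (bireg Y Z D d) (insert (a, z) E) F"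
    then have G: "G \<in> bireg Y Z D d"
      by (simp add: cls_def)
    have fG: "finite G"
      using fin G finite_subset[of _ "Y \<times> Z"] by (auto simp: bireg_def)
    have eq: "?T' G = (\<lambda>((w, x), (v, z')). ((z', w), (v, x))) ` (G \<times> G)"
      by force
    have "card (?T' G) = card (G \<times> G)"
      unfolding eq by (rule card_image) (auto simp: inj_on_def)
    then show "finite (?T' G) \<and> card (?T' G) \<le> (card Z * d)\<^sup>2"
      using card_bireg[OF fin G] fG by (auto simp: eq card_cartesian_product power2_eq_square)
  next
    fix G t assume G: "G \<in> cls (bireg Y Z D d) E (insert (a, z) F)" and t: "t \<in> ?T G"
    obtain z' w v x where [simp]: "t = ((z', w), (v, x))"
      by (cases t) auto
    have *: "(a, z') \<in> G" "(w, z) \<in> G" "(v, x) \<in> G" "(a, z) \<notin> G" "(w, x) \<notin> G" "(v, z') \<notin> G"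
      and **: "(a, z') \<notin> E" "(w, z) \<notin> E" "(v, x) \<notin> E" "(w, x) \<notin> F" "(v, z') \<notin> F"
      using G t by (auto simp: cls_def)
    have "?h G t \<in> bireg Y Z D d"
      using switch3_bireg[OF fin _ *] G by (simp add: cls_def)
    moreover have "insert (a, z) E \<subseteq> ?h G t"
      using G ** by (auto simp: cls_def)
    moreover have "F \<inter> ?h G t = {}"
      using G ** az by (auto simp: cls_def)
    moreover have "?g (?h G t) t = G"
      using * by auto
    ultimately show "?h G t \<in> cls (bireg Y Z D d) (insert (a, z) E) F \<and> t \<in> ?T' (?h G t) \<and> ?g (?h G t) t = G"
      by (simp add: cls_def)
  qed
qed

section \<open>Hall violators under bounded edge odds\<close>

text \<open>The induction of Halmos and Vaughan: at a nonempty proper subset with equality the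
  problem splits into two smaller ones; if there is none, any vertex can be matched to any
  neighbour, since every other nonempty proper subset has one neighbour to spare.\<close>

lemma hall_marriage:
  fixes \<Gamma> :: "'a \<Rightarrow> 'b set"
  assumes "finite A" "\<And>a. a \<in> A \<Longrightarrow> finite (\<Gamma> a)"
    and "\<And>S. S \<subseteq> A \<Longrightarrow> card S \<le> card (\<Union>(\<Gamma> ` S))"
  shows "\<exists>f. inj_on f A \<and> (\<forall>a\<in>A. f a \<in> \<Gamma> a)"
  using assms
proof (induction "card A" arbitrary: A \<Gamma> rule: less_induct)
  case less
  show ?case
  proof (cases "\<exists>S. S \<subset> A \<and> S \<noteq> {} \<and> card (\<Union>(\<Gamma> ` S)) = card S")
    case True
    then obtain S where S: "S \<subset> A" "S \<noteq> {}" "card (\<Union>(\<Gamma> ` S)) = card S"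
      by blast
    have fS: "finite S"
      using S less.prems(1) finite_subset by blast
    have "\<exists>f. inj_on f S \<and> (\<forall>a\<in>S. f a \<in> \<Gamma> a)"
    proof (rule less.hyps)
      show "card S < card A"
        using S less.prems(1) by (simp add: psubset_card_mono)
    qed (use S less.prems fS in auto)
    then obtain f where f: "inj_on f S" "\<forall>a\<in>S. f a \<in> \<Gamma> a"
      by blast
    let ?N = "\<Union>(\<Gamma> ` S)" and ?\<Delta> = "\<lambda>a. \<Gamma> a - \<Union>(\<Gamma> ` S)"
    have "\<exists>g. inj_on g (A - S) \<and> (\<forall>a\<in>A - S. g a \<in> ?\<Delta> a)"
    proof (rule less.hyps)
      show "card (A - S) < card A"
        by (rule psubset_card_mono) (use S less.prems in auto)
    next
      fix T assume T: "T \<subseteq> A - S"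
      have fT: "finite T"
        using T less.prems(1) finite_subset by blast
      have "card T + card S = card (T \<union> S)"
        using T fT fS by (subst card_Un_disjoint) auto
      also have "\<dots> \<le> card (\<Union>(\<Gamma> ` (T \<union> S)))"
        using T S by (intro less.prems(3)) auto
      also have "\<Union>(\<Gamma> ` (T \<union> S)) = \<Union>(?\<Delta> ` T) \<union> ?N"
        by auto
      also have "card \<dots> \<le> card (\<Union>(?\<Delta> ` T)) + card ?N"
        by (rule card_Un_le)
      finally show "card T \<le> card (\<Union>(?\<Delta> ` T))"
        using S by simp
    qed (use less.prems in auto)
    then obtain g where g: "inj_on g (A - S)" "\<forall>a\<in>A - S. g a \<in> ?\<Delta> a"
      by blast
    let ?h = "\<lambda>a. if a \<in> S then f a else g a"
    have "inj_on ?h A"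
    proof (rule inj_onI)
      fix x x' assume x: "x \<in> A" "x' \<in> A" "?h x = ?h x'"
      show "x = x'"
      proof (cases "x \<in> S"; cases "x' \<in> S")
        assume "x \<in> S" "x' \<notin> S"
        then show ?thesis
          using x f g by (metis DiffD2 DiffI UN_I)
      next
        assume "x \<notin> S" "x' \<in> S"
        then show ?thesis
          using x f g by (metis DiffD2 DiffI UN_I)
      qed (use x f g in \<open>auto simp: inj_on_def\<close>)
    qed
    moreover have "\<forall>a\<in>A. ?h a \<in> \<Gamma> a"
      using f g by auto
    ultimately show ?thesis
      by blast
  next
    case False
    show ?thesis
    proof (cases "A = {}")
      case True
      then show ?thesis
        by simp
    next
      case ne: False
      then obtain a where a: "a \<in> A"
        by blast
      have "card {a} \<le> card (\<Gamma> a)"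
        using less.prems(3)[of "{a}"] a by simp
      then obtain b where b: "b \<in> \<Gamma> a"
        by fastforce
      have "\<exists>g. inj_on g (A - {a}) \<and> (\<forall>x\<in>A - {a}. g x \<in> \<Gamma> x - {b})"
      proof (rule less.hyps)
        show "card (A - {a}) < card A"
          by (rule card_Diff1_less[OF less.prems(1) a])
      next
        fix T assume T: "T \<subseteq> A - {a}"
        show "card T \<le> card (\<Union>((\<lambda>x. \<Gamma> x - {b}) ` T))"
        proof (cases "T = {}")
          case False
          have "T \<subset> A"
            using T a by auto
          then have "card (\<Union>(\<Gamma> ` T)) \<noteq> card T" "card T \<le> card (\<Union>(\<Gamma> ` T))"
            using \<open>\<nexists>S. S \<subset> A \<and> S \<noteq> {} \<and> card (\<Union>(\<Gamma> ` S)) = card S\<close> False less.prems(3)[of T]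
            by auto
          then have "card T + 1 \<le> card (\<Union>(\<Gamma> ` T))"
            by simp
          moreover have "\<Union>((\<lambda>x. \<Gamma> x - {b}) ` T) = \<Union>(\<Gamma> ` T) - {b}"
            by auto
          moreover have "card (\<Union>(\<Gamma> ` T)) - 1 \<le> card (\<Union>(\<Gamma> ` T) - {b})"
            by (metis card_Diff_singleton_if diff_le_self order_refl)
          ultimately show ?thesis
            by simp
        qed simp
      qed (use less.prems in auto)
      then obtain g where g: "inj_on g (A - {a})" "\<forall>x\<in>A - {a}. g x \<in> \<Gamma> x - {b}"
        by blast
      have "inj_on (g(a := b)) A"
        using g a by (auto simp: inj_on_def)
      moreover have "\<forall>x\<in>A. (g(a := b)) x \<in> \<Gamma> x"
        using g b by auto
      ultimately show ?thesis
        by blast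
    qed
  qed
qed

section \<open>Classes of graphs with prescribed and forbidden edges\<close>

lemma card_cls_split:
  assumes "finite \<G>"
  shows "card (cls \<G> E F) = card (cls \<G> (insert e E) F) + card (cls \<G> E (insert e F))"
proof -
  have "cls \<G> E F = cls \<G> (insert e E) F \<union> cls \<G> E (insert e F)"
    "cls \<G> (insert e E) F \<inter> cls \<G> E (insert e F) = {}"
    by (auto simp: cls_def)
  then show ?thesis
    using card_Un_disjoint[of "cls \<G> (insert e E) F" "cls \<G> E (insert e F)"] finite_cls[OF assms]
    by metis
qed

lemma cls_empty [simp]: "cls \<G> {} {} = \<G>"
  by (simp add: cls_def)

lemma cls_converse: "cls (converse ` \<G>) (E\<inverse>) (F\<inverse>) = converse ` cls \<G> E F"
proof -
  have *: "E\<inverse> \<subseteq> H\<inverse> \<longleftrightarrow> E \<subseteq> H" "F\<inverse> \<inter> H\<inverse> = {} \<longleftrightarrow> F \<inter> H = {}" for H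
    by (rule converse_mono) (metis converse_Int converse_empty converse_inject)
  show ?thesis
  proof (intro equalityI subsetI)
    fix H assume "H \<in> cls (converse ` \<G>) (E\<inverse>) (F\<inverse>)"
    then obtain G where "G \<in> \<G>" "H = G\<inverse>" "E\<inverse> \<subseteq> G\<inverse>" "F\<inverse> \<inter> G\<inverse> = {}"
      unfolding cls_def by blast
    then show "H \<in> converse ` cls \<G> E F"
      unfolding * cls_def by blast
  next
    fix H assume "H \<in> converse ` cls \<G> E F"
    then obtain G where G: "G \<in> \<G>" "H = G\<inverse>" "E \<subseteq> G" "F \<inter> G = {}"
      unfolding cls_def by blast
    then show "H \<in> cls (converse ` \<G>) (E\<inverse>) (F\<inverse>)"
      unfolding cls_def by (simp add: *)
  qed
qed

lemma card_image_converse: "card (converse ` \<G>) = card \<G>"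
  by (rule card_image) (simp add: inj_on_def converse_inject)

lemma card_UN_bound:
  fixes c :: real
  assumes "finite I" "\<And>i. i \<in> I \<Longrightarrow> real (card (A i)) \<le> c"
  shows "real (card (\<Union>i\<in>I. A i)) \<le> real (card I) * c"
proof -
  have "real (card (\<Union>i\<in>I. A i)) \<le> (\<Sum>i\<in>I. real (card (A i)))"
    using card_UN_le[OF assms(1), of A] by (metis of_nat_le_iff of_nat_sum)
  also have "\<dots> \<le> real (card I) * c"
    by (rule sum_bounded_above) (rule assms(2))
  finally show ?thesis .
qed

text \<open>Abstracts what the switchings give, so that rows and columns can be exchanged.
  \<open>\<beta>0\<close> is the sharp lower bound, with no edge prescribed; \<open>\<beta>1\<close>
  loses a constant factor but tolerates \<open>R\<close> prescribed edges. The set \<open>F\<close>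
  of absent edges is unrestricted in size, since a violator makes very many edges absent.\<close>

locale edge_odds =
  fixes \<G> :: "('a \<times> 'b) set set" and P :: "'a set" and Q :: "'b set"
    and R :: nat and \<alpha> \<beta>0 \<beta>1 :: real
  assumes finite_family: "finite \<G>" and finite_P: "finite P" and finite_Q: "finite Q"
    and nonneg: "0 \<le> \<alpha>" "0 \<le> \<beta>0" "0 \<le> \<beta>1"
    and upper: "E \<subseteq> P \<times> Q \<Longrightarrow> F \<subseteq> P \<times> Q \<Longrightarrow> e \<in> P \<times> Q \<Longrightarrow> e \<notin> E \<Longrightarrow> card E \<le> R \<Longrightarrow>
      card (cls \<G> (insert e E) F) \<le> \<alpha> * card (cls \<G> E (insert e F))"
    and lower0: "F \<subseteq> P \<times> Q \<Longrightarrow> e \<in> P \<times> Q \<Longrightarrow> e \<notin> F \<Longrightarrow>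
      \<beta>0 * card (cls \<G> {} (insert e F)) \<le> card (cls \<G> {e} F)"
    and lower1: "E \<subseteq> P \<times> Q \<Longrightarrow> F \<subseteq> P \<times> Q \<Longrightarrow> e \<in> P \<times> Q \<Longrightarrow> e \<notin> F \<Longrightarrow> card E \<le> R \<Longrightarrow>
      \<beta>1 * card (cls \<G> E (insert e F)) \<le> card (cls \<G> (insert e E) F)"
begin

lemma finite_subset_PQ: "E \<subseteq> P \<times> Q \<Longrightarrow> finite E"
  using finite_P finite_Q finite_subset by blast

text \<open>Lets violators among the columns be handled by the lemmas about rows.\<close>

lemma edge_odds_converse: "edge_odds (converse ` \<G>) Q P R \<alpha> \<beta>0 \<beta>1"
proof
  have conv: "E\<inverse> \<subseteq> P \<times> Q" if "E \<subseteq> Q \<times> P" for E :: "('b \<times> 'a) set"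
    using that by auto
  have cc: "card (cls (converse ` \<G>) E F) = card (cls \<G> (E\<inverse>) (F\<inverse>))" for E F
    using cls_converse[of \<G> "E\<inverse>" "F\<inverse>"] card_image_converse by (metis converse_converse)
  have ins: "(insert e E)\<inverse> = insert (prod.swap e) (E\<inverse>)" for e and E :: "('b \<times> 'a) set"
    by (cases e) auto
  have sw: "prod.swap e \<in> E\<inverse> \<longleftrightarrow> e \<in> E" for e and E :: "('b \<times> 'a) set"
    by (cases e) auto
  have cE: "card (E\<inverse>) = card E" for E :: "('b \<times> 'a) set"
    by simp
  fix E F :: "('b \<times> 'a) set" and e
  assume F: "F \<subseteq> Q \<times> P" and e: "e \<in> Q \<times> P"
  have se: "prod.swap e \<in> P \<times> Q"
    using e by auto
  show "\<beta>0 * card (cls (converse ` \<G>) {} (insert e F)) \<le> card (cls (converse ` \<G>) {e} F)" if "e \<notin> F"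
    using lower0[OF conv[OF F] se] that by (simp add: cc ins sw)
  assume E: "E \<subseteq> Q \<times> P" and R: "card E \<le> R"
  show "card (cls (converse ` \<G>) (insert e E) F) \<le> \<alpha> * card (cls (converse ` \<G>) E (insert e F))" if "e \<notin> E"
    using upper[OF conv[OF E] conv[OF F] se] that R by (simp add: cc ins sw)
  show "\<beta>1 * card (cls (converse ` \<G>) E (insert e F)) \<le> card (cls (converse ` \<G>) (insert e E) F)" if "e \<notin> F"
    using lower1[OF conv[OF E] conv[OF F] se] that R by (simp add: cc ins sw)
qed (use finite_family finite_P finite_Q nonneg in auto)

text \<open>Odds dominate probabilities, so exposing the edges of \<open>E\<close> one by one costs
  a factor \<open>\<alpha>\<close> each.\<close>

lemma card_present:
  assumes "E \<subseteq> P \<times> Q" "card E \<le> R"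
  shows "card (cls \<G> E {}) \<le> \<alpha> ^ card E * card \<G>"
  using finite_subset_PQ[OF assms(1)] assms
proof (induction E rule: finite_induct)
  case (insert e E)
  have "card (cls \<G> (insert e E) {}) \<le> \<alpha> * card (cls \<G> E {e})"
    using insert by (intro upper) auto
  also have "\<dots> \<le> \<alpha> * card (cls \<G> E {})"
    using nonneg card_cls_split[OF finite_family, of E "{}" e] by (intro mult_left_mono) auto
  also have "\<dots> \<le> \<alpha> * (\<alpha> ^ card E * card \<G>)"
    using insert nonneg by (intro mult_left_mono) auto
  finally show ?case
    using insert by (simp add: mult.assoc)
qed simp

text \<open>An edge with conditional odds at least \<open>\<beta>1\<close> is missing with
  conditional probability at most 1 / (1 + \<open>\<beta>1\<close>); the absent edges are exposed
  one by one while \<open>E\<close> stays prescribed.\<close>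

lemma card_absent1:
  assumes "F \<subseteq> P \<times> Q" "E \<subseteq> P \<times> Q" "card E \<le> R"
  shows "(1 + \<beta>1) ^ card F * card (cls \<G> E F) \<le> card (cls \<G> E {})"
  using finite_subset_PQ[OF assms(1)] assms
proof (induction F rule: finite_induct)
  case (insert e F)
  have "(1 + \<beta>1) * card (cls \<G> E (insert e F)) \<le> card (cls \<G> E F)"
    using lower1[of E F e] insert card_cls_split[OF finite_family, of E F e]
    by (simp add: algebra_simps)
  then have "(1 + \<beta>1) ^ card F * ((1 + \<beta>1) * card (cls \<G> E (insert e F))) \<le> (1 + \<beta>1) ^ card F * card (cls \<G> E F)"
    using nonneg by (intro mult_left_mono) auto
  then show ?case
    using insert by (simp add: mult_ac)
qed simp

lemma card_absent0:
  assumes "F \<subseteq> P \<times> Q"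
  shows "(1 + \<beta>0) ^ card F * card (cls \<G> {} F) \<le> card \<G>"
  using finite_subset_PQ[OF assms(1)] assms
proof (induction F rule: finite_induct)
  case (insert e F)
  have "(1 + \<beta>0) * card (cls \<G> {} (insert e F)) \<le> card (cls \<G> {} F)"
    using lower0[of F e] insert card_cls_split[OF finite_family, of "{}" F e]
    by (simp add: algebra_simps)
  then have "(1 + \<beta>0) ^ card F * ((1 + \<beta>0) * card (cls \<G> {} (insert e F))) \<le> (1 + \<beta>0) ^ card F * card (cls \<G> {} F)"
    using nonneg by (intro mult_left_mono) auto
  then show ?case
    using insert by (simp add: mult_ac)
qed simp

lemma card_absent_ge:
  assumes "F \<subseteq> P \<times> Q"
  shows "card \<G> \<le> (1 + \<alpha>) ^ card F * card (cls \<G> {} F)"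
  using finite_subset_PQ[OF assms(1)] assms
proof (induction F rule: finite_induct)
  case (insert e F)
  have "card (cls \<G> {} F) \<le> (1 + \<alpha>) * card (cls \<G> {} (insert e F))"
    using upper[of "{}" F e] insert card_cls_split[OF finite_family, of "{}" F e]
    by (simp add: algebra_simps)
  then have "(1 + \<alpha>) ^ card F * card (cls \<G> {} F) \<le> (1 + \<alpha>) ^ card F * ((1 + \<alpha>) * card (cls \<G> {} (insert e F)))"
    using nonneg by (intro mult_left_mono) auto
  then show ?case
    using insert by (simp add: mult_ac)
qed simp

text \<open>The deficiency \<open>j\<close> is 1 for violators among the rows and 2 for those among
  the columns, because only the row \<open>y\<close> is dropped. The condition of two neighbours is
  what minimality yields, and it forces 2 (s - j) edges to be present.\<close>

definition tight_violators :: "nat \<Rightarrow> nat \<Rightarrow> ('a \<times> 'b) set set" where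
  "tight_violators j s = {G \<in> \<G>. \<exists>S\<subseteq>P. card S = s \<and> card (Q \<inter> G `` S) = s - j \<and>
     (\<forall>t\<in>Q \<inter> G `` S. 2 \<le> card (S \<inter> G\<inverse> `` {t}))}"

lemma finite_tight_violators: "finite (tight_violators j s)"
  unfolding tight_violators_def using finite_family by auto

text \<open>
  A violator that is minimal under inclusion: a vertex of its neighbourhood with only one
  neighbour in it could be removed together with that neighbour.
\<close>

lemma tight_violator_exists:
  assumes "G \<in> \<G>" "S \<subseteq> P" "card (Q \<inter> G `` S) + j \<le> card S" "1 \<le> j"
  shows "\<exists>s. j \<le> s \<and> s \<le> card S \<and> G \<in> tight_violators j s"
  using assms(2,3)
proof (induction "card S" arbitrary: S rule: less_induct)
  case less
  have fS: "finite S"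
    using less.prems finite_P finite_subset by blast
  have fN: "finite (Q \<inter> X)" for X
    using finite_Q by auto
  show ?case
  proof (cases "\<exists>x\<in>S. card (Q \<inter> G `` (S - {x})) + j \<le> card (S - {x})")
    case True
    then obtain x where x: "x \<in> S" "card (Q \<inter> G `` (S - {x})) + j \<le> card (S - {x})"
      by blast
    have "card (S - {x}) < card S"
      by (rule card_Diff1_less[OF fS x(1)])
    then show ?thesis
      using less.hyps[of "S - {x}"] less.prems x by fastforce
  next
    case False
    have ne: "S \<noteq> {}"
      using less.prems assms(4) by auto
    then obtain x0 where x0: "x0 \<in> S"
      by blast
    \<comment> \<open>Dropping \<open>x0\<close> destroys the violation and cannot enlarge the
      neighbourhood, so the neighbourhood has at least \<open>card S - j\<close> vertices; the
      violation gives the other inequality.\<close>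
    have "card (Q \<inter> G `` S) = card S - j"
    proof -
      have "\<not> card (Q \<inter> G `` (S - {x0})) + j \<le> card (S - {x0})"
        using False x0 by blast
      moreover have "card (Q \<inter> G `` (S - {x0})) \<le> card (Q \<inter> G `` S)"
        using fN by (intro card_mono) auto
      ultimately show ?thesis
        using x0 fS less.prems by (simp add: card_Diff_singleton)
    qed
    moreover have "2 \<le> card (S \<inter> G\<inverse> `` {t})" if t: "t \<in> Q \<inter> G `` S" for t
    proof (rule ccontr)
      assume "\<not> 2 \<le> card (S \<inter> G\<inverse> `` {t})"
      moreover from t obtain x where x: "x \<in> S" "(x, t) \<in> G"
        by auto
      ultimately have eq: "S \<inter> G\<inverse> `` {t} = {x}"
        using fS card_le_Suc0_iff_eq[of "S \<inter> G\<inverse> `` {t}"] by auto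
      have "Q \<inter> G `` (S - {x}) \<subseteq> (Q \<inter> G `` S) - {t}"
        using eq by auto
      then have "card (Q \<inter> G `` (S - {x})) \<le> card ((Q \<inter> G `` S) - {t})"
        using fN by (intro card_mono) auto
      also have "\<dots> = card (Q \<inter> G `` S) - 1"
        using t by (simp add: card_Diff_singleton)
      finally have "card (Q \<inter> G `` (S - {x})) \<le> card (Q \<inter> G `` S) - 1" .
      moreover have "card (Q \<inter> G `` S) > 0"
        using t fN card_gt_0_iff by blast
      ultimately have "card (Q \<inter> G `` (S - {x})) + j \<le> card (S - {x})"
        using less.prems x fS by (simp add: card_Diff_singleton)
      then show False
        using False x by blast
    qed
    ultimately have "G \<in> tight_violators j (card S)"
      using assms(1) less.prems unfolding tight_violators_def by blast
    then show ?thesis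
      using less.prems by (intro exI[of _ "card S"]) auto
  qed
qed

lemma card_tight_violators_plain:
  "real (card (tight_violators j s)) \<le>
     real (card P choose s) * (real (card Q choose (s - j)) *
       (real (card \<G>) / (1 + \<beta>0) ^ (s * (card Q - (s - j)))))"
proof -
  let ?SS = "{S. S \<subseteq> P \<and> card S = s}" and ?TT = "{T. T \<subseteq> Q \<and> card T = s - j}"
  have "tight_violators j s \<subseteq> (\<Union>S\<in>?SS. \<Union>T\<in>?TT. cls \<G> {} (S \<times> (Q - T)))"
  proof
    fix G assume "G \<in> tight_violators j s"
    then obtain S where G: "G \<in> \<G>" "S \<in> ?SS" "card (Q \<inter> G `` S) = s - j"
      unfolding tight_violators_def by blast
    moreover have "G \<in> cls \<G> {} (S \<times> (Q - (Q \<inter> G `` S)))"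
      using G unfolding cls_def by auto
    moreover have "Q \<inter> G `` S \<in> ?TT"
      using G by simp
    ultimately show "G \<in> (\<Union>S\<in>?SS. \<Union>T\<in>?TT. cls \<G> {} (S \<times> (Q - T)))"
      by (meson UN_I)
  qed
  then have "card (tight_violators j s) \<le> card (\<Union>S\<in>?SS. \<Union>T\<in>?TT. cls \<G> {} (S \<times> (Q - T)))"
    using finite_P finite_Q finite_cls[OF finite_family] by (intro card_mono finite_UN_I) auto
  then have "real (card (tight_violators j s)) \<le> real (card (\<Union>S\<in>?SS. \<Union>T\<in>?TT. cls \<G> {} (S \<times> (Q - T))))"
    by simp
  also have "\<dots> \<le> real (card ?SS) * (real (card ?TT) *
      (real (card \<G>) / (1 + \<beta>0) ^ (s * (card Q - (s - j)))))"
  proof (intro card_UN_bound)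
    fix S T assume S: "S \<in> ?SS" and T: "T \<in> ?TT"
    have "card (S \<times> (Q - T)) = s * (card Q - (s - j))"
      using S T card_Diff_subset[of T Q] finite_subset[of T Q] finite_Q
      by (auto simp: card_cartesian_product)
    then show "real (card (cls \<G> {} (S \<times> (Q - T)))) \<le> real (card \<G>) / (1 + \<beta>0) ^ (s * (card Q - (s - j)))"
      using card_absent0[of "S \<times> (Q - T)"] S T nonneg
      by (auto simp: pos_le_divide_eq mult.commute Times_subset_cancel2)
  qed (use finite_P finite_Q in auto)
  finally show ?thesis
    using finite_P finite_Q by (simp add: n_subsets)
qed

text \<open>Each vertex of the neighbourhood T is charged with two prescribed edges into S: at most
  s^2 choices and a factor \<open>\<alpha>\<close>^2. The gain over the plain bound is the factor
  \<open>\<alpha>\<close>^2 s^2 per vertex of T, small compared with the number of choices of T as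
  long as s is small.\<close>

lemma card_tight_violators_pattern:
  assumes R: "2 * (s - j) \<le> R"
  shows "real (card (tight_violators j s)) \<le>
     real (card P choose s) * (real (card Q choose (s - j)) * (real ((s choose 2) ^ (s - j)) *
       (\<alpha> ^ (2 * (s - j)) * real (card \<G>) / (1 + \<beta>1) ^ (s * (card Q - (s - j))))))"
proof -
  let ?SS = "{S. S \<subseteq> P \<and> card S = s}" and ?TT = "{T. T \<subseteq> Q \<and> card T = s - j}"
  \<comment> \<open>A pattern picks a pair of rows for every column of T. The pairs are indexed by
    columns, hence the swap in \<open>?E\<close>.\<close>
  let ?HH = "\<lambda>S T. PiE T (\<lambda>_. {X. X \<subseteq> S \<and> card X = 2})"
  let ?E = "\<lambda>h T. prod.swap ` (SIGMA t:T. h t)"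
  let ?U = "\<Union>S\<in>?SS. \<Union>T\<in>?TT. \<Union>h\<in>?HH S T. cls \<G> (?E h T) (S \<times> (Q - T))"
  have fin: "finite S" "finite T" "finite (?HH S T)" if "S \<in> ?SS" "T \<in> ?TT" for S T
  proof -
    show *: "finite S" "finite T"
      using that finite_P finite_Q finite_subset by auto
    then show "finite (?HH S T)"
      by (intro finite_PiE) auto
  qed
  have "tight_violators j s \<subseteq> ?U"
  proof
    fix G assume "G \<in> tight_violators j s"
    then obtain S where G: "G \<in> \<G>" and S: "S \<subseteq> P" "card S = s"
      and T: "card (Q \<inter> G `` S) = s - j" and two: "\<And>t. t \<in> Q \<inter> G `` S \<Longrightarrow> 2 \<le> card (S \<inter> G\<inverse> `` {t})"
      unfolding tight_violators_def by blast
    have "\<exists>X. X \<subseteq> S \<inter> G\<inverse> `` {t} \<and> card X = 2" if "t \<in> Q \<inter> G `` S" for t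
      using obtain_subset_with_card_n[OF two[OF that]] by metis
    then obtain h where h: "\<And>t. t \<in> Q \<inter> G `` S \<Longrightarrow> h t \<subseteq> S \<inter> G\<inverse> `` {t} \<and> card (h t) = 2"
      by metis
    let ?h = "restrict h (Q \<inter> G `` S)"
    have "?h \<in> ?HH S (Q \<inter> G `` S)"
      using h by auto
    moreover have "G \<in> cls \<G> (?E ?h (Q \<inter> G `` S)) (S \<times> (Q - (Q \<inter> G `` S)))"
    proof -
      have "e \<in> G" if "e \<in> ?E ?h (Q \<inter> G `` S)" for e
      proof -
        have "Sigma (Q \<inter> G `` S) ?h = Sigma (Q \<inter> G `` S) h"
          by (rule Sigma_cong) (rule refl, erule restrict_apply')
        with that have "e \<in> prod.swap ` Sigma (Q \<inter> G `` S) h"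
          by (simp only:)
        then obtain t x where "t \<in> Q \<inter> G `` S" "x \<in> h t" "e = (x, t)"
          by (metis (no_types, lifting) SigmaE imageE swap_simp)
        then show ?thesis
          using h[of t] by blast
      qed
      then show ?thesis
        using G unfolding cls_def by blast
    qed
    ultimately show "G \<in> ?U"
      using S T by blast
  qed
  moreover have "finite ?U"
    by (rule finite_subset[OF _ finite_family]) (simp add: cls_def UN_subset_iff)
  ultimately have "real (card (tight_violators j s)) \<le> real (card ?U)"
    by (simp add: card_mono)
  also have "\<dots> \<le> real (card ?SS) * (real (card ?TT) * (real ((s choose 2) ^ (s - j)) *
       (\<alpha> ^ (2 * (s - j)) * real (card \<G>) / (1 + \<beta>1) ^ (s * (card Q - (s - j))))))"
  proof (intro card_UN_bound)
    fix S T assume S: "S \<in> ?SS" and T: "T \<in> ?TT"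
    have cH: "card (?HH S T) = (s choose 2) ^ (s - j)"
      using S T fin[OF S T] by (simp add: card_PiE n_subsets)
    have "real (card (\<Union>h\<in>?HH S T. cls \<G> (?E h T) (S \<times> (Q - T)))) \<le> real (card (?HH S T)) *
        (\<alpha> ^ (2 * (s - j)) * real (card \<G>) / (1 + \<beta>1) ^ (s * (card Q - (s - j))))"
    proof (intro card_UN_bound)
      fix h assume h: "h \<in> ?HH S T"
      have fh: "finite (h t)" "card (h t) = 2" if "t \<in> T" for t
        using h that fin[OF S T] finite_subset[of "h t" S] by (auto simp: PiE_iff)
      have E: "?E h T \<subseteq> P \<times> Q"
      proof -
        have "h t \<subseteq> P" if "t \<in> T" for t
          using h S that by (auto simp: PiE_iff)
        then have "Sigma T h \<subseteq> Q \<times> P"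
          using T by blast
        then show ?thesis
          by auto
      qed
      have "card (?E h T) = card (SIGMA t:T. h t)"
        by (rule card_image) auto
      also have "\<dots> = 2 * (s - j)"
        using fh fin[OF S T] T by (simp add: card_SigmaI)
      finally have cE: "card (?E h T) = 2 * (s - j)" .
      have cF: "card (S \<times> (Q - T)) = s * (card Q - (s - j))"
        using S T card_Diff_subset[of T Q] finite_subset[of T Q] finite_Q
        by (auto simp: card_cartesian_product)
      have "(1 + \<beta>1) ^ (s * (card Q - (s - j))) * card (cls \<G> (?E h T) (S \<times> (Q - T))) \<le> card (cls \<G> (?E h T) {})"
        using card_absent1[of "S \<times> (Q - T)" "?E h T"] S T E cE cF R by auto
      also have "\<dots> \<le> \<alpha> ^ (2 * (s - j)) * card \<G>"
        using card_present[of "?E h T"] E cE R by auto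
      finally show "real (card (cls \<G> (?E h T) (S \<times> (Q - T)))) \<le>
          \<alpha> ^ (2 * (s - j)) * real (card \<G>) / (1 + \<beta>1) ^ (s * (card Q - (s - j)))"
        using nonneg by (subst pos_le_divide_eq) (auto simp: mult.commute)
    qed (use fin[OF S T] in auto)
    then show "real (card (\<Union>h\<in>?HH S T. cls \<G> (?E h T) (S \<times> (Q - T)))) \<le> real ((s choose 2) ^ (s - j)) *
        (\<alpha> ^ (2 * (s - j)) * real (card \<G>) / (1 + \<beta>1) ^ (s * (card Q - (s - j))))"
      using cH by simp
  qed (use finite_P finite_Q in auto)
  finally show ?thesis
    using finite_P finite_Q by (simp add: n_subsets)
qed

end

section \<open>Swapping pairs of rows\<close>

text \<open>
  For a fixed pair of rows \<open>a\<close> and \<open>\<phi> a\<close> the switches exchanging an entry of \<open>a\<close> with one of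
  \<open>\<phi> a\<close> can be undone in the same number of ways, so an entry occurring in exactly one of the two
  rows is at least as likely to be in \<open>a\<close> as in \<open>\<phi> a\<close>, even if \<open>a\<close> avoids further columns.
\<close>

lemma swap_moment:
  fixes \<K> :: "('a \<times> 'b) set set" and \<phi> :: "'a \<Rightarrow> 'a"
  assumes fin: "finite \<K>" "\<And>G. G \<in> \<K> \<Longrightarrow> finite G"
    and closed: "\<And>G a z z'. G \<in> \<K> \<Longrightarrow> a \<in> S \<Longrightarrow> (a, z') \<in> G \<Longrightarrow> (\<phi> a, z) \<in> G \<Longrightarrow>
      (a, z) \<notin> G \<Longrightarrow> (\<phi> a, z') \<notin> G \<Longrightarrow> (G - {(a, z'), (\<phi> a, z)}) \<union> {(a, z), (\<phi> a, z')} \<in> \<K>"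
    and rows: "\<And>G a. G \<in> \<K> \<Longrightarrow> a \<in> S \<Longrightarrow> card (G `` {a}) = card (G `` {\<phi> a})"
    and phi: "inj_on \<phi> S" "\<phi> ` S \<inter> S = {}"
    and F: "finite F" "F \<subseteq> S \<times> UNIV"
  shows "(\<Sum>G\<in>{G \<in> \<K>. F \<inter> G = {}}. 2 ^ card {e \<in> F. (\<phi> (fst e), snd e) \<in> G}) \<le> real (card \<K>)"
  using F
proof (induction F rule: finite_induct)
  case (insert e F)
  obtain a z where e: "e = (a, z)"
    by (cases e)
  have aS: "a \<in> S"
    using insert e by auto
  define w where "w = \<phi> a"
  have wa: "w \<noteq> a" "w \<notin> S"
    using phi aS by (auto simp: w_def)
  let ?c = "\<lambda>F G. card {e \<in> F. (\<phi> (fst e), snd e) \<in> G}"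
  let ?W = "\<lambda>G. 2 ^ ?c F G :: real"
  let ?V = "{G \<in> \<K>. F \<inter> G = {}}"
  define X0 where "X0 = {G \<in> ?V. (a, z) \<notin> G \<and> (w, z) \<notin> G}"
  define X where "X = {G \<in> ?V. (a, z) \<notin> G \<and> (w, z) \<in> G}"
  define X' where "X' = {G \<in> ?V. (a, z) \<in> G \<and> (w, z) \<notin> G}"
  define X1 where "X1 = {G \<in> ?V. (a, z) \<in> G \<and> (w, z) \<in> G}"
  have finX: "finite X0" "finite X" "finite X'" "finite X1"
    using fin by (auto simp: X0_def X_def X'_def X1_def)
  have c0: "?c (insert e F) G = ?c F G" if "G \<in> X0" for G
  proof -
    have "{x \<in> insert e F. (\<phi> (fst x), snd x) \<in> G} = {x \<in> F. (\<phi> (fst x), snd x) \<in> G}"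
      using that by (auto simp: X0_def e w_def)
    then show ?thesis
      by simp
  qed
  have c1: "?c (insert e F) G = Suc (?c F G)" if "G \<in> X" for G
  proof -
    have "{x \<in> insert e F. (\<phi> (fst x), snd x) \<in> G} = insert e {x \<in> F. (\<phi> (fst x), snd x) \<in> G}"
      using that by (auto simp: X_def e w_def)
    then show ?thesis
      using insert by simp
  qed
  \<comment> \<open>The new entry doubles the weight exactly on \<open>X\<close>, while
    \<open>X'\<close> and \<open>X1\<close> contain it and drop out of the left-hand side. The
    induction step therefore reduces to: the weight of \<open>X\<close> is at most that of
    \<open>X'\<close>.\<close>
  have "{G \<in> \<K>. insert e F \<inter> G = {}} = X0 \<union> X" "X0 \<inter> X = {}"
    by (auto simp: X0_def X_def e)
  then have "(\<Sum>G\<in>{G \<in> \<K>. insert e F \<inter> G = {}}. 2 ^ ?c (insert e F) G) =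
      (\<Sum>G\<in>X0. 2 ^ ?c (insert e F) G) + (\<Sum>G\<in>X. 2 ^ ?c (insert e F) G :: real)"
    using finX by (simp add: sum.union_disjoint)
  also have "(\<Sum>G\<in>X0. 2 ^ ?c (insert e F) G) = (\<Sum>G\<in>X0. ?W G)"
    by (rule sum.cong) (simp_all only: c0)
  also have "(\<Sum>G\<in>X. 2 ^ ?c (insert e F) G) = (\<Sum>G\<in>X. ?W G + ?W G)"
    by (rule sum.cong) (simp_all only: c1 power_Suc mult_2)
  also have "\<dots> = (\<Sum>G\<in>X. ?W G) + (\<Sum>G\<in>X. ?W G)"
    by (rule sum.distrib)
  finally have lhs: "(\<Sum>G\<in>{G \<in> \<K>. insert e F \<inter> G = {}}. 2 ^ ?c (insert e F) G) =
      (\<Sum>G\<in>X0. ?W G) + ((\<Sum>G\<in>X. ?W G) + (\<Sum>G\<in>X. ?W G))" .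
  have "?V = X0 \<union> (X \<union> (X' \<union> X1))" "X0 \<inter> (X \<union> (X' \<union> X1)) = {}" "X \<inter> (X' \<union> X1) = {}" "X' \<inter> X1 = {}"
    by (auto simp: X0_def X_def X'_def X1_def)
  then have rhs: "(\<Sum>G\<in>?V. ?W G) =
      (\<Sum>G\<in>X0. ?W G) + ((\<Sum>G\<in>X. ?W G) + ((\<Sum>G\<in>X'. ?W G) + (\<Sum>G\<in>X1. ?W G)))"
    using finX by (simp add: sum.union_disjoint)
  \<comment> \<open>As the two rows have equal size, both differences have \<open>m G\<close>
    elements, and the switch preserves this number. Giving each pair of a graph and a column
    \<open>z'\<close> the weight of the graph over \<open>m G\<close> turns the comparison of
    \<open>X\<close> with \<open>X'\<close> into an injection of pairs.\<close>
  define m where "m G = card (G `` {w} - G `` {a})" for G :: "('a \<times> 'b) set"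
  have m_eq: "m G = card (G `` {a} - G `` {w})" if "G \<in> \<K>" for G
  proof -
    have f: "finite (G `` {w})" "finite (G `` {a})"
      using fin that by auto
    have "card (G `` {w} - G `` {a}) = card (G `` {w}) - card (G `` {w} \<inter> G `` {a})"
      "card (G `` {a} - G `` {w}) = card (G `` {a}) - card (G `` {a} \<inter> G `` {w})"
      using f by (auto intro!: card_Diff_subset_Int)
    then show ?thesis
      using rows[OF that aS] by (simp add: m_def w_def Int_commute)
  qed
  have m_pos: "0 < m G" if "G \<in> \<K>" "(w, z) \<in> G \<and> (a, z) \<notin> G \<or> (a, z) \<in> G \<and> (w, z) \<notin> G" for G
  proof -
    have f: "finite (G `` {w} - G `` {a})" "finite (G `` {a} - G `` {w})"
      using fin that by auto
    from that(2) have "z \<in> G `` {w} - G `` {a} \<or> z \<in> G `` {a} - G `` {w}"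
      by auto
    then show ?thesis
      using f m_eq[OF that(1)] unfolding m_def by (metis card_gt_0_iff empty_iff)
  qed
  define sw where "sw = (\<lambda>(G, z'). ((G - {(a, z'), (w, z)}) \<union> {(a, z), (w, z')}, z' :: 'b))"
  define sw' where "sw' = (\<lambda>(G, z'). ((G - {(a, z), (w, z')}) \<union> {(a, z'), (w, z)}, z' :: 'b))"
  let ?A = "SIGMA G:X. G `` {a} - G `` {w}" and ?B = "SIGMA G:X'. G `` {w} - G `` {a}"
  have finAB: "finite ?A" "finite ?B"
    using finX fin by (auto simp: X_def X'_def)
  have sw_props: "sw p \<in> ?B \<and> ?W (fst (sw p)) = ?W (fst p) \<and> m (fst (sw p)) = m (fst p) \<and> sw' (sw p) = p"
    if p: "p \<in> ?A" for p
  proof -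
    obtain G z' where [simp]: "p = (G, z')"
      by (cases p)
    have G: "G \<in> \<K>" "F \<inter> G = {}" "(a, z) \<notin> G" "(w, z) \<in> G" "(a, z') \<in> G" "(w, z') \<notin> G"
      using p by (auto simp: X_def)
    let ?G = "(G - {(a, z'), (w, z)}) \<union> {(a, z), (w, z')}"
    have GK: "?G \<in> \<K>"
      using closed[OF G(1) aS G(5)] G by (simp add: w_def)
    \<comment> \<open>The weight survives the switch, which touches only the rows \<open>a\<close>
      and \<open>w\<close> in the columns \<open>z\<close> and \<open>z'\<close>. No partner row is
      \<open>a\<close>, only \<open>a\<close> has partner \<open>w\<close>, and neither
      \<open>(a, z)\<close> nor \<open>(a, z')\<close> lies in \<open>F\<close>: the former is the
      new entry, the latter is present in \<open>G\<close>.\<close>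
    have sets: "{x \<in> F. (\<phi> (fst x), snd x) \<in> ?G} = {x \<in> F. (\<phi> (fst x), snd x) \<in> G}"
    proof (rule Collect_cong, rule conj_cong[OF refl])
      fix x assume x: "x \<in> F"
      obtain b u where [simp]: "x = (b, u)"
        by (cases x)
      have b: "b \<in> S" "\<phi> b \<noteq> a"
        using x insert.prems phi aS by auto
      have "b = a" if "\<phi> b = w"
        using that phi b aS by (auto simp: w_def inj_on_def)
      moreover have "(a, z) \<notin> F" "(a, z') \<notin> F"
        using insert.hyps e G by auto
      ultimately have "(\<phi> b, u) \<notin> {(a, z'), (w, z), (a, z), (w, z')}"
        using b x by auto
      then show "(\<phi> (fst x), snd x) \<in> ?G \<longleftrightarrow> (\<phi> (fst x), snd x) \<in> G"
        by auto
    qed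
    have rowsG: "?G `` {w} - ?G `` {a} = insert z' (G `` {w} - G `` {a} - {z})"
      using G wa by auto
    have "m ?G = Suc (card (G `` {w} - G `` {a} - {z}))"
      unfolding m_def rowsG by (rule card_insert_disjoint) (use fin G in auto)
    also have "\<dots> = m G"
      unfolding m_def by (rule card_Suc_Diff1) (use fin G in auto)
    finally have mG: "m ?G = m G" .
    have "F \<inter> ?G = {}"
    proof -
      have "(w, z') \<notin> F" "(a, z) \<notin> F"
        using wa insert.prems insert.hyps e by auto
      then show ?thesis
        using G by auto
    qed
    then have GX: "?G \<in> X'"
      using GK G wa by (auto simp: X'_def)
    have z': "z' \<in> ?G `` {w} - ?G `` {a}"
      unfolding rowsG by (rule insertI1)
    have eq: "sw p = (?G, z')"
      by (simp add: sw_def)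
    show ?thesis
    proof (intro conjI)
      show "sw p \<in> ?B"
        unfolding eq by (rule SigmaI) (fact GX, fact z')
      show "?W (fst (sw p)) = ?W (fst p)"
        unfolding eq unfolding \<open>p = (G, z')\<close> fst_conv sets by (rule refl)
      show "m (fst (sw p)) = m (fst p)"
        unfolding eq unfolding \<open>p = (G, z')\<close> fst_conv by (rule mG)
      show "sw' (sw p) = p"
        using G wa by (auto simp: sw_def sw'_def)
    qed
  qed
  have sub: "sw ` ?A \<subseteq> ?B"
    by (rule image_subsetI) (rule sw_props[THEN conjunct1])
  have inj: "inj_on sw ?A"
    by (rule inj_on_inverseI[where g = sw']) (simp only: sw_props)
  have "(\<Sum>G\<in>X. ?W G) = (\<Sum>G\<in>X. \<Sum>z'\<in>G `` {a} - G `` {w}. ?W G / m G)"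
  proof (rule sum.cong)
    fix G assume "G \<in> X"
    then show "?W G = (\<Sum>z'\<in>G `` {a} - G `` {w}. ?W G / m G)"
      using m_pos[of G] m_eq[of G] by (auto simp: X_def)
  qed simp
  also have "\<dots> = (\<Sum>(G, z')\<in>?A. ?W G / m G)"
    by (rule sum.Sigma) (use finX fin in \<open>auto simp: X_def\<close>)
  also have "\<dots> = (\<Sum>p\<in>?A. ?W (fst (sw p)) / m (fst (sw p)))"
    by (rule sum.cong) (use sw_props in \<open>auto simp: case_prod_beta\<close>)
  also have "\<dots> = (\<Sum>p\<in>sw ` ?A. ?W (fst p) / m (fst p))"
    by (simp only: sum.reindex[OF inj] o_def)
  also have "\<dots> \<le> (\<Sum>p\<in>?B. ?W (fst p) / m (fst p))"
    by (rule sum_mono2[OF finAB(2) sub]) simp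
  also have "\<dots> = (\<Sum>(G, z')\<in>?B. ?W G / m G)"
    by (simp add: case_prod_beta)
  also have "\<dots> = (\<Sum>G\<in>X'. \<Sum>z'\<in>G `` {w} - G `` {a}. ?W G / m G)"
    by (rule sum.Sigma[symmetric]) (use finX fin in \<open>auto simp: X'_def\<close>)
  also have "\<dots> = (\<Sum>G\<in>X'. ?W G)"
  proof (rule sum.cong)
    fix G assume "G \<in> X'"
    then show "(\<Sum>z'\<in>G `` {w} - G `` {a}. ?W G / m G) = ?W G"
      using m_pos[of G] by (auto simp: X'_def m_def)
  qed simp
  finally have "(\<Sum>G\<in>X. ?W G) \<le> (\<Sum>G\<in>X'. ?W G)" .
  moreover have "0 \<le> (\<Sum>G\<in>X1. ?W G)"
    by (rule sum_nonneg) simp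
  ultimately have "(\<Sum>G\<in>{G \<in> \<K>. insert e F \<inter> G = {}}. 2 ^ ?c (insert e F) G) \<le> (\<Sum>G\<in>?V. ?W G)"
    unfolding lhs rhs by linarith
  also have "\<dots> \<le> real (card \<K>)"
    using insert by auto
  finally show ?case .
qed simp

text \<open>Discarding a lightest element never lowers the average. The averages are compared after
  multiplying out, to stay in the naturals.\<close>

lemma exists_heavy_subset:
  fixes f :: "'a \<Rightarrow> nat"
  assumes "finite W" "s \<le> card W"
  shows "\<exists>V\<subseteq>W. card V = s \<and> s * sum f W \<le> card W * sum f V"
  using assms
proof (induction "card W" arbitrary: W)
  case 0
  then show ?case
    by auto
next
  case (Suc c)
  show ?case
  proof (cases "s = Suc c")
    case True
    then show ?thesis
      using Suc by (intro exI[of _ W]) auto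
  next
    case False
    have "W \<noteq> {}"
      using Suc by auto
    then obtain x where x: "x \<in> W" "\<And>v. v \<in> W \<Longrightarrow> f x \<le> f v"
      using Suc.prems(1) by (metis (no_types, lifting) arg_min_if_finite(1) arg_min_least)
    have "\<exists>V\<subseteq>W - {x}. card V = s \<and> s * sum f (W - {x}) \<le> card (W - {x}) * sum f V"
      using Suc x False by (intro Suc.hyps(1)) auto
    then obtain V where V: "V \<subseteq> W - {x}" "card V = s" "s * sum f (W - {x}) \<le> card (W - {x}) * sum f V"
      by blast
    have "s * f x \<le> sum f V"
      using sum_bounded_below[of V "f x" f] x V by auto
    moreover have "sum f W = f x + sum f (W - {x})"
      using Suc.prems(1) x by (simp add: sum.remove)
    moreover have "card W = Suc (card (W - {x}))"
      using card_Suc_Diff1[OF Suc.prems(1) x(1)] by simp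
    ultimately have "s * sum f W \<le> card W * sum f V"
      using V by (simp add: distrib_left)
    then show ?thesis
      using V by blast
  qed
qed

text \<open>The heavy rows depend on the graph, so a union bound runs over all pairings
  \<open>\<phi>\<close>, at most \<open>card Y1 ^ card S\<close> many. For a fixed pairing, Markov's
  inequality with \<open>swap_moment\<close> gives the factor 2^(-q). \<open>S\<close> may be a part
  of the avoiding set \<open>S0\<close>, so that enough rows remain to serve as partners.\<close>

lemma swap_bound:
  fixes \<K> :: "('a \<times> 'b) set set" and q :: real
  assumes fin: "finite \<K>" "\<And>G. G \<in> \<K> \<Longrightarrow> finite G" "finite Y1" "finite U"
    and closed: "\<And>G a w z z'. G \<in> \<K> \<Longrightarrow> a \<in> Y1 \<Longrightarrow> w \<in> Y1 \<Longrightarrow> (a, z') \<in> G \<Longrightarrow> (w, z) \<in> G \<Longrightarrow>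
      (a, z) \<notin> G \<Longrightarrow> (w, z') \<notin> G \<Longrightarrow> (G - {(a, z'), (w, z)}) \<union> {(a, z), (w, z')} \<in> \<K>"
    and rows: "\<And>G a w. G \<in> \<K> \<Longrightarrow> a \<in> Y1 \<Longrightarrow> w \<in> Y1 \<Longrightarrow> card (G `` {a}) = card (G `` {w})"
    and S: "S \<subseteq> Y1" "S \<subseteq> S0"
    and heavy: "\<And>G. G \<in> \<K> \<Longrightarrow> (S0 \<times> U) \<inter> G = {} \<Longrightarrow>
      \<exists>W\<subseteq>Y1 - S. card W = card S \<and> q \<le> (\<Sum>w\<in>W. card (U \<inter> G `` {w}))"
  shows "card {G \<in> \<K>. (S0 \<times> U) \<inter> G = {}} \<le> real (card Y1) ^ card S * (2 powr (-q) * card \<K>)"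
proof -
  let ?\<Phi> = "{\<phi> \<in> PiE S (\<lambda>_. Y1). inj_on \<phi> S \<and> \<phi> ` S \<inter> S = {}}"
  let ?c = "\<lambda>\<phi> G. card {e \<in> S \<times> U. (\<phi> (fst e), snd e) \<in> G}"
  let ?X = "\<lambda>\<phi>. {G \<in> \<K>. (S \<times> U) \<inter> G = {} \<and> q \<le> ?c \<phi> G}"
  have fS: "finite S"
    using S fin finite_subset by blast
  have "{G \<in> \<K>. (S0 \<times> U) \<inter> G = {}} \<subseteq> (\<Union>\<phi>\<in>?\<Phi>. ?X \<phi>)"
  proof
    fix G assume "G \<in> {G \<in> \<K>. (S0 \<times> U) \<inter> G = {}}"
    then have G0: "G \<in> \<K>" "(S0 \<times> U) \<inter> G = {}"
      by auto
    then have G: "G \<in> \<K>" "(S \<times> U) \<inter> G = {}"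
      using S by auto
    from G0 obtain W where W: "W \<subseteq> Y1 - S" "card W = card S" "q \<le> (\<Sum>w\<in>W. card (U \<inter> G `` {w}))"
      using heavy by blast
    have "finite W"
      using W fin finite_subset by blast
    then obtain f where f: "bij_betw f S W"
      using finite_same_card_bij[OF fS] W by metis
    let ?f = "restrict f S"
    have bij: "bij_betw ?f S W"
      using f by (simp add: bij_betw_cong[of S "restrict f S" f])
    have "?f \<in> ?\<Phi>"
      using bij W by (auto simp: bij_betw_def)
    moreover have "?c ?f G = (\<Sum>w\<in>W. card (U \<inter> G `` {w}))"
    proof -
      have "{e \<in> S \<times> U. (?f (fst e), snd e) \<in> G} = (SIGMA a:S. U \<inter> G `` {?f a})"
        by auto
      then have "?c ?f G = (\<Sum>a\<in>S. card (U \<inter> G `` {?f a}))"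
        using fS fin by (simp add: card_SigmaI)
      also have "\<dots> = (\<Sum>w\<in>W. card (U \<inter> G `` {w}))"
        by (rule sum.reindex_bij_betw[OF bij])
      finally show ?thesis .
    qed
    then have "G \<in> ?X ?f"
      using G W by simp
    ultimately show "G \<in> (\<Union>\<phi>\<in>?\<Phi>. ?X \<phi>)"
      by (rule UN_I[of ?f ?\<Phi> G ?X])
  qed
  moreover have "finite (\<Union>\<phi>\<in>?\<Phi>. ?X \<phi>)"
    by (rule finite_subset[OF _ fin(1)]) auto
  ultimately have "real (card {G \<in> \<K>. (S0 \<times> U) \<inter> G = {}}) \<le> real (card (\<Union>\<phi>\<in>?\<Phi>. ?X \<phi>))"
    by (simp add: card_mono)
  also have "\<dots> \<le> real (card ?\<Phi>) * (2 powr (-q) * card \<K>)"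
  proof (rule card_UN_bound)
    show "finite ?\<Phi>"
      using fS fin by (simp add: finite_PiE)
    fix \<phi> assume phi: "\<phi> \<in> ?\<Phi>"
    have phiY: "a \<in> Y1 \<and> \<phi> a \<in> Y1" if "a \<in> S" for a
      using phi S that by auto
    have "2 powr q * card (?X \<phi>) = (\<Sum>G\<in>?X \<phi>. 2 powr q)"
      by simp
    also have "\<dots> \<le> (\<Sum>G\<in>?X \<phi>. 2 ^ ?c \<phi> G)"
    proof (rule sum_mono)
      fix G assume "G \<in> ?X \<phi>"
      then have "2 powr q \<le> 2 powr (real (?c \<phi> G))"
        by (intro powr_mono) auto
      then show "2 powr q \<le> 2 ^ ?c \<phi> G"
        by (simp add: powr_realpow)
    qed
    also have "\<dots> \<le> (\<Sum>G\<in>{G \<in> \<K>. (S \<times> U) \<inter> G = {}}. 2 ^ ?c \<phi> G)"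
      by (rule sum_mono2) (use fin in auto)
    also have "\<dots> \<le> real (card \<K>)"
      by (rule swap_moment[where S = S]) (use fin closed rows phi phiY fS in auto)
    finally have "2 powr (-q) * (2 powr q * card (?X \<phi>)) \<le> 2 powr (-q) * card \<K>"
      by (rule mult_left_mono) simp
    moreover have "2 powr (-q) * (2 powr q * card (?X \<phi>)) = card (?X \<phi>)"
      by (subst mult.assoc[symmetric], subst powr_add[symmetric]) simp
    ultimately show "real (card (?X \<phi>)) \<le> 2 powr (-q) * card \<K>"
      by (simp only:)
  qed
  also have "\<dots> \<le> real (card Y1) ^ card S * (2 powr (-q) * card \<K>)"
  proof (rule mult_right_mono)
    have "card ?\<Phi> \<le> card (PiE S (\<lambda>_. Y1))"
      using fS fin by (intro card_mono finite_PiE) auto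
    also have "\<dots> = card Y1 ^ card S"
      using fS by (simp add: card_PiE)
    finally have "real (card ?\<Phi>) \<le> real (card Y1 ^ card S)"
      by (rule of_nat_mono)
    then show "real (card ?\<Phi>) \<le> real (card Y1) ^ card S"
      by (simp only: of_nat_power)
  qed simp
  finally show ?thesis .
qed

section \<open>Violators in the dense range\<close>

lemma choose_le_power: "(n choose r) \<le> n ^ r"
  by (cases "r \<le> n") (simp_all add: binomial_le_pow binomial_eq_0)

lemma card_UN_le_sum:
  fixes c :: "'i \<Rightarrow> real"
  assumes "finite I" "\<And>i. i \<in> I \<Longrightarrow> real (card (A i)) \<le> c i"
  shows "real (card (\<Union>i\<in>I. A i)) \<le> sum c I"
proof -
  have "real (card (\<Union>i\<in>I. A i)) \<le> real (\<Sum>i\<in>I. card (A i))"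
    using card_UN_le[OF assms(1), of A] by (rule of_nat_mono)
  also have "\<dots> = (\<Sum>i\<in>I. real (card (A i)))"
    by simp
  also have "\<dots> \<le> sum c I"
    by (rule sum_mono) (rule assms(2))
  finally show ?thesis .
qed

lemma sum_powers_le:
  fixes x :: real
  assumes "0 \<le> x" "x \<le> 1/2"
  shows "(\<Sum>s=1..m. x ^ s) \<le> 2 * x"
proof -
  have "(\<Sum>s=1..m. x ^ s) \<le> 2 * x - 2 * (x ^ m * x)"
  proof (induction m)
    case (Suc m)
    have "x ^ m * x * (1 - 2 * x) \<ge> 0"
      using assms by auto
    then show ?case
      using Suc by (simp add: algebra_simps)
  qed (use assms in auto)
  then show ?thesis
    using assms by (smt (verit) mult_nonneg_nonneg zero_le_power)
qed

lemma exists_heavy_rows: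
  fixes f :: "'a \<Rightarrow> nat"
  assumes "finite W" "s \<le> card W" "card W \<le> n" "0 < n"
  shows "\<exists>V\<subseteq>W. card V = s \<and> real s * sum f W / n \<le> (\<Sum>v\<in>V. f v)"
proof -
  obtain V where V: "V \<subseteq> W" "card V = s" "s * sum f W \<le> card W * sum f V"
    using exists_heavy_subset[OF assms(1,2), of f] by blast
  have "s * sum f W \<le> n * sum f V"
    using V(3) assms(3) by (meson le_trans mult_le_mono1)
  then have "real s * real (sum f W) \<le> real n * real (sum f V)"
    by (metis of_nat_le_iff of_nat_mult)
  then have "real s * sum f W / n \<le> sum f V"
    using assms(4) by (simp add: pos_divide_le_eq mult.commute)
  then show ?thesis
    using V by auto
qed

lemma sum_card_rows:
  assumes "finite G" "finite W"
  shows "(\<Sum>w\<in>W. card (U \<inter> G `` {w})) = card {e \<in> G. fst e \<in> W \<and> snd e \<in> U}"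
proof -
  have "{e \<in> G. fst e \<in> W \<and> snd e \<in> U} = (SIGMA w:W. U \<inter> G `` {w})"
    by auto
  then show ?thesis
    using assms by (simp add: card_SigmaI)
qed

lemma half_power_bound:
  fixes M q l :: real
  assumes "1 \<le> M" "real m \<le> M" "s' \<le> s" "real s * l / 8 \<le> q" "0 \<le> c"
  shows "real m ^ s' * (2 powr (-q) * c) \<le> M ^ s * (2 powr (- l / 8)) ^ s * c"
proof -
  have "real m ^ s' \<le> M ^ s'"
    using assms by (intro power_mono) auto
  also have "\<dots> \<le> M ^ s"
    using assms by (intro power_increasing) auto
  finally have 1: "real m ^ s' \<le> M ^ s" .
  have "2 powr (-q) \<le> 2 powr (real s * (- l / 8))"
    using assms by (intro powr_mono) auto
  also have "\<dots> = (2 powr (- l / 8)) ^ s"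
    by (subst powr_realpow[symmetric]) (simp_all add: powr_powr mult.commute)
  finally have 2: "2 powr (-q) \<le> (2 powr (- l / 8)) ^ s" .
  have "real m ^ s' * (2 powr (-q) * c) \<le> M ^ s * ((2 powr (- l / 8)) ^ s * c)"
    using 1 2 assms by (intro mult_mono mult_right_mono mult_nonneg_nonneg) auto
  then show ?thesis
    by (simp add: mult.assoc)
qed

text \<open>A violator of size s costs three factors \<open>M ^ s\<close>, for the choice of S, of a
  set T containing its neighbourhood in B, and of the partner rows, against 2^(-s l / 8) from the
  pairing. This gives a geometric series with ratio \<open>M ^ 3\<close> 2^(-l/8).\<close>

lemma dense_row_violators:
  fixes M :: real
  assumes fin: "finite Y" "finite Z" and yA: "y \<in> A" "A \<subseteq> Y" and B: "card B = D" and cA: "card A = D"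
    and d2: "2 \<le> d" and n9: "9 \<le> card Y" and Dn: "D \<le> card Y" and M: "card Y \<le> M"
    and x: "M ^ 3 * 2 powr (- (real D * real d / card Y) / 8) \<le> 1/2"
  defines "\<K> \<equiv> {G \<in> bireg Y Z D d. G `` {y} = B}"
  shows "card {G \<in> \<K>. \<exists>S\<subseteq>A - {y}. S \<noteq> {} \<and> 2 * card S \<le> D + 1 \<and> card (B \<inter> G `` S) < card S}
    \<le> 2 * (M ^ 3 * 2 powr (- (real D * real d / card Y) / 8)) * card \<K>"
proof (cases "\<K> = {}")
  case True
  then show ?thesis
    by simp
next
  case False
  define l where "l = real D * real d / card Y"
  define r where "r = 2 powr (- l / 8)"
  have r0: "0 \<le> r"
    by (simp add: r_def)
  have M1: "1 \<le> M"
    using M n9 by linarith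
  have BZ: "B \<subseteq> Z"
    using False by (auto simp: \<K>_def bireg_def)
  have finB: "finite B" "finite A"
    using BZ yA fin finite_subset by blast+
  have D1: "1 \<le> D"
    using cA yA finB by (metis card_0_eq empty_iff less_one linorder_not_less)
  have finK: "finite \<K>"
    unfolding \<K>_def using finite_bireg[OF fin] by auto
  let ?X = "\<lambda>S T. {G \<in> \<K>. (S \<times> (B - T)) \<inter> G = {}}"
  let ?SS = "\<lambda>s. {S. S \<subseteq> A - {y} \<and> card S = s}" and ?TT = "\<lambda>s. {T. T \<subseteq> B \<and> card T = s - 1}"
  have single: "card (?X S T) \<le> M ^ s * r ^ s * card \<K>"
    if s: "1 \<le> s" "2 * s \<le> D + 1" and S: "S \<in> ?SS s" and T: "T \<in> ?TT s" for s S T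
  proof -
    let ?U = "B - T"
    define s' where "s' = (s + 1) div 2"
    have fS: "finite S" "S \<subseteq> Y - {y}" "card S = s"
      using S yA fin finite_subset[of S Y] by auto
    have cU: "card ?U = D + 1 - s"
      using T s B finB card_Diff_subset[of T B] finite_subset[of T B] by auto
    obtain S' where S': "S' \<subseteq> S" "card S' = s'"
    proof -
      have "s' \<le> card S"
        using fS s by (simp add: s'_def)
      then show ?thesis
        using obtain_subset_with_card_n that by metis
    qed
    define q where "q = real s' * real (card ?U * (d - 1)) / card Y"
    have "card (?X S T) \<le> real (card (Y - {y})) ^ card S' * (2 powr (-q) * card \<K>)"
    proof (rule swap_bound)
      fix G assume G: "G \<in> \<K>" and e: "(S \<times> ?U) \<inter> G = {}"
      have Gb: "G \<in> bireg Y Z D d" "G `` {y} = B"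
        using G by (auto simp: \<K>_def)
      have fG: "finite G"
        using fin Gb finite_subset[of _ "Y \<times> Z"] by (auto simp: bireg_def)
      let ?W = "Y - {y} - S"
      have cW: "card ?W = card Y - 1 - s"
        using fS fin yA by (subst card_Diff_subset) (auto simp: card_Diff_singleton)
      \<comment> \<open>Each column of \<open>?U\<close> has d edges, one of them from
        \<open>y\<close> and none from S.\<close>
      have sum: "(\<Sum>w\<in>?W. card (?U \<inter> G `` {w})) = card ?U * (d - 1)"
      proof -
        have "{e \<in> G. snd e \<in> ?U} = {e \<in> G. fst e \<in> ?W \<and> snd e \<in> ?U} \<union> {y} \<times> ?U"
          using Gb e by (auto simp: bireg_def)
        then have "card {e \<in> G. snd e \<in> ?U} = card {e \<in> G. fst e \<in> ?W \<and> snd e \<in> ?U} + card ({y} \<times> ?U)"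
          using fG finB by (simp only:) (subst card_Un_disjoint; auto)
        moreover have "card {e \<in> G. snd e \<in> ?U} = card ?U * d"
          by (rule card_edges_columns[OF fin Gb(1)]) (use BZ in auto)
        ultimately show ?thesis
          using fG fin by (simp add: sum_card_rows card_cartesian_product diff_mult_distrib2)
      qed
      \<comment> \<open>Here \<open>9 \<le> card Y\<close> enters: for s = (n + 1) / 2, the n - 1 -
        s rows outside S and \<open>y\<close> number at least (s + 1) / 2 exactly when n is at least
        9.\<close>
      have "s' \<le> card ?W"
        unfolding cW s'_def using s Dn n9 by linarith
      then have "\<exists>V\<subseteq>?W. card V = s' \<and> real s' * (\<Sum>w\<in>?W. card (?U \<inter> G `` {w})) / card Y \<le> (\<Sum>w\<in>V. card (?U \<inter> G `` {w}))"
        by (intro exists_heavy_rows) (use fin cW n9 in auto)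
      then show "\<exists>W\<subseteq>Y - {y} - S'. card W = card S' \<and> q \<le> (\<Sum>w\<in>W. card (?U \<inter> G `` {w}))"
        unfolding sum q_def S'(2) using S' by (meson Diff_mono order_refl order_trans)
    next
      fix G a w z z'
      assume *: "G \<in> \<K>" "a \<in> Y - {y}" "w \<in> Y - {y}" "(a, z') \<in> G" "(w, z) \<in> G" "(a, z) \<notin> G" "(w, z') \<notin> G"
      have "(G - {(a, z'), (w, z)}) \<union> {(a, z), (w, z')} \<in> bireg Y Z D d"
        using switch2_bireg[OF fin, of G D d a z' w z] * by (auto simp: \<K>_def)
      moreover have "((G - {(a, z'), (w, z)}) \<union> {(a, z), (w, z')}) `` {y} = G `` {y}"
        using * by auto
      ultimately show "(G - {(a, z'), (w, z)}) \<union> {(a, z), (w, z')} \<in> \<K>"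
        using * unfolding \<K>_def by blast
    qed (use S' fS fin finK finB in \<open>auto simp: \<K>_def bireg_def intro: finite_subset[of _ "Y \<times> Z"]\<close>)
    also have "\<dots> \<le> M ^ s * (2 powr (- l / 8)) ^ s * card \<K>"
    proof (rule half_power_bound)
      show "real (card (Y - {y})) \<le> M"
        using M card_mono[OF fin(1), of "Y - {y}"] by (meson Diff_subset le_trans of_nat_mono order_trans)
      show "card S' \<le> s"
        using S' s by (simp add: s'_def)
      \<comment> \<open>The 8 in the exponent: a factor 2 each for pairing only half of S, for
        \<open>?U\<close> being about half of B, and for d - 1 in place of d.\<close>
      have a: "real s / 2 \<le> real s'" "real D / 2 \<le> real (card ?U)" "real d / 2 \<le> real (d - 1)"
        using s d2 cU by (auto simp: s'_def of_nat_diff)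
      have "real s / 2 * (real D / 2 * (real d / 2)) \<le> real s' * (real (card ?U) * real (d - 1))"
        using a by (intro mult_mono) auto
      then have "real s / 2 * (real D / 2 * (real d / 2)) / card Y \<le> real s' * (real (card ?U) * real (d - 1)) / card Y"
        by (rule divide_right_mono) simp
      then show "real s * l / 8 \<le> q"
        by (simp add: l_def q_def)
    qed (use M1 in auto)
    finally show ?thesis
      by (simp add: r_def)
  qed
  have "{G \<in> \<K>. \<exists>S\<subseteq>A - {y}. S \<noteq> {} \<and> 2 * card S \<le> D + 1 \<and> card (B \<inter> G `` S) < card S}
      \<subseteq> (\<Union>s\<in>{s\<in>{1..D}. 2 * s \<le> D + 1}. \<Union>S\<in>?SS s. \<Union>T\<in>?TT s. ?X S T)"
  proof
    fix G assume "G \<in> {G \<in> \<K>. \<exists>S\<subseteq>A - {y}. S \<noteq> {} \<and> 2 * card S \<le> D + 1 \<and> card (B \<inter> G `` S) < card S}"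
    then obtain S where G: "G \<in> \<K>" and S: "S \<subseteq> A - {y}" "S \<noteq> {}" "2 * card S \<le> D + 1" "card (B \<inter> G `` S) < card S"
      by blast
    \<comment> \<open>The neighbourhood is enlarged to exactly s - 1 vertices, so that for each s
      all complements B - T have the same size.\<close>
    have "\<exists>T. B \<inter> G `` S \<subseteq> T \<and> T \<subseteq> B \<and> card T = card S - 1"
      by (rule exists_subset_between) (use S B D1 finB in auto)
    then obtain T where T: "B \<inter> G `` S \<subseteq> T" "T \<subseteq> B" "card T = card S - 1"
      by blast
    have "G \<in> ?X S T"
      using G T by auto
    moreover have "card S \<in> {s\<in>{1..D}. 2 * s \<le> D + 1}"
      using S D1 by auto
    ultimately show "G \<in> (\<Union>s\<in>{s\<in>{1..D}. 2 * s \<le> D + 1}. \<Union>S\<in>?SS s. \<Union>T\<in>?TT s. ?X S T)"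
      using S T by blast
  qed
  then have "card {G \<in> \<K>. \<exists>S\<subseteq>A - {y}. S \<noteq> {} \<and> 2 * card S \<le> D + 1 \<and> card (B \<inter> G `` S) < card S}
      \<le> card (\<Union>s\<in>{s\<in>{1..D}. 2 * s \<le> D + 1}. \<Union>S\<in>?SS s. \<Union>T\<in>?TT s. ?X S T)"
    by (intro card_mono finite_subset[OF _ finK]) auto
  then have "real (card {G \<in> \<K>. \<exists>S\<subseteq>A - {y}. S \<noteq> {} \<and> 2 * card S \<le> D + 1 \<and> card (B \<inter> G `` S) < card S})
      \<le> real (card (\<Union>s\<in>{s\<in>{1..D}. 2 * s \<le> D + 1}. \<Union>S\<in>?SS s. \<Union>T\<in>?TT s. ?X S T))"
    by (rule of_nat_mono)
  also have "\<dots> \<le> (\<Sum>s\<in>{s\<in>{1..D}. 2 * s \<le> D + 1}. (M ^ 3 * r) ^ s * card \<K>)"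
  proof (rule card_UN_le_sum)
    fix s assume s: "s \<in> {s\<in>{1..D}. 2 * s \<le> D + 1}"
    have "real (card (\<Union>S\<in>?SS s. \<Union>T\<in>?TT s. ?X S T)) \<le>
        real (card (?SS s)) * (real (card (?TT s)) * (M ^ s * r ^ s * card \<K>))"
      by (intro card_UN_bound single) (use s finB in auto)
    also have "\<dots> \<le> M ^ s * (M ^ s * (M ^ s * r ^ s * card \<K>))"
    proof (intro mult_mono)
      have "card (?SS s) \<le> (D - 1) ^ s"
        using choose_le_power[of "D - 1" s] finB yA cA by (simp add: n_subsets card_Diff_singleton)
      then have "real (card (?SS s)) \<le> real (D - 1) ^ s"
        by (metis of_nat_le_iff of_nat_power)
      also have "\<dots> \<le> M ^ s"
        using M Dn by (intro power_mono) auto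
      finally show "real (card (?SS s)) \<le> M ^ s" .
      have "card (?TT s) \<le> D ^ (s - 1)"
        using choose_le_power[of D "s - 1"] finB B by (simp add: n_subsets)
      then have "real (card (?TT s)) \<le> real D ^ (s - 1)"
        by (metis of_nat_le_iff of_nat_power)
      also have "\<dots> \<le> M ^ (s - 1)"
        using M Dn by (intro power_mono) auto
      also have "\<dots> \<le> M ^ s"
        using M1 by (intro power_increasing) auto
      finally show "real (card (?TT s)) \<le> M ^ s" .
    qed (use M1 r0 in auto)
    also have "\<dots> = (M ^ 3 * r) ^ s * card \<K>"
      by (simp add: power_mult_distrib power3_eq_cube mult_ac)
    finally show "real (card (\<Union>S\<in>?SS s. \<Union>T\<in>?TT s. ?X S T)) \<le> (M ^ 3 * r) ^ s * card \<K>" .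
  qed simp
  also have "\<dots> \<le> (\<Sum>s=1..D. (M ^ 3 * r) ^ s * card \<K>)"
    by (rule sum_mono2) (use M1 r0 in auto)
  also have "\<dots> = (\<Sum>s=1..D. (M ^ 3 * r) ^ s) * card \<K>"
    by (rule sum_distrib_right[symmetric])
  also have "\<dots> \<le> 2 * (M ^ 3 * r) * card \<K>"
    by (intro mult_right_mono sum_powers_le) (use x M1 r0 in \<open>auto simp: r_def l_def\<close>)
  finally show ?thesis
    by (simp add: r_def l_def)
qed

text \<open>The roles of Y and Z are exchanged, without conditioning on the neighbourhood of
  \<open>y\<close>, which swaps between columns need not preserve. In exchange U ranges over subsets
  of Z; this costs \<open>M ^ u\<close>, no more than the other choices.\<close>

lemma dense_column_violators:
  fixes M :: real
  assumes fin: "finite Y" "finite Z" and yA: "y \<in> A" "A \<subseteq> Y" and cA: "card A = D"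
    and N9: "9 \<le> card Z" and DN: "D \<le> card Z" and M: "card Z \<le> M"
    and x: "M ^ 3 * 2 powr (- (real D * real D / card Z) / 8) \<le> 1/2"
  shows "card {G \<in> bireg Y Z D d. \<exists>U\<subseteq>Z. U \<noteq> {} \<and> 2 * card U \<le> D + 1 \<and>
      (\<exists>S\<subseteq>A - {y}. card S = D + 1 - card U \<and> (S \<times> U) \<inter> G = {})}
    \<le> 2 * (M ^ 3 * 2 powr (- (real D * real D / card Z) / 8)) * card (bireg Y Z D d)"
proof -
  define \<K> where "\<K> = bireg Z Y d D"
  have KG: "\<K> = converse ` bireg Y Z D d"
  proof (intro equalityI subsetI)
    fix H assume "H \<in> \<K>"
    then show "H \<in> converse ` bireg Y Z D d"
      using converse_bireg[of H Z Y d D] by (intro image_eqI[of _ _ "H\<inverse>"]) (auto simp: \<K>_def)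
  qed (auto simp: \<K>_def intro: converse_bireg)
  have cK: "card \<K> = card (bireg Y Z D d)"
    unfolding KG by (rule card_image_converse)
  define l where "l = real D * real D / card Z"
  define r where "r = 2 powr (- l / 8)"
  have r0: "0 \<le> r"
    by (simp add: r_def)
  have M1: "1 \<le> M"
    using M N9 by linarith
  have finA: "finite A"
    using yA fin finite_subset by blast
  have D1: "1 \<le> D"
    using cA yA finA by (metis card_0_eq empty_iff less_one linorder_not_less)
  have finK: "finite \<K>"
    unfolding \<K>_def using finite_bireg fin by auto
  let ?X = "\<lambda>U S. {G \<in> \<K>. (U \<times> S) \<inter> G = {}}"
  let ?UU = "\<lambda>u. {U. U \<subseteq> Z \<and> card U = u}" and ?SS = "\<lambda>u. {S. S \<subseteq> A - {y} \<and> card S = D + 1 - u}"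
  have single: "card (?X U S) \<le> M ^ u * r ^ u * card \<K>"
    if u: "1 \<le> u" "2 * u \<le> D + 1" and U: "U \<in> ?UU u" and S: "S \<in> ?SS u" for u U S
  proof -
    define u' where "u' = (u + 1) div 2"
    have fS: "finite U" "U \<subseteq> Z" "card U = u" "S \<subseteq> Y" "finite S"
      using S U yA fin finite_subset[of U Z] finite_subset[of S Y] by auto
    obtain U' where U': "U' \<subseteq> U" "card U' = u'"
    proof -
      have "u' \<le> card U"
        using fS u by (simp add: u'_def)
      then show ?thesis
        using obtain_subset_with_card_n that by metis
    qed
    define q where "q = real u' * real (card S * D) / card Z"
    have "card (?X U S) \<le> real (card Z) ^ card U' * (2 powr (-q) * card \<K>)"
    proof (rule swap_bound)
      fix G assume G: "G \<in> \<K>" and e: "(U \<times> S) \<inter> G = {}"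
      have Gb: "G \<in> bireg Z Y d D"
        using G by (auto simp: \<K>_def)
      have fG: "finite G"
        using fin Gb finite_subset[of _ "Z \<times> Y"] by (auto simp: bireg_def)
      let ?W = "Z - U"
      have cW: "card ?W = card Z - u"
        using fS fin by (subst card_Diff_subset) auto
      have sum: "(\<Sum>w\<in>?W. card (S \<inter> G `` {w})) = card S * D"
      proof -
        have "{e \<in> G. snd e \<in> S} = {e \<in> G. fst e \<in> ?W \<and> snd e \<in> S}"
          using Gb e by (auto simp: bireg_def)
        moreover have "card {e \<in> G. snd e \<in> S} = card S * D"
          by (rule card_edges_columns[OF fin(2,1) Gb]) (use fS in auto)
        ultimately show ?thesis
          using fG fin by (simp add: sum_card_rows)
      qed
      have "u' \<le> card ?W"
        unfolding cW u'_def using u DN N9 by linarith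
      then have "\<exists>V\<subseteq>?W. card V = u' \<and> real u' * (\<Sum>w\<in>?W. card (S \<inter> G `` {w})) / card Z \<le> (\<Sum>w\<in>V. card (S \<inter> G `` {w}))"
        by (intro exists_heavy_rows) (use fin cW N9 in auto)
      then show "\<exists>W\<subseteq>Z - U'. card W = card U' \<and> q \<le> (\<Sum>w\<in>W. card (S \<inter> G `` {w}))"
        unfolding sum q_def U'(2) using U' by (meson Diff_mono order_refl order_trans)
    next
      fix G a w z z'
      assume *: "G \<in> \<K>" "a \<in> Z" "w \<in> Z" "(a, z') \<in> G" "(w, z) \<in> G" "(a, z) \<notin> G" "(w, z') \<notin> G"
      then show "(G - {(a, z'), (w, z)}) \<union> {(a, z), (w, z')} \<in> \<K>"
        using switch2_bireg[OF fin(2,1), of G d D a z' w z] by (auto simp: \<K>_def)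
    qed (use U' fS fin finK in \<open>auto simp: \<K>_def bireg_def intro: finite_subset[of _ "Z \<times> Y"]\<close>)
    also have "\<dots> \<le> M ^ u * (2 powr (- l / 8)) ^ u * card \<K>"
    proof (rule half_power_bound)
      show "card U' \<le> u"
        using U' u by (simp add: u'_def)
      \<comment> \<open>Only two factors 2 are lost here; a third one is given away to reach the
        same exponent l/8 as for rows.\<close>
      have a: "real u / 2 \<le> real u'" "real D / 2 \<le> real (card S)"
        using u S by (auto simp: u'_def)
      have "real u / 2 * (real D / 2 * (real D / 2)) \<le> real u' * (real (card S) * real D)"
        using a by (intro mult_mono) auto
      then have "real u / 2 * (real D / 2 * (real D / 2)) / card Z \<le> real u' * (real (card S) * real D) / card Z"
        by (rule divide_right_mono) simp
      then show "real u * l / 8 \<le> q"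
        by (simp add: l_def q_def)
    qed (use M M1 in auto)
    finally show ?thesis
      by (simp add: r_def)
  qed
  let ?bad = "{G \<in> bireg Y Z D d. \<exists>U\<subseteq>Z. U \<noteq> {} \<and> 2 * card U \<le> D + 1 \<and>
      (\<exists>S\<subseteq>A - {y}. card S = D + 1 - card U \<and> (S \<times> U) \<inter> G = {})}"
  have "converse ` ?bad \<subseteq> (\<Union>u\<in>{u\<in>{1..D}. 2 * u \<le> D + 1}. \<Union>U\<in>?UU u. \<Union>S\<in>?SS u. ?X U S)"
  proof
    fix H assume "H \<in> converse ` ?bad"
    then obtain G U S where H: "H = G\<inverse>" and G: "G \<in> bireg Y Z D d" and U: "U \<subseteq> Z" "U \<noteq> {}" "2 * card U \<le> D + 1"
      and S: "S \<subseteq> A - {y}" "card S = D + 1 - card U" "(S \<times> U) \<inter> G = {}"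
      by blast
    have "H \<in> ?X U S"
      using G S converse_bireg[OF G] by (auto simp: \<K>_def H)
    moreover have "0 < card U"
      using U fin finite_subset[of U Z] by (auto simp: card_gt_0_iff)
    then have "card U \<in> {u\<in>{1..D}. 2 * u \<le> D + 1}"
      using U D1 by auto
    ultimately show "H \<in> (\<Union>u\<in>{u\<in>{1..D}. 2 * u \<le> D + 1}. \<Union>U\<in>?UU u. \<Union>S\<in>?SS u. ?X U S)"
      using S U by blast
  qed
  then have "card (converse ` ?bad) \<le> card (\<Union>u\<in>{u\<in>{1..D}. 2 * u \<le> D + 1}. \<Union>U\<in>?UU u. \<Union>S\<in>?SS u. ?X U S)"
    by (intro card_mono finite_subset[OF _ finK]) auto
  then have "real (card ?bad) \<le> real (card (\<Union>u\<in>{u\<in>{1..D}. 2 * u \<le> D + 1}. \<Union>U\<in>?UU u. \<Union>S\<in>?SS u. ?X U S))"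
    unfolding card_image_converse by (rule of_nat_mono)
  also have "\<dots> \<le> (\<Sum>u\<in>{u\<in>{1..D}. 2 * u \<le> D + 1}. (M ^ 3 * r) ^ u * card \<K>)"
  proof (rule card_UN_le_sum)
    fix u assume u: "u \<in> {u\<in>{1..D}. 2 * u \<le> D + 1}"
    have "real (card (\<Union>U\<in>?UU u. \<Union>S\<in>?SS u. ?X U S)) \<le>
        real (card (?UU u)) * (real (card (?SS u)) * (M ^ u * r ^ u * card \<K>))"
      by (intro card_UN_bound single) (use u fin finA in auto)
    also have "\<dots> \<le> M ^ u * (M ^ u * (M ^ u * r ^ u * card \<K>))"
    proof (intro mult_mono)
      have "card (?UU u) \<le> card Z ^ u"
        using choose_le_power[of "card Z" u] fin by (simp add: n_subsets)
      then have "real (card (?UU u)) \<le> real (card Z) ^ u"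
        by (metis of_nat_le_iff of_nat_power)
      also have "\<dots> \<le> M ^ u"
        using M by (intro power_mono) auto
      finally show "real (card (?UU u)) \<le> M ^ u" .
      \<comment> \<open>S misses only u - 2 of the D - 1 vertices of A - {y}, so it is counted by
        its complement. For u = 1 it would need D vertices, and there is no such S.\<close>
      have "card (?SS u) \<le> D ^ u"
      proof -
        have "card (?SS u) = (D - 1) choose (D + 1 - u)"
          using finA yA cA by (simp add: n_subsets card_Diff_singleton)
        also have "\<dots> \<le> D ^ u"
        proof (cases "2 \<le> u")
          case True
          have "(D - 1) choose (D + 1 - u) = (D - 1) choose (u - 2)"
            using True u by (subst binomial_symmetric) (auto simp: algebra_simps)
          also have "\<dots> \<le> (D - 1) ^ (u - 2)"
            by (rule choose_le_power)
          also have "\<dots> \<le> D ^ (u - 2)"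
            by (rule power_mono) auto
          also have "\<dots> \<le> D ^ u"
            using D1 by (intro power_increasing) auto
          finally show ?thesis .
        next
          case False
          then have "u = 1"
            using u by simp
          then show ?thesis
            using D1 by (simp add: binomial_eq_0)
        qed
        finally show ?thesis .
      qed
      then have "real (card (?SS u)) \<le> real D ^ u"
        by (metis of_nat_le_iff of_nat_power)
      also have "\<dots> \<le> M ^ u"
        using M DN by (intro power_mono) auto
      finally show "real (card (?SS u)) \<le> M ^ u" .
    qed (use M1 r0 in auto)
    also have "\<dots> = (M ^ 3 * r) ^ u * card \<K>"
      by (simp add: power_mult_distrib power3_eq_cube mult_ac)
    finally show "real (card (\<Union>U\<in>?UU u. \<Union>S\<in>?SS u. ?X U S)) \<le> (M ^ 3 * r) ^ u * card \<K>" .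
  qed simp
  also have "\<dots> \<le> (\<Sum>u=1..D. (M ^ 3 * r) ^ u * card \<K>)"
    by (rule sum_mono2) (use M1 r0 in auto)
  also have "\<dots> = (\<Sum>u=1..D. (M ^ 3 * r) ^ u) * card \<K>"
    by (rule sum_distrib_right[symmetric])
  also have "\<dots> \<le> 2 * (M ^ 3 * r) * card \<K>"
    by (intro mult_right_mono sum_powers_le) (use x M1 r0 in \<open>auto simp: r_def l_def\<close>)
  finally show ?thesis
    by (simp add: r_def l_def cK)
qed

section \<open>Conditioning on the out-neighbourhood of a vertex\<close>

lemma inj_on_mod_interval:
  fixes N :: nat
  assumes "\<And>x y. x \<in> X \<Longrightarrow> y \<in> X \<Longrightarrow> x \<le> y \<Longrightarrow> y - x < N"
  shows "inj_on (\<lambda>m. m mod N) X"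
proof (rule linorder_inj_onI)
  fix x y assume xy: "x < y" "x \<in> X" "y \<in> X"
  have "\<not> N dvd y - x"
    using assms[OF xy(2,3)] xy(1) by (auto dest: dvd_imp_le)
  then show "x mod N \<noteq> y mod N"
    using xy mod_eq_dvd_iff_nat[of x y N] by auto
qed auto

text \<open>The n D edges are numbered consecutively, D to a row, and dealt cyclically to the N
  columns. Since \<open>D \<le> N\<close>, the columns dealt to one row are distinct; since n D = N
  d, every column is met d times.\<close>

lemma circulant_bireg:
  assumes nD: "n * D = N * d" and DN: "D \<le> N" and "0 < D"
  shows "(\<lambda>m. (m div D, m mod N)) ` {..<n * D} \<in> bireg {..<n} {..<N} D d" (is "?G \<in> _")
proof -
  have N: "0 < N"
    using assms by simp
  have "?G \<subseteq> {..<n} \<times> {..<N}"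
    using N assms by (auto simp: less_mult_imp_div_less)
  moreover have "card (?G `` {i}) = D" if "i < n" for i
  proof -
    have "?G `` {i} = (\<lambda>m. m mod N) ` {m. m < n * D \<and> m div D = i}"
      by auto
    also have "{m. m < n * D \<and> m div D = i} = {i * D..<i * D + D}"
    proof (intro equalityI subsetI)
      fix m assume "m \<in> {m. m < n * D \<and> m div D = i}"
      then show "m \<in> {i * D..<i * D + D}"
        using \<open>0 < D\<close> by (auto simp: dividend_less_div_times mult.commute) (metis add.commute dividend_less_div_times mult.commute)
    next
      fix m assume m: "m \<in> {i * D..<i * D + D}"
      have "i * D + D \<le> n * D"
        using that by (metis Suc_leI add.commute mult_Suc mult_le_mono1)
      moreover have "m div D = i"
        using m \<open>0 < D\<close> by (intro div_nat_eqI) (auto simp: mult.commute)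
      ultimately show "m \<in> {m. m < n * D \<and> m div D = i}"
        using m by auto
    qed
    also have "card ((\<lambda>m. m mod N) ` \<dots>) = card {i * D..<i * D + D}"
      by (intro card_image inj_on_mod_interval) (use DN in auto)
    finally show ?thesis
      by simp
  qed
  moreover have "card (?G\<inverse> `` {z}) = d" if z: "z < N" for z
  proof -
    have eq: "{m. m < n * D \<and> m mod N = z} = (\<lambda>k. z + N * k) ` {..<d}"
    proof (intro equalityI subsetI)
      fix m assume "m \<in> {m. m < n * D \<and> m mod N = z}"
      then have "m < N * d" "m = z + N * (m div N)"
        by (auto simp: nD)
      moreover have "m div N < d"
        using \<open>m < N * d\<close> by (simp add: less_mult_imp_div_less mult.commute)
      ultimately show "m \<in> (\<lambda>k. z + N * k) ` {..<d}"
        by blast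
    next
      fix m assume "m \<in> (\<lambda>k. z + N * k) ` {..<d}"
      then obtain k where k: "k < d" "m = z + N * k"
        by auto
      have "N * Suc k \<le> N * d"
        using k by (intro mult_le_mono2) simp
      then show "m \<in> {m. m < n * D \<and> m mod N = z}"
        using k z by (simp add: nD)
    qed
    have "?G\<inverse> `` {z} = (\<lambda>m. m div D) ` {m. m < n * D \<and> m mod N = z}"
      by auto
    also have "card \<dots> = card {m. m < n * D \<and> m mod N = z}"
    proof (rule card_image, rule inj_onI)
      fix x x' assume x: "x \<in> {m. m < n * D \<and> m mod N = z}" "x' \<in> {m. m < n * D \<and> m mod N = z}" "x div D = x' div D"
      have "inj_on (\<lambda>m. m mod N) {m. m div D = x div D}"
      proof (rule inj_on_mod_interval)
        fix u v assume u: "u \<in> {m. m div D = x div D}" "v \<in> {m. m div D = x div D}"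
        have "u div D * D + u mod D = u" "v div D * D + v mod D = v" "v mod D < D"
          using \<open>0 < D\<close> by simp_all
        moreover have "u div D = x div D" "v div D = x div D"
          using u by simp_all
        ultimately show "v - u < N"
          using DN by simp
      qed
      then show "x = x'"
        by (rule inj_onD) (use x in auto)
    qed
    also have "\<dots> = d"
      unfolding eq using N by (subst card_image) (auto simp: inj_on_def)
    finally show ?thesis .
  qed
  ultimately show ?thesis
    by (simp add: bireg_def)
qed

lemma Image_map_prod:
  assumes "inj_on f I" "i \<in> I" "fst ` G \<subseteq> I"
  shows "(map_prod f g ` G) `` {f i} = g ` (G `` {i})"
proof (intro equalityI subsetI)
  fix x assume "x \<in> (map_prod f g ` G) `` {f i}"
  then obtain i' z where z: "(i', z) \<in> G" "f i = f i'" "x = g z"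
    by auto
  then have "i' \<in> I"
    using assms(3) by force
  then have "i' = i"
    using assms(1,2) z(2) by (metis inj_onD)
  then show "x \<in> g ` (G `` {i})"
    using z by auto
next
  fix x assume "x \<in> g ` (G `` {i})"
  then show "x \<in> (map_prod f g ` G) `` {f i}"
    by force
qed

lemma bireg_nonempty:
  assumes fin: "finite Y" "finite Z" and "card Y * D = card Z * d" "D \<le> card Z" "0 < D"
  shows "bireg Y Z D d \<noteq> {}"
proof -
  obtain f where f: "bij_betw f {..<card Y} Y"
    using ex_bij_betw_nat_finite[OF fin(1)] by (auto simp: atLeast0LessThan)
  obtain g where g: "bij_betw g {..<card Z} Z"
    using ex_bij_betw_nat_finite[OF fin(2)] by (auto simp: atLeast0LessThan)
  obtain G where G: "G \<in> bireg {..<card Y} {..<card Z} D d"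
    using circulant_bireg[OF assms(3-5)] by blast
  let ?G = "map_prod f g ` G"
  have G_sub: "G \<subseteq> {..<card Y} \<times> {..<card Z}"
    using G by (simp add: bireg_def)
  have conv: "?G\<inverse> = map_prod g f ` (G\<inverse>)"
    by force
  have row: "card (?G `` {f i}) = D" if "i < card Y" for i
  proof -
    have "?G `` {f i} = g ` (G `` {i})"
      by (rule Image_map_prod[of f "{..<card Y}"]) (use f that G_sub in \<open>auto simp: bij_betw_def\<close>)
    also have "card \<dots> = card (G `` {i})"
      by (rule card_image, rule inj_on_subset[of g "{..<card Z}"])
         (use G_sub g in \<open>auto simp: bij_betw_def\<close>)
    finally show ?thesis
      using G that by (simp add: bireg_def)
  qed
  have col: "card (?G\<inverse> `` {g z}) = d" if "z < card Z" for z
  proof -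
    have "?G\<inverse> `` {g z} = f ` (G\<inverse> `` {z})"
      unfolding conv by (rule Image_map_prod[of g "{..<card Z}"]) (use g that G_sub in \<open>auto simp: bij_betw_def\<close>)
    also have "card \<dots> = card (G\<inverse> `` {z})"
      by (rule card_image, rule inj_on_subset[of f "{..<card Y}"])
         (use G_sub f in \<open>auto simp: bij_betw_def\<close>)
    finally show ?thesis
      using G that by (simp add: bireg_def)
  qed
  have fY: "\<exists>i<card Y. v = f i" if "v \<in> Y" for v
    using f that by (auto simp: bij_betw_def)
  have gZ: "\<exists>z<card Z. v = g z" if "v \<in> Z" for v
    using g that by (auto simp: bij_betw_def)
  have "?G \<subseteq> f ` {..<card Y} \<times> g ` {..<card Z}"
    using G_sub by auto
  then have "?G \<subseteq> Y \<times> Z"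
    using f g by (simp add: bij_betw_def)
  moreover have "\<forall>v\<in>Y. card (?G `` {v}) = D"
    using fY row by metis
  moreover have "\<forall>v\<in>Z. card (?G\<inverse> `` {v}) = d"
    using gZ col by metis
  ultimately have "?G \<in> bireg Y Z D d"
    unfolding bireg_def by blast
  then show ?thesis
    by blast
qed

text \<open>Fixing the neighbourhood of \<open>y\<close> amounts to prescribing the edges
  \<open>?E0\<close> and forbidding \<open>?F0\<close>, so the switchings apply with these added to
  E and F. In \<open>\<beta>\<close>, the factor d - 1 - r arises because the edge from
  \<open>y\<close> to the column, like the at most r prescribed ones, must not be removed.\<close>

lemma edge_odds_bireg:
  assumes fin: "finite Y" "finite Z" and yA: "y \<in> A" "A \<subseteq> Y" and B: "B \<subseteq> Z" "card B = D" and cA: "card A = D"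
    and K: "2 * D + 3 * D * d + D * D + K \<le> card Z * d" "0 < K" and R: "R \<le> D"
  defines "\<G> \<equiv> {G \<in> bireg Y Z D d. G `` {y} = B}"
    and "\<beta> \<equiv> \<lambda>r. real (D - r) * real (d - 1 - r) * real K / (real (card Z) * real d)\<^sup>2"
  shows "edge_odds \<G> (A - {y}) B R (real D * real d / real K) (\<beta> 0) (\<beta> R)"
proof -
  let ?E0 = "{y} \<times> B" and ?F0 = "{y} \<times> (Z - B)"
  have fA: "finite A" "finite B"
    using fin yA B finite_subset by blast+
  have cls_eq: "cls \<G> E F = cls (bireg Y Z D d) (?E0 \<union> E) (?F0 \<union> F)" for E F
  proof -
    have "G `` {y} = B \<longleftrightarrow> ?E0 \<subseteq> G \<and> ?F0 \<inter> G = {}" if "G \<in> bireg Y Z D d" for G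
    proof
      assume "?E0 \<subseteq> G \<and> ?F0 \<inter> G = {}"
      moreover have "G `` {y} \<subseteq> Z"
        by (rule bireg_image_subset[OF that])
      ultimately show "G `` {y} = B"
        by blast
    qed auto
    then show ?thesis
      unfolding cls_def \<G>_def by auto
  qed
  \<comment> \<open>However large F is, it lies between A - {y} and B, so it blocks at most D
    columns for a row other than \<open>y\<close> and, together with \<open>?F0\<close>, at most D
    rows for a column.\<close>
  have exclusion: "card (?E0 \<union> E) + (D + card ((?F0 \<union> F) `` {w})) * d + (d + card ((?F0 \<union> F)\<inverse> `` {z'})) * D + K \<le> card Z * d"
    if "F \<subseteq> (A - {y}) \<times> B" "card E \<le> R" "w \<noteq> y" for E F w z'
  proof -
    have 1: "card (?E0 \<union> E) \<le> 2 * D"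
      using card_Un_le[of ?E0 E] B R that by (simp add: card_cartesian_product)
    have "(?F0 \<union> F) `` {w} \<subseteq> B"
      using that by auto
    then have 2: "card ((?F0 \<union> F) `` {w}) \<le> D"
      using card_mono[OF fA(2)] B by metis
    have "(?F0 \<union> F)\<inverse> `` {z'} \<subseteq> A"
      using that yA by auto
    then have 3: "card ((?F0 \<union> F)\<inverse> `` {z'}) \<le> D"
      using card_mono[OF fA(1)] cA by metis
    have "(D + card ((?F0 \<union> F) `` {w})) * d \<le> (D + D) * d" "(d + card ((?F0 \<union> F)\<inverse> `` {z'})) * D \<le> (d + D) * D"
      using 2 3 by (intro mult_le_mono1; simp)+
    moreover have "(D + D) * d + (d + D) * D = 3 * D * d + D * D"
      by (simp add: algebra_simps)
    ultimately show ?thesis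
      using 1 K by linarith
  qed
  have fin_sub: "finite E" if "E \<subseteq> (A - {y}) \<times> B" for E
    using that fA finite_subset[of E "(A - {y}) \<times> B"] by auto
  have low: "\<beta> r * card (cls \<G> E (insert e F)) \<le> card (cls \<G> (insert e E) F)"
    if E: "E \<subseteq> (A - {y}) \<times> B" and F: "F \<subseteq> (A - {y}) \<times> B" and e: "e \<in> (A - {y}) \<times> B" "e \<notin> F"
      and r: "card E \<le> r" "r \<le> R" for r E F e
  proof -
    obtain a z where [simp]: "e = (a, z)"
      by (cases e)
    have a: "a \<in> Y" "a \<noteq> y" "z \<in> Z" "z \<in> B" "(a, z) \<notin> F"
      using e yA B by auto
    let ?E = "?E0 \<union> E" and ?F = "?F0 \<union> F"
    have fE: "finite E"
      by (rule fin_sub[OF E])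
    have "(D - card (?E `` {a})) * (d - card (?E\<inverse> `` {z})) * K * card (cls (bireg Y Z D d) ?E (insert (a, z) ?F))
      \<le> (card Z * d)\<^sup>2 * card (cls (bireg Y Z D d) (insert (a, z) ?E) ?F)"
    proof (rule switch_lower)
      fix w z' assume w: "w \<in> Y" "(w, z) \<notin> ?E" "z' \<in> Z"
      \<comment> \<open>In the row \<open>y\<close> all of Z - B is forbidden, which would leave too
        few free edges. This row is never chosen: \<open>z\<close> lies in B, so its edge from
        \<open>y\<close> belongs to \<open>?E0\<close>.\<close>
      then have "w \<noteq> y"
        using a by auto
      then show "card ?E + (D + card (?F `` {w})) * d + (d + card (?F\<inverse> `` {z'})) * D + K \<le> card Z * d"
        using exclusion[OF F] r by auto
    qed (use fin a fA fin_sub[OF E] fin_sub[OF F] in auto)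
    moreover have "(D - r) * (d - 1 - r) * K \<le> (D - card (?E `` {a})) * (d - card (?E\<inverse> `` {z})) * K"
    proof (intro mult_le_mono)
      have "?E `` {a} \<subseteq> snd ` E"
        using a by force
      then have "card (?E `` {a}) \<le> card E"
        using fE by (meson card_image_le card_mono finite_imageI le_trans)
      then show "D - r \<le> D - card (?E `` {a})"
        using r by simp
      have "?E\<inverse> `` {z} \<subseteq> insert y (fst ` E)"
        by force
      then have "card (?E\<inverse> `` {z}) \<le> card (insert y (fst ` E))"
        using fE by (intro card_mono) auto
      also have "\<dots> \<le> Suc (card E)"
        using card_insert_le_m1 fE card_image_le[OF fE, of fst] by (metis card_insert_if finite_imageI Suc_le_mono le_SucI)
      finally show "d - 1 - r \<le> d - card (?E\<inverse> `` {z})"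
        using r by simp
    qed simp
    ultimately have "(D - r) * (d - 1 - r) * K * card (cls (bireg Y Z D d) ?E (insert (a, z) ?F))
      \<le> (card Z * d)\<^sup>2 * card (cls (bireg Y Z D d) (insert (a, z) ?E) ?F)"
      by (meson le_trans mult_le_mono1)
    then have "(D - r) * (d - 1 - r) * K * card (cls \<G> E (insert e F)) \<le> (card Z * d)\<^sup>2 * card (cls \<G> (insert e E) F)"
      by (simp add: cls_eq)
    then have "real ((D - r) * (d - 1 - r) * K * card (cls \<G> E (insert e F))) \<le> real ((card Z * d)\<^sup>2 * card (cls \<G> (insert e E) F))"
      by (rule of_nat_mono)
    moreover have "0 < (real (card Z) * real d)\<^sup>2"
      using K by (auto simp: zero_less_mult_iff intro!: Nat.gr0I)
    ultimately show ?thesis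
      by (simp add: \<beta>_def field_simps)
  qed
  show ?thesis
  proof
    show "finite \<G>" "finite (A - {y})" "finite B"
      using fA finite_bireg[OF fin] by (auto simp: \<G>_def)
    show "0 \<le> real D * real d / real K" "0 \<le> \<beta> 0" "0 \<le> \<beta> R"
      by (simp_all add: \<beta>_def)
  next
    fix E F :: "('a \<times> 'b) set" and e
    assume E: "E \<subseteq> (A - {y}) \<times> B" and F: "F \<subseteq> (A - {y}) \<times> B" and e: "e \<in> (A - {y}) \<times> B" "e \<notin> E" and R: "card E \<le> R"
    obtain a z where [simp]: "e = (a, z)"
      by (cases e)
    have a: "a \<in> Y" "a \<noteq> y" "z \<in> Z" "(a, z) \<notin> E"
      using e yA B by auto
    have "K * card (cls (bireg Y Z D d) (insert (a, z) (?E0 \<union> E)) (?F0 \<union> F))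
      \<le> D * d * card (cls (bireg Y Z D d) (?E0 \<union> E) (insert (a, z) (?F0 \<union> F)))"
      by (rule switch_upper[OF fin]) (use fin a fA fin_sub[OF E] fin_sub[OF F] exclusion[OF F R] in auto)
    then have "K * card (cls \<G> (insert e E) F) \<le> D * d * card (cls \<G> E (insert e F))"
      by (simp add: cls_eq)
    then have "real (K * card (cls \<G> (insert e E) F)) \<le> real (D * d * card (cls \<G> E (insert e F)))"
      by (rule of_nat_mono)
    then show "card (cls \<G> (insert e E) F) \<le> real D * real d / real K * card (cls \<G> E (insert e F))"
      using K by (simp add: field_simps)
  next
    fix F e assume "F \<subseteq> (A - {y}) \<times> B" "e \<in> (A - {y}) \<times> B" "e \<notin> F"
    then show "\<beta> 0 * card (cls \<G> {} (insert e F)) \<le> card (cls \<G> {e} F)"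
      by (intro low) auto
  qed (rule low; simp)
qed

text \<open>
  The second alternative comes from a violator \<open>S\<close> with more than half of the vertices: a set \<open>U\<close> of
  vertices outside its neighbourhood then has at least two neighbours too few in \<open>A - {y}\<close>, which
  has one vertex less than \<open>B\<close>.
\<close>

lemma no_matching_violator:
  assumes G: "G `` {y} = B" and fin: "finite A" "finite B" and y: "y \<in> A" and c: "card A = D" "card B = D"
    and none: "\<nexists>M. perfect_matching A B (induced_bipartite G A B) M"
  shows "(\<exists>S\<subseteq>A - {y}. S \<noteq> {} \<and> 2 * card S \<le> D + 1 \<and> card (B \<inter> G `` S) < card S) \<or>
    (\<exists>U\<subseteq>B. U \<noteq> {} \<and> 2 * card U \<le> D + 1 \<and> (\<exists>S\<subseteq>A - {y}. card S = D + 1 - card U \<and> (S \<times> U) \<inter> G = {}))"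
proof -
  let ?\<Gamma> = "\<lambda>a. B \<inter> G `` {a}"
  have UN: "\<Union>(?\<Gamma> ` S) = B \<inter> G `` S" for S
    by auto
  have "\<exists>S\<subseteq>A - {y}. card (B \<inter> G `` S) < card S"
  proof (rule ccontr)
    assume "\<not> ?thesis"
    then have ge: "card S \<le> card (B \<inter> G `` S)" if "S \<subseteq> A - {y}" for S
      using that by (metis not_less)
    have "\<exists>f. inj_on f (A - {y}) \<and> (\<forall>a\<in>A - {y}. f a \<in> ?\<Gamma> a)"
    proof (rule hall_marriage)
      show "card S \<le> card (\<Union>(?\<Gamma> ` S))" if "S \<subseteq> A - {y}" for S
        unfolding UN by (rule ge[OF that])
    qed (use fin in auto)
    then obtain f where f: "inj_on f (A - {y})" "\<And>a. a \<in> A - {y} \<Longrightarrow> f a \<in> ?\<Gamma> a"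
      by blast
    have "card (f ` (A - {y})) < card B"
      using f c y fin card_gt_0_iff[of A] by (subst card_image) (auto simp: card_Diff_singleton)
    then obtain b where b: "b \<in> B" "b \<notin> f ` (A - {y})"
      using fin by (meson card_mono finite_Diff finite_imageI linorder_not_less subsetI)
    define h where "h = f(y := b)"
    have h: "inj_on h A" "\<And>a. a \<in> A \<Longrightarrow> h a \<in> B \<and> (a, h a) \<in> G"
      using f b G by (auto simp: h_def inj_on_def)
    let ?M = "(\<lambda>a. (a, h a)) ` A"
    have "card ?M = card A"
      by (rule card_image) (simp add: inj_on_def)
    moreover have "vertex_disjoint ?M"
      using h unfolding vertex_disjoint_def by (auto simp: inj_on_def)
    ultimately have "perfect_matching A B (induced_bipartite G A B) ?M"
      using h c unfolding perfect_matching_def induced_bipartite_def by auto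
    then show False
      using none by blast
  qed
  then obtain S where S: "S \<subseteq> A - {y}" "card (B \<inter> G `` S) < card S"
    by blast
  show ?thesis
  proof (cases "2 * card S \<le> D + 1")
    case True
    then show ?thesis
      using S by (metis card.empty not_less_zero)
  next
    case False
    have sD: "card S \<le> D - 1"
      using S fin card_mono[of "A - {y}" S] y c by (auto simp: card_Diff_singleton)
    have "card (B - G `` S) = D - card (B \<inter> G `` S)"
      using fin c by (metis card_Diff_subset_Int finite_Int)
    then have "D + 1 - card S \<le> card (B - G `` S)"
      using S sD by linarith
    then obtain U where U: "U \<subseteq> B - G `` S" "card U = D + 1 - card S"
      using obtain_subset_with_card_n by metis
    have "U \<noteq> {}" "2 * card U \<le> D + 1" "card S = D + 1 - card U"
      using U sD False by auto
    moreover have "(S \<times> U) \<inter> G = {}"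
      using U by auto
    moreover have "U \<subseteq> B"
      using U by auto
    ultimately show ?thesis
      using S(1) by (intro disjI2 exI[of _ U] conjI exI[of _ S])
  qed
qed

lemma perfect_matching_not_isolated:
  assumes "perfect_matching A B (induced_bipartite G A B) M" "finite A" "a \<in> A"
  shows "B \<inter> G `` {a} \<noteq> {}"
proof -
  have M: "M \<subseteq> G \<inter> (A \<times> B)" "vertex_disjoint M" "card M = card A"
    using assms unfolding perfect_matching_def induced_bipartite_def by auto
  have "inj_on fst M"
    using M unfolding vertex_disjoint_def inj_on_def by blast
  then have "card (fst ` M) = card A"
    using M by (simp add: card_image)
  moreover have "fst ` M \<subseteq> A"
    using M by auto
  ultimately have "fst ` M = A"
    using assms(2) by (simp add: card_subset_eq)
  then obtain e where "e \<in> M" "fst e = a"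
    using assms(3) by auto
  then show ?thesis
    using M by (cases e) auto
qed

section \<open>Numerical estimates\<close>

text \<open>s^s / s! is a single term of the series for e^s.\<close>

lemma power_self_le_exp_fact: "real s ^ s \<le> exp 1 ^ s * fact s"
proof -
  have "real s ^ s /\<^sub>R fact s \<le> exp (real s)"
    using sum_le_suminf[OF summable_exp_generic[of "real s"], of "{s}"] by (simp add: exp_def)
  moreover have "exp 1 ^ s = exp (real s)"
    by (simp add: exp_of_nat_mult[symmetric])
  ultimately show ?thesis
    by (simp add: field_simps)
qed

text \<open>In the first bound the factorials absorb s^(2 t), the number of patterns, because s^t /
  s! and s^t / t! are at most e^s. The remaining power D^(2 t) will meet \<open>\<alpha>\<close>^(2
  t), leaving an excess of only D^j. In the second bound s is proportional to D, so binomial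
  coefficients are exponential in s with a constant base.\<close>

lemma choose_pair_bounds:
  fixes D :: real
  assumes m: "real m \<le> D" and l: "real l \<le> D" and s: "s = t + j" "1 \<le> s"
  shows "real (m choose s) * real (l choose t) * real s ^ (2 * t) \<le> D ^ (j + 2 * t) * exp 1 ^ (2 * s)"
    and "real s \<le> D \<Longrightarrow> 0 < \<rho> \<Longrightarrow> \<rho> * D \<le> real s \<Longrightarrow>
      real (m choose s) * real (l choose t) \<le> ((exp 1 / \<rho>)\<^sup>2) ^ s"
proof -
  have D0: "0 \<le> D"
    using m by simp
  have c: "real (n choose r) \<le> D ^ r / fact r" if "real n \<le> D" for n r
  proof -
    have "real ((n choose r) * fact r) \<le> real (n ^ r)"
      using binomial_fact_pow[of n r] by (rule of_nat_mono)
    also have "real (n ^ r) \<le> D ^ r"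
      using that by (simp add: power_mono)
    finally show ?thesis
      by (simp add: field_simps)
  qed
  have "fact s div fact (s - j) \<le> s ^ j"
    using s by (intro fact_div_fact_le_pow) simp
  then have fs: "real (fact s) \<le> real s ^ j * fact t"
  proof -
    have "fact t dvd (fact s :: nat)"
      using s by (intro fact_dvd) simp
    then have "(fact s :: nat) = fact s div fact t * fact t"
      by simp
    also have "\<dots> \<le> s ^ j * fact t"
      using \<open>fact s div fact (s - j) \<le> s ^ j\<close> s by (intro mult_le_mono1) simp
    finally have "real (fact s) \<le> real (s ^ j * fact t)"
      by (rule of_nat_mono)
    then show ?thesis
      by simp
  qed
  have ss: "real s ^ s / fact s \<le> exp 1 ^ s"
    using power_self_le_exp_fact[of s] by (simp add: field_simps)
  have "real s ^ t \<le> real s ^ s"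
    using s by (intro power_increasing) auto
  then have "real s ^ t / fact s \<le> real s ^ s / fact s"
    by (rule divide_right_mono) simp
  with ss have a: "real s ^ t / fact s \<le> exp 1 ^ s"
    by linarith
  have "real s ^ t * fact s \<le> real s ^ t * (real s ^ j * fact t)"
    using fs by (intro mult_left_mono) auto
  then have "real s ^ t / fact t \<le> real s ^ s / fact s"
    using s by (simp add: field_simps power_add)
  with ss have b: "real s ^ t / fact t \<le> exp 1 ^ s"
    by linarith
  have "real (m choose s) * real (l choose t) * real s ^ (2 * t) \<le> (D ^ s / fact s) * (D ^ t / fact t) * real s ^ (2 * t)"
    using c[OF m] c[OF l] D0 by (intro mult_right_mono mult_mono) auto
  also have "\<dots> = D ^ (s + t) * ((real s ^ t / fact s) * (real s ^ t / fact t))"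
    by (simp add: power_add mult_2)
  also have "\<dots> \<le> D ^ (s + t) * (exp 1 ^ s * exp 1 ^ s)"
    using a b D0 by (intro mult_left_mono mult_mono) auto
  also have "\<dots> = D ^ (j + 2 * t) * exp 1 ^ (2 * s)"
  proof -
    have "s + t = j + 2 * t" "s + s = 2 * s"
      using s by auto
    then show ?thesis
      by (simp only: power_add[symmetric])
  qed
  finally show "real (m choose s) * real (l choose t) * real s ^ (2 * t) \<le> D ^ (j + 2 * t) * exp 1 ^ (2 * s)" .
  assume sD: "real s \<le> D" and rho: "0 < \<rho>" "\<rho> * D \<le> real s"
  have "D ^ s / fact s \<le> (exp 1 / \<rho>) ^ s"
  proof -
    have "(\<rho> * D) ^ s \<le> real s ^ s"
      using rho D0 by (intro power_mono) auto
    also have "\<dots> \<le> exp 1 ^ s * fact s"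
      by (rule power_self_le_exp_fact)
    finally show ?thesis
      using rho by (simp add: field_simps power_mult_distrib power_divide)
  qed
  moreover have "D ^ t / fact t \<le> D ^ s / fact s"
  proof -
    have "real (fact s) \<le> D ^ j * fact t"
      using fs sD by (smt (verit) mult_right_mono power_mono fact_ge_zero of_nat_0_le_iff)
    then have "D ^ t * fact s \<le> D ^ t * (D ^ j * fact t)"
      using D0 by (intro mult_left_mono) auto
    then show ?thesis
      using s by (simp add: field_simps power_add)
  qed
  ultimately have "D ^ t / fact t \<le> (exp 1 / \<rho>) ^ s" "D ^ s / fact s \<le> (exp 1 / \<rho>) ^ s"
    by linarith+
  then have "real (m choose s) \<le> (exp 1 / \<rho>) ^ s" "real (l choose t) \<le> (exp 1 / \<rho>) ^ s"
    using c[OF m, of s] c[OF l, of t] by linarith+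
  then have "real (m choose s) * real (l choose t) \<le> (exp 1 / \<rho>) ^ s * (exp 1 / \<rho>) ^ s"
    using rho by (intro mult_mono) auto
  then show "real (m choose s) * real (l choose t) \<le> ((exp 1 / \<rho>)\<^sup>2) ^ s"
    by (simp only: power2_eq_square power_mult_distrib)
qed

section \<open>Summing over all sizes of violators\<close>

context edge_odds
begin

text \<open>
  \<open>t0\<close> accounts for violators of size \<open>j\<close>, which have no neighbours, \<open>\<theta>\<close> for the other small ones,
  where the two neighbours of each vertex of the neighbourhood are used, and \<open>\<theta>0\<close> for those of size
  at least \<open>\<rho> D\<close>, which are few enough for the plain union bound.
\<close>

lemma few_violators:
  fixes D :: nat and \<theta> \<theta>0 \<rho> t0 x u :: real
  assumes P: "card P \<le> D" and Q: "card Q + j = D + 1" and j: "1 \<le> j" "j \<le> D"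
    and t0: "real D ^ j / (1 + \<beta>0) ^ (j * (D + 1 - j)) \<le> t0"
    and th: "0 \<le> \<theta>" "\<And>s. j < s \<Longrightarrow> 2 * (s - j) \<le> R \<Longrightarrow> 1 / (1 + \<beta>1) ^ (D + 1 - s) \<le> \<theta>"
    and x: "x = (real D * \<alpha>)\<^sup>2 * (exp 1)\<^sup>2 * \<theta>" "x \<le> 1/2"
    and th0: "0 \<le> \<theta>0" "\<And>s. 2 * s \<le> D + 1 \<Longrightarrow> 1 / (1 + \<beta>0) ^ (D + 1 - s) \<le> \<theta>0"
    and rho: "0 < \<rho>" "\<And>s. R < 2 * (s - j) \<Longrightarrow> \<rho> * D \<le> real s"
    and u: "u = (exp 1 / \<rho>)\<^sup>2 * \<theta>0" "u \<le> 1/2"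
  shows "card {G \<in> \<G>. \<exists>S\<subseteq>P. card (Q \<inter> G `` S) + j \<le> card S \<and> 2 * card S \<le> D + 1}
    \<le> (t0 + 2 * (real D ^ j * ((exp 1)\<^sup>2 * \<theta>) ^ j) * x + 2 * u) * card \<G>"
proof -
  let ?C = "real D ^ j * ((exp 1)\<^sup>2 * \<theta>) ^ j"
  let ?I = "{s \<in> {j..D}. 2 * s \<le> D + 1}"
  have x0: "0 \<le> x"
    unfolding x(1) using th by simp
  have u0: "0 \<le> u"
    unfolding u(1) using th0 by simp
  have C0: "0 \<le> ?C"
    using th by simp
  have t00: "0 \<le> t0"
    using t0 nonneg by (smt (verit) divide_nonneg_nonneg of_nat_0_le_iff zero_le_power)
  define c where "c s = (if s = j then t0 else if 2 * (s - j) \<le> R then ?C * x ^ (s - j) else u ^ s)" for s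
  have bound: "card (tight_violators j s) \<le> c s * card \<G>" if s: "s \<in> ?I" for s
  proof -
    define t where "t = s - j"
    have st: "s = t + j" "1 \<le> s" and tD: "card Q - t = D + 1 - s"
      using s j Q by (auto simp: t_def)
    have PD: "real (card P) \<le> real D" "real (card Q) \<le> real D"
      using P Q j by auto
    consider "s = j" | "s \<noteq> j" "2 * t \<le> R" | "s \<noteq> j" "R < 2 * t"
      by linarith
    then show ?thesis
    proof cases
      case 1
      have "real (card (tight_violators j s)) \<le> real (card P choose j) * (real (card \<G>) / (1 + \<beta>0) ^ (j * (D + 1 - j)))"
      proof -
        have "card Q = D + 1 - j"
          using Q by simp
        then show ?thesis
          using card_tight_violators_plain[of j j] 1 by simp
      qed
      also have "\<dots> \<le> real D ^ j * (real (card \<G>) / (1 + \<beta>0) ^ (j * (D + 1 - j)))"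
      proof (rule mult_right_mono)
        have "(card P choose j) \<le> card P ^ j"
          by (rule choose_le_power)
        also have "\<dots> \<le> D ^ j"
          using P by (rule power_mono) simp
        finally show "real (card P choose j) \<le> real D ^ j"
          by (metis of_nat_le_iff of_nat_power)
      qed (use nonneg in auto)
      also have "\<dots> = (real D ^ j / (1 + \<beta>0) ^ (j * (D + 1 - j))) * card \<G>"
        by simp
      also have "\<dots> \<le> t0 * card \<G>"
        using t0 by (rule mult_right_mono) simp
      finally show ?thesis
        using 1 by (simp add: c_def)
    next
      case 2
      have th': "1 / (1 + \<beta>1) ^ (s * (D + 1 - s)) \<le> \<theta> ^ s"
      proof -
        have "(1 / (1 + \<beta>1) ^ (D + 1 - s)) ^ s \<le> \<theta> ^ s"
          using th(2)[of s] 2 s nonneg by (intro power_mono) (auto simp: t_def)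
        then show ?thesis
          by (simp add: power_divide power_mult[symmetric] mult.commute)
      qed
      have ch: "real ((s choose 2) ^ t) \<le> real s ^ (2 * t)"
      proof -
        have "(s choose 2) ^ t \<le> (s ^ 2) ^ t"
          by (intro power_mono choose_le_power) simp
        then have "real ((s choose 2) ^ t) \<le> real ((s ^ 2) ^ t)"
          by (rule of_nat_mono)
        then show ?thesis
          by (simp add: power_mult)
      qed
      have "real (card (tight_violators j s)) \<le>
        real (card P choose s) * (real (card Q choose t) * (real ((s choose 2) ^ t) *
          (\<alpha> ^ (2 * t) * real (card \<G>) / (1 + \<beta>1) ^ (s * (D + 1 - s)))))"
        using card_tight_violators_pattern[of s j] 2 tD by (simp add: t_def)
      also have "\<dots> = real (card P choose s) * real (card Q choose t) * real ((s choose 2) ^ t) *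
          (\<alpha> ^ (2 * t) * real (card \<G>) * (1 / (1 + \<beta>1) ^ (s * (D + 1 - s))))"
        by (simp add: mult_ac)
      also have "\<dots> \<le> real (card P choose s) * real (card Q choose t) * real s ^ (2 * t) *
          (\<alpha> ^ (2 * t) * real (card \<G>) * \<theta> ^ s)"
        using ch th' nonneg th by (intro mult_mono mult_left_mono mult_nonneg_nonneg) auto
      also have "\<dots> \<le> real D ^ (j + 2 * t) * exp 1 ^ (2 * s) * (\<alpha> ^ (2 * t) * real (card \<G>) * \<theta> ^ s)"
        using choose_pair_bounds(1)[OF PD st] nonneg th by (intro mult_right_mono) auto
      \<comment> \<open>Regrouped by s = t + j: every vertex of the neighbourhood contributes (D
        \<open>\<alpha>\<close>)^2 e^2 \<open>\<theta>\<close> = x, and the j surplus vertices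
        contribute \<open>?C\<close>.\<close>
      also have "\<dots> = ?C * x ^ t * card \<G>"
        unfolding x(1) st(1) by (simp add: power_add power_mult power_mult_distrib mult_ac power2_eq_square)
      finally show ?thesis
        using 2 by (simp add: c_def t_def)
    next
      case 3
      have th': "1 / (1 + \<beta>0) ^ (s * (D + 1 - s)) \<le> \<theta>0 ^ s"
      proof -
        have "(1 / (1 + \<beta>0) ^ (D + 1 - s)) ^ s \<le> \<theta>0 ^ s"
          using th0(2)[of s] s nonneg by (intro power_mono) auto
        then show ?thesis
          by (simp add: power_divide power_mult[symmetric] mult.commute)
      qed
      have "real (card (tight_violators j s)) \<le>
        real (card P choose s) * (real (card Q choose t) * (real (card \<G>) / (1 + \<beta>0) ^ (s * (D + 1 - s))))"
        using card_tight_violators_plain[of j s] tD by (simp add: t_def)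
      also have "\<dots> = real (card P choose s) * real (card Q choose t) * (card \<G> * (1 / (1 + \<beta>0) ^ (s * (D + 1 - s))))"
        by (simp add: mult_ac)
      also have "\<dots> \<le> ((exp 1 / \<rho>)\<^sup>2) ^ s * (card \<G> * \<theta>0 ^ s)"
        using choose_pair_bounds(2)[OF PD st _ rho(1)] rho(2)[of s] 3 s th' nonneg
        by (intro mult_mono mult_left_mono mult_nonneg_nonneg) (auto simp: t_def)
      also have "\<dots> = u ^ s * card \<G>"
        unfolding u(1) by (simp add: power_mult_distrib mult_ac)
      finally show ?thesis
        using 3 by (simp add: c_def t_def)
    qed
  qed
  have "{G \<in> \<G>. \<exists>S\<subseteq>P. card (Q \<inter> G `` S) + j \<le> card S \<and> 2 * card S \<le> D + 1} \<subseteq> (\<Union>s\<in>?I. tight_violators j s)"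
  proof
    fix G assume "G \<in> {G \<in> \<G>. \<exists>S\<subseteq>P. card (Q \<inter> G `` S) + j \<le> card S \<and> 2 * card S \<le> D + 1}"
    then obtain S where S: "G \<in> \<G>" "S \<subseteq> P" "card (Q \<inter> G `` S) + j \<le> card S" "2 * card S \<le> D + 1"
      by blast
    then obtain s where s: "j \<le> s" "s \<le> card S" "G \<in> tight_violators j s"
      using tight_violator_exists[OF S(1-3) j(1)] by blast
    then have "s \<in> ?I"
      using S P card_mono[OF finite_P S(2)] by auto
    then show "G \<in> (\<Union>s\<in>?I. tight_violators j s)"
      using s by blast
  qed
  then have "card {G \<in> \<G>. \<exists>S\<subseteq>P. card (Q \<inter> G `` S) + j \<le> card S \<and> 2 * card S \<le> D + 1}
      \<le> card (\<Union>s\<in>?I. tight_violators j s)"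
    using finite_tight_violators by (intro card_mono) auto
  then have "real (card {G \<in> \<G>. \<exists>S\<subseteq>P. card (Q \<inter> G `` S) + j \<le> card S \<and> 2 * card S \<le> D + 1})
      \<le> real (card (\<Union>s\<in>?I. tight_violators j s))"
    by (rule of_nat_mono)
  also have "\<dots> \<le> (\<Sum>s\<in>?I. c s * card \<G>)"
    by (rule card_UN_le_sum) (use bound in auto)
  also have "\<dots> = (\<Sum>s\<in>?I. c s) * card \<G>"
    by (rule sum_distrib_right[symmetric])
  also have "\<dots> \<le> (t0 + 2 * ?C * x + 2 * u) * card \<G>"
  proof (rule mult_right_mono)
    have "(\<Sum>s\<in>?I. c s) \<le> (\<Sum>s\<in>{j..D}. c s)"
      by (rule sum_mono2) (use t00 C0 x0 u0 in \<open>auto simp: c_def\<close>)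
    also have "\<dots> = t0 + (\<Sum>s\<in>{j + 1..D}. c s)"
      using j by (simp add: sum.atLeast_Suc_atMost c_def)
    finally have I: "sum c ?I \<le> t0 + (\<Sum>s\<in>{j + 1..D}. c s)" .
    have "(\<Sum>s\<in>{j + 1..D}. c s) \<le> (\<Sum>s\<in>{j + 1..D}. ?C * x ^ (s - j) + u ^ s)"
      by (rule sum_mono) (use C0 x0 u0 in \<open>auto simp: c_def\<close>)
    also have "\<dots> = ?C * (\<Sum>s\<in>{j + 1..D}. x ^ (s - j)) + (\<Sum>s\<in>{j + 1..D}. u ^ s)"
      by (simp add: sum.distrib sum_distrib_left)
    finally have II: "(\<Sum>s\<in>{j + 1..D}. c s) \<le> ?C * (\<Sum>s\<in>{j + 1..D}. x ^ (s - j)) + (\<Sum>s\<in>{j + 1..D}. u ^ s)" .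
    have "(\<Sum>s\<in>{j + 1..D}. x ^ (s - j)) = (\<Sum>i=1..D - j. x ^ i)"
      by (rule sum.reindex_bij_witness[of _ "\<lambda>i. i + j" "\<lambda>s. s - j"]) auto
    also have "\<dots> \<le> 2 * x"
      by (rule sum_powers_le[OF x0 x(2)])
    finally have III: "?C * (\<Sum>s\<in>{j + 1..D}. x ^ (s - j)) \<le> ?C * (2 * x)"
      using C0 by (rule mult_left_mono)
    have "(\<Sum>s\<in>{j + 1..D}. u ^ s) \<le> (\<Sum>s=1..D. u ^ s)"
      by (rule sum_mono2) (use u0 in auto)
    also have "\<dots> \<le> 2 * u"
      by (rule sum_powers_le[OF u0 u(2)])
    finally have "sum c ?I \<le> t0 + (?C * (2 * x) + 2 * u)"
      using I II III by linarith
    also have "?C * (2 * x) = 2 * ?C * x"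
      by (simp only: mult_ac)
    finally show "sum c ?I \<le> t0 + 2 * ?C * x + 2 * u"
      by (simp only: add.assoc)
  qed simp
  finally show ?thesis .
qed

end

text \<open>The constant 4 + k: since d is at least 2, the spared edges number at most D d + 3 D d +
  D^2 = (4 + k) D d, and D d = p N d. The last bound uses 1 / (1 - u) <= 1 + 2 u for 0 <= u <=
  1/2.\<close>

lemma switching_constants:
  fixes n N D d :: nat and k :: real
  defines "p \<equiv> real d / n" and "K \<equiv> N * d - (2 * D + 3 * D * d + D * D)"
  assumes k: "0 < k" and N: "real N = k * n" and D: "real D = k * d" and d: "2 \<le> d" and n: "0 < n"
    and small: "(4 + k) * p \<le> 1/2"
  shows "2 * D + 3 * D * d + D * D + K \<le> N * d" "0 < K"
    and "(1 - (4 + k) * p) * (real N * real d) \<le> real K" "real K \<le> real N * real d"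
    and "real D * real d / real K \<le> p * (1 + 2 * ((4 + k) * p))"
proof -
  have p0: "0 < p"
    using d n by (simp add: p_def)
  have Nd: "0 < real N * real d"
    using N k n d by simp
  have "real (2 * D + 3 * D * d + D * D) = k * d * (2 + 3 * d + k * d)"
    using D by (simp add: algebra_simps)
  also have "\<dots> \<le> k * d * (d + 3 * d + k * d)"
    using k d by (intro mult_left_mono) auto
  also have "\<dots> = (4 + k) * p * (real N * real d)"
    using n by (simp add: p_def N field_simps)
  finally have E: "real (2 * D + 3 * D * d + D * D) \<le> (4 + k) * p * (real N * real d)" .
  also have "\<dots> \<le> 1/2 * (real N * real d)"
    using small Nd by (intro mult_right_mono) auto
  also have "\<dots> < real (N * d)"
    using Nd by simp
  finally have lt: "2 * D + 3 * D * d + D * D < N * d"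
    by (simp only: of_nat_less_iff)
  then show "2 * D + 3 * D * d + D * D + K \<le> N * d" "0 < K"
    by (simp_all add: K_def)
  have K: "real K = real N * real d - real (2 * D + 3 * D * d + D * D)"
    unfolding K_def using lt by (simp only: of_nat_diff less_imp_le of_nat_mult)
  then show Kl: "(1 - (4 + k) * p) * (real N * real d) \<le> real K"
    using E by (simp add: algebra_simps)
  have "0 \<le> real (2 * D + 3 * D * d + D * D)"
    by (rule of_nat_0_le_iff)
  then show "real K \<le> real N * real d"
    using K by linarith
  have "real D * real d \<le> p * (1 + 2 * ((4 + k) * p)) * ((1 - (4 + k) * p) * (real N * real d))"
  proof -
    let ?u = "(4 + k) * p"
    have "0 \<le> ?u * (1 - 2 * ?u)"
      using small k p0 by (intro mult_nonneg_nonneg) auto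
    then have "1 \<le> (1 + 2 * ?u) * (1 - ?u)"
      by (simp add: algebra_simps)
    then have "p * (real N * real d) * 1 \<le> p * (real N * real d) * ((1 + 2 * ?u) * (1 - ?u))"
      using p0 Nd by (intro mult_left_mono) auto
    moreover have "p * (real N * real d) = real D * real d"
      using n by (simp add: p_def N D)
    moreover have "p * (1 + 2 * ?u) * ((1 - ?u) * (real N * real d)) = p * (real N * real d) * ((1 + 2 * ?u) * (1 - ?u))"
      by (simp only: mult_ac)
    ultimately show ?thesis
      by (simp only: mult_1_right)
  qed
  also have "\<dots> \<le> p * (1 + 2 * ((4 + k) * p)) * real K"
    using Kl p0 k by (intro mult_left_mono) auto
  finally show "real D * real d / real K \<le> p * (1 + 2 * ((4 + k) * p))"
    using \<open>0 < K\<close> by (simp add: pos_divide_le_eq)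
qed

lemma switching_odds_bounds:
  fixes n N D d r :: nat and k :: real
  defines "p \<equiv> real d / n" and "K \<equiv> N * d - (2 * D + 3 * D * d + D * D)"
  defines "\<beta> \<equiv> \<lambda>r. real (D - r) * real (d - 1 - r) * real K / (real N * real d)\<^sup>2"
  assumes k: "0 < k" and N: "real N = k * n" and D: "real D = k * d" and d: "2 \<le> d" and n: "0 < n"
    and small: "(4 + k) * p \<le> 1/2"
  shows "\<beta> r \<le> p" "p * (1 - 1 / d - (4 + k) * p) \<le> \<beta> 0"
    and "40 * r \<le> D \<Longrightarrow> 40 * r \<le> d \<Longrightarrow> 200 \<le> d \<Longrightarrow> (4 + k) * p \<le> 1/100 \<Longrightarrow> 93/100 * p \<le> \<beta> r"
proof -
  note c = switching_constants[OF k N D d n small[unfolded p_def], folded p_def K_def]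
  have p0: "0 < p"
    using d n by (simp add: p_def)
  have Nd: "0 < real N * real d"
    using N k n d by simp
  have pN: "real D * real d / (real N * real d) = p"
    using n d k by (simp add: p_def N D)
  have \<beta>_eq: "\<beta> r = real (D - r) * real (d - 1 - r) / (real N * real d) * (real K / (real N * real d))" for r
    by (simp add: \<beta>_def power2_eq_square)
  have "\<beta> r \<le> real D * real d / (real N * real d) * 1"
    unfolding \<beta>_eq using c(4) Nd by (intro mult_mono divide_right_mono) auto
  then show "\<beta> r \<le> p"
    by (simp only: pN mult_1_right)
  have Kl: "1 - (4 + k) * p \<le> real K / (real N * real d)"
    using c(3) Nd by (simp add: pos_le_divide_eq)
  have "p * (1 - 1 / d) = real D * (real d - 1) / (real N * real d)"
    unfolding pN[symmetric] using d by (simp add: field_simps)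
  also have "\<dots> = real (D - 0) * real (d - 1 - 0) / (real N * real d)"
    using d by (simp add: of_nat_diff)
  finally have a: "p * (1 - 1 / d) = real (D - 0) * real (d - 1 - 0) / (real N * real d)" .
  have "p * (1 - 1 / d - (4 + k) * p) \<le> p * ((1 - 1 / d) * (1 - (4 + k) * p))"
    using p0 k d by (intro mult_left_mono) (auto simp: algebra_simps)
  also have "\<dots> = p * (1 - 1 / d) * (1 - (4 + k) * p)"
    by simp
  also have "\<dots> \<le> \<beta> 0"
    unfolding \<beta>_eq a[symmetric] using Kl p0 d by (intro mult_left_mono) auto
  finally show "p * (1 - 1 / d - (4 + k) * p) \<le> \<beta> 0" .
  assume r: "40 * r \<le> D" "40 * r \<le> d" "200 \<le> d" and small': "(4 + k) * p \<le> 1/100"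
  \<comment> \<open>The losses are 1/40 in the row, 1/40 + 1/200 in the column and 1/100 in K; the
    product of what remains exceeds 93/100.\<close>
  have "39/40 * real D \<le> real (D - r)" "97/100 * real d \<le> real (d - 1 - r)"
    using r by (auto simp: of_nat_diff)
  then have "39/40 * real D * (97/100 * real d) \<le> real (D - r) * real (d - 1 - r)"
    by (intro mult_mono) auto
  then have "39/40 * real D * (97/100 * real d) / (real N * real d) \<le> real (D - r) * real (d - 1 - r) / (real N * real d)"
    by (rule divide_right_mono) simp
  moreover have "39/40 * real D * (97/100 * real d) / (real N * real d) = 39/40 * (97/100) * p"
    unfolding pN[symmetric] by simp
  ultimately have b: "39/40 * (97/100) * p \<le> real (D - r) * real (d - 1 - r) / (real N * real d)"
    by (simp only:)
  have "93/100 * p \<le> 39/40 * (97/100) * p * (99/100)"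
    using p0 by simp
  also have "\<dots> \<le> real (D - r) * real (d - 1 - r) / (real N * real d) * (real K / (real N * real d))"
  proof (rule mult_mono[OF b])
    show "99/100 \<le> real K / (real N * real d)"
      using Kl small' by linarith
  qed auto
  finally show "93/100 * p \<le> \<beta> r"
    unfolding \<beta>_eq .
qed

lemma inverse_power_le_exp:
  fixes \<beta> :: real
  assumes "0 \<le> \<beta>" "c \<le> real m * ln (1 + \<beta>)"
  shows "1 / (1 + \<beta>) ^ m \<le> exp (- c)"
proof -
  have "(1 + \<beta>) ^ m = exp (real m * ln (1 + \<beta>))"
    using assms by (simp add: exp_of_nat_mult)
  then show ?thesis
    using assms by (simp add: exp_minus inverse_eq_divide divide_left_mono)
qed

section \<open>Violators and isolated vertices in the sparse range\<close>

context edge_odds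
begin

text \<open>Of the three error terms, only D e^(-l) = exp (-(l - ln D)), due to violators without
  neighbours, is critical at the threshold and needs the exponent l up to a bounded error. The other
  two decay in l alone, so constant factors in their exponents can be lost.\<close>

lemma sparse_violators:
  fixes D :: nat and p l \<rho> :: real
  assumes P: "card P \<le> D" and Q: "card Q + j = D + 1" and j: "j \<in> {1, 2}"
    and D: "200 \<le> D" and l: "l = real D * p" "5 \<le> l" "real D \<le> exp l" and p: "0 < p"
    and a: "\<alpha> \<le> 2 * p" and b: "\<beta>0 \<le> 1" "l - 1/2 \<le> real D * ln (1 + \<beta>0)" "9/10 * p \<le> ln (1 + \<beta>1)"
    and R: "40 * R \<le> D" and rho: "0 < \<rho>" "\<And>s. R < 2 * (s - j) \<Longrightarrow> \<rho> * D \<le> real s"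
    and x: "4 * l\<^sup>2 * (exp 1)\<^sup>2 * exp (- (85/100 * l)) \<le> 1/2"
    and u: "(exp 1 / \<rho>)\<^sup>2 * exp (- (45/100 * l)) \<le> 1/2"
  shows "card {G \<in> \<G>. \<exists>S\<subseteq>P. card (Q \<inter> G `` S) + j \<le> card S \<and> 2 * card S \<le> D + 1}
    \<le> (16 * (real D * exp (- l)) + 8 * exp 1 ^ 6 * l\<^sup>2 * exp (- (l / 2))
        + 2 * ((exp 1 / \<rho>)\<^sup>2 * exp (- (45/100 * l)))) * card \<G>"
proof -
  \<comment> \<open>For deficiency 2 the product of D^j and \<open>\<theta>\<close>^(j + 1) must be
    at most exp (-l/2) although D may be as large as e^l. This requires a constant of at least
    5/6.\<close>
  define \<theta> where "\<theta> = exp (- (85/100 * l))"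
  define X where "X = (real D * \<alpha>)\<^sup>2 * (exp 1)\<^sup>2 * \<theta>"
  have X_le: "X \<le> 4 * l\<^sup>2 * (exp 1)\<^sup>2 * \<theta>"
  proof -
    have "real D * \<alpha> \<le> 2 * l"
      using a l mult_left_mono[OF a, of "real D"] by simp
    then have "(real D * \<alpha>)\<^sup>2 \<le> (2 * l)\<^sup>2"
      using nonneg by (intro power_mono) auto
    then have "(real D * \<alpha>)\<^sup>2 * ((exp 1)\<^sup>2 * \<theta>) \<le> (2 * l)\<^sup>2 * ((exp 1)\<^sup>2 * \<theta>)"
      by (rule mult_right_mono) (simp add: \<theta>_def)
    then show ?thesis
      by (simp add: X_def power_mult_distrib mult_ac)
  qed
  have lnb: "9/10 * l \<le> real D * ln (1 + \<beta>0)"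
    using b l by simp
  have lnb0: "0 \<le> ln (1 + \<beta>0)" "0 \<le> ln (1 + \<beta>1)"
    using nonneg by simp_all
  have Dl: "real D * exp (- l) \<le> 1"
    using l(3) by (simp add: exp_minus field_simps)
  have t1: "real D / (1 + \<beta>0) ^ D \<le> 2 * (real D * exp (- l))"
  proof -
    have "1 / (1 + \<beta>0) ^ D \<le> exp (- (l - 1/2))"
      using b nonneg by (intro inverse_power_le_exp) auto
    also have "\<dots> = exp (1/2) * exp (- l)"
      by (simp add: exp_add[symmetric])
    also have "\<dots> \<le> 2 * exp (- l)"
    proof (rule mult_right_mono)
      have "exp (1/2 :: real) \<le> 1 + 1/2 + (1/2)\<^sup>2"
        by (rule exp_bound) auto
      then show "exp (1/2 :: real) \<le> 2"
        by (simp add: power2_eq_square)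
    qed simp
    finally have "real D * (1 / (1 + \<beta>0) ^ D) \<le> real D * (2 * exp (- l))"
      by (rule mult_left_mono) simp
    then show ?thesis
      by (simp add: mult_ac)
  qed
  have t: "real D ^ j / (1 + \<beta>0) ^ (j * (D + 1 - j)) \<le> 16 * (real D * exp (- l))"
  proof (cases "j = 1")
    case True
    have "0 \<le> real D * exp (- l)"
      by simp
    moreover have "real D ^ j / (1 + \<beta>0) ^ (j * (D + 1 - j)) = real D / (1 + \<beta>0) ^ D"
      using True by simp
    ultimately show ?thesis
      using t1 by linarith
  next
    case False
    then have j2: "j = 2"
      using j by auto
    have pos: "0 < 1 + \<beta>0"
      using nonneg by linarith
    \<comment> \<open>Two columns have 2 (D - 1) entries in A - {y}, two fewer than 2 D. Restoring
      them costs (1 + \<open>\<beta>0\<close>)^2, at most 4.\<close>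
    have e: "(1 + \<beta>0) ^ (2 * (D + 1 - 2)) * (1 + \<beta>0)\<^sup>2 = ((1 + \<beta>0) ^ D)\<^sup>2"
    proof -
      have "2 * (D + 1 - 2) + 2 = D * 2"
        using D by simp
      then show ?thesis
        by (simp only: power_add[symmetric] power_mult[symmetric])
    qed
    have "real D ^ j / (1 + \<beta>0) ^ (j * (D + 1 - j)) = (real D / (1 + \<beta>0) ^ D)\<^sup>2 * (1 + \<beta>0)\<^sup>2"
      unfolding j2 power_divide e[symmetric] using pos by simp
    also have "\<dots> \<le> (2 * (real D * exp (- l)))\<^sup>2 * 2\<^sup>2"
      using t1 b(1) nonneg pos by (intro mult_mono power_mono) auto
    also have "\<dots> = 16 * ((real D * exp (- l)) * (real D * exp (- l)))"
      by (simp add: power2_eq_square)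
    also have "\<dots> \<le> 16 * ((real D * exp (- l)) * 1)"
      using Dl by (intro mult_left_mono) auto
    finally show ?thesis
      by simp
  qed
  have "card {G \<in> \<G>. \<exists>S\<subseteq>P. card (Q \<inter> G `` S) + j \<le> card S \<and> 2 * card S \<le> D + 1}
    \<le> (16 * (real D * exp (- l)) + 2 * (real D ^ j * ((exp 1)\<^sup>2 * \<theta>) ^ j) * X
        + 2 * ((exp 1 / \<rho>)\<^sup>2 * exp (- (45/100 * l)))) * card \<G>"
  proof (rule few_violators[OF P Q _ _ t])
    show "1 \<le> j" "j \<le> D"
      using j D by auto
    show "X = (real D * \<alpha>)\<^sup>2 * (exp 1)\<^sup>2 * \<theta>"
      by (rule X_def)
    show "X \<le> 1/2"
      using X_le x by (simp add: \<theta>_def)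
    show "0 \<le> \<theta>"
      by (simp add: \<theta>_def)
    show "1 / (1 + \<beta>1) ^ (D + 1 - s) \<le> \<theta>" if s: "j < s" "2 * (s - j) \<le> R" for s
      unfolding \<theta>_def
    proof (rule inverse_power_le_exp[OF nonneg(3)])
      \<comment> \<open>The bound on R gives s <= D/80 + j, and \<open>200 \<le> D\<close> absorbs j
        <= 2.\<close>
      have "real s \<le> real D / 40"
        using s R D j by auto
      then have s': "39/40 * real D \<le> real (D + 1 - s)"
        by (auto simp: of_nat_diff)
      have "85/100 * l \<le> 39/40 * real D * (9/10 * p)"
        using l p by (simp add: l(1))
      also have "\<dots> \<le> real (D + 1 - s) * ln (1 + \<beta>1)"
        using s' b p by (intro mult_mono) auto
      finally show "85/100 * l \<le> real (D + 1 - s) * ln (1 + \<beta>1)" .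
    qed
    show "1 / (1 + \<beta>0) ^ (D + 1 - s) \<le> exp (- (45/100 * l))" if s: "2 * s \<le> D + 1" for s
    proof (rule inverse_power_le_exp[OF nonneg(2)])
      have s': "1/2 * real D \<le> real (D + 1 - s)"
        using s by (auto simp: of_nat_diff)
      have "45/100 * l \<le> 1/2 * (real D * ln (1 + \<beta>0))"
        using lnb by simp
      also have "\<dots> = 1/2 * real D * ln (1 + \<beta>0)"
        by simp
      also have "\<dots> \<le> real (D + 1 - s) * ln (1 + \<beta>0)"
        using s' lnb0 by (intro mult_right_mono) auto
      finally show "45/100 * l \<le> real (D + 1 - s) * ln (1 + \<beta>0)" .
    qed
  qed (use rho u in auto)
  also have "\<dots> \<le> (16 * (real D * exp (- l)) + 8 * exp 1 ^ 6 * l\<^sup>2 * exp (- (l / 2))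
        + 2 * ((exp 1 / \<rho>)\<^sup>2 * exp (- (45/100 * l)))) * card \<G>"
  proof -
    have "real D ^ j * \<theta> ^ j * \<theta> \<le> exp l ^ j * \<theta> ^ j * \<theta>"
      using l(3) by (intro mult_right_mono power_mono) (auto simp: \<theta>_def)
    also have "\<dots> = exp (real j * l + real j * (- (85/100 * l)) + (- (85/100 * l)))"
      unfolding \<theta>_def by (simp only: exp_of_nat_mult exp_add)
    also have "\<dots> \<le> exp (- (l / 2))"
      using j l(2) by auto
    finally have *: "real D ^ j * \<theta> ^ j * \<theta> \<le> exp (- (l / 2))" .
    have "(real D ^ j * ((exp 1)\<^sup>2 * \<theta>) ^ j) * X \<le> (real D ^ j * ((exp 1)\<^sup>2 * \<theta>) ^ j) * (4 * l\<^sup>2 * (exp 1)\<^sup>2 * \<theta>)"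
      using X_le by (rule mult_left_mono) (simp add: \<theta>_def)
    also have "\<dots> = 4 * l\<^sup>2 * (((exp 1)\<^sup>2) ^ j * (exp 1)\<^sup>2) * (real D ^ j * \<theta> ^ j * \<theta>)"
      by (simp add: power_mult_distrib mult_ac)
    also have "\<dots> \<le> 4 * l\<^sup>2 * exp 1 ^ 6 * exp (- (l / 2))"
    proof (intro mult_mono mult_left_mono *)
      have "((exp 1)\<^sup>2) ^ j * (exp 1)\<^sup>2 = (exp 1 :: real) ^ (2 * j + 2)"
        by (simp only: power_mult power_add)
      also have "\<dots> \<le> exp 1 ^ 6"
        using j by (intro power_increasing) auto
      finally show "((exp 1)\<^sup>2) ^ j * (exp 1)\<^sup>2 \<le> (exp 1 :: real) ^ 6" .
    qed (auto simp: \<theta>_def)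
    finally have "2 * (real D ^ j * ((exp 1)\<^sup>2 * \<theta>) ^ j) * X \<le> 8 * exp 1 ^ 6 * l\<^sup>2 * exp (- (l / 2))"
      by (simp add: mult_ac)
    then show ?thesis
      by (intro mult_right_mono add_mono) auto
  qed
  finally show ?thesis .
qed

text \<open>Chebyshev's inequality for the number of isolated vertices, centred at M g. This is a
  lower bound for the mean rather than the mean itself; it suffices because the mean enters the
  expanded square with a negative sign.\<close>

lemma isolated_second_moment:
  assumes M: "card P = M" "0 < M" and Q: "card Q = D"
  defines "h \<equiv> 1 / (1 + \<beta>0) ^ D" and "g \<equiv> 1 / (1 + \<alpha>) ^ D"
  shows "card {G \<in> \<G>. \<forall>a\<in>P. Q \<inter> G `` {a} \<noteq> {}} \<le> (h / (M * g\<^sup>2) + (h / g)\<^sup>2 - 1) * card \<G>"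
proof -
  let ?I = "\<lambda>a G. if Q \<inter> G `` {a} = {} then 1 else 0 :: real"
  let ?X = "\<lambda>G. \<Sum>a\<in>P. ?I a G"
  have h0: "0 < h" "0 < g"
    using nonneg by (auto simp: h_def g_def add_pos_nonneg)
  have I1: "(\<Sum>G\<in>\<G>. ?I a G) = card (cls \<G> {} ({a} \<times> Q))" for a
  proof -
    have "{G \<in> \<G>. Q \<inter> G `` {a} = {}} = cls \<G> {} ({a} \<times> Q)"
      by (auto simp: cls_def)
    then show ?thesis
      using finite_family by (simp add: sum.If_cases Int_def Collect_conj_eq[symmetric])
  qed
  have I2: "(\<Sum>G\<in>\<G>. ?I a G * ?I b G) = card (cls \<G> {} ({a, b} \<times> Q))" for a b
  proof -
    have "{G \<in> \<G>. Q \<inter> G `` {a} = {} \<and> Q \<inter> G `` {b} = {}} = cls \<G> {} ({a, b} \<times> Q)"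
      by (auto simp: cls_def)
    moreover have "?I a G * ?I b G = (if Q \<inter> G `` {a} = {} \<and> Q \<inter> G `` {b} = {} then 1 else 0)" for G
      by simp
    ultimately show ?thesis
      using finite_family by (simp add: sum.If_cases Int_def Collect_conj_eq[symmetric])
  qed
  have lower: "g * card \<G> \<le> card (cls \<G> {} ({a} \<times> Q))" if "a \<in> P" for a
    using card_absent_ge[of "{a} \<times> Q"] that Q nonneg
    by (auto simp: g_def card_cartesian_product pos_divide_le_eq mult.commute add_pos_nonneg)
  have upper1: "card (cls \<G> {} ({a, a} \<times> Q)) \<le> h * card \<G>" if "a \<in> P" for a
    using card_absent0[of "{a} \<times> Q"] that Q nonneg
    by (auto simp: h_def card_cartesian_product pos_le_divide_eq mult.commute add_pos_nonneg)
  have upper2: "card (cls \<G> {} ({a, b} \<times> Q)) \<le> h\<^sup>2 * card \<G>" if "a \<in> P" "b \<in> P" "a \<noteq> b" for a b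
  proof -
    have "card ({a, b} \<times> Q) = D * 2"
      using that Q by (simp add: card_cartesian_product)
    then have "((1 + \<beta>0) ^ D)\<^sup>2 * card (cls \<G> {} ({a, b} \<times> Q)) \<le> card \<G>"
      using card_absent0[of "{a, b} \<times> Q"] that by (auto simp add: power_mult)
    then show ?thesis
      using nonneg by (auto simp: h_def power_divide pos_le_divide_eq mult.commute add_pos_nonneg)
  qed
  have EX: "M * g * card \<G> \<le> (\<Sum>G\<in>\<G>. ?X G)"
  proof -
    have "M * g * card \<G> = (\<Sum>a\<in>P. g * card \<G>)"
      using M by simp
    also have "\<dots> \<le> (\<Sum>a\<in>P. \<Sum>G\<in>\<G>. ?I a G)"
      by (rule sum_mono) (simp only: I1 lower)
    also have "\<dots> = (\<Sum>G\<in>\<G>. ?X G)"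
      by (rule sum.swap)
    finally show ?thesis .
  qed
  have EX2: "(\<Sum>G\<in>\<G>. (?X G)\<^sup>2) \<le> (M * h + M\<^sup>2 * h\<^sup>2) * card \<G>"
  proof -
    have "(\<Sum>G\<in>\<G>. (?X G)\<^sup>2) = (\<Sum>G\<in>\<G>. \<Sum>a\<in>P. \<Sum>b\<in>P. ?I a G * ?I b G)"
      by (simp only: power2_eq_square sum_product)
    also have "\<dots> = (\<Sum>a\<in>P. \<Sum>G\<in>\<G>. \<Sum>b\<in>P. ?I a G * ?I b G)"
      by (rule sum.swap)
    also have "\<dots> = (\<Sum>a\<in>P. \<Sum>b\<in>P. \<Sum>G\<in>\<G>. ?I a G * ?I b G)"
      by (rule sum.cong[OF refl], rule sum.swap)
    also have "\<dots> = (\<Sum>a\<in>P. \<Sum>b\<in>P. real (card (cls \<G> {} ({a, b} \<times> Q))))"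
      by (simp only: I2)
    also have "\<dots> \<le> (\<Sum>a\<in>P. \<Sum>b\<in>P. ((if b = a then h * card \<G> else 0) + h\<^sup>2 * card \<G>))"
    proof (intro sum_mono)
      fix a b assume ab: "a \<in> P" "b \<in> P"
      show "real (card (cls \<G> {} ({a, b} \<times> Q))) \<le> (if b = a then h * card \<G> else 0) + h\<^sup>2 * card \<G>"
        using upper1[OF ab(1)] upper2[OF ab] by (cases "b = a") (auto intro: add_increasing2)
    qed
    also have "\<dots> = (M * h + M\<^sup>2 * h\<^sup>2) * card \<G>"
      using M finite_P by (simp add: sum.distrib algebra_simps power2_eq_square)
    finally show ?thesis .
  qed
  let ?m = "M * g" and ?N = "{G \<in> \<G>. \<forall>a\<in>P. Q \<inter> G `` {a} \<noteq> {}}"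
  have m0: "0 < ?m"
    using M h0 by simp
  have "?m\<^sup>2 * card ?N = (\<Sum>G\<in>?N. (?X G - ?m)\<^sup>2)"
    by simp
  also have "\<dots> \<le> (\<Sum>G\<in>\<G>. (?X G - ?m)\<^sup>2)"
    by (rule sum_mono2[OF finite_family]) auto
  also have "\<dots> = (\<Sum>G\<in>\<G>. (?X G)\<^sup>2) - 2 * ?m * (\<Sum>G\<in>\<G>. ?X G) + ?m\<^sup>2 * card \<G>"
    by (simp add: power2_diff sum.distrib sum_subtractf sum_distrib_left algebra_simps)
  also have "\<dots> \<le> (M * h + M\<^sup>2 * h\<^sup>2) * card \<G> - 2 * ?m * (?m * card \<G>) + ?m\<^sup>2 * card \<G>"
    using EX2 EX m0 by (intro add_mono diff_mono mult_left_mono) auto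
  also have "\<dots> = (M * h + M\<^sup>2 * h\<^sup>2 - ?m\<^sup>2) * card \<G>"
    by (simp add: algebra_simps power2_eq_square)
  also have "\<dots> = ?m\<^sup>2 * ((h / (M * g\<^sup>2) + (h / g)\<^sup>2 - 1) * card \<G>)"
    using M h0 by (simp add: field_simps power2_eq_square)
  finally show ?thesis
    using M h0 by (simp add: mult_le_cancel_left)
qed

end

section \<open>Bounds for a single parameter set\<close>

definition matched :: "'a set \<Rightarrow> 'a \<Rightarrow> ('a \<times> 'b) set \<Rightarrow> bool" where
  "matched A y G \<longleftrightarrow>
     (\<exists>M. perfect_matching A (out_nbrs G y) (induced_bipartite G A (out_nbrs G y)) M)"

locale biregular_setting =
  fixes Y A :: "'a set" and Z :: "'b set" and y :: 'a and D d :: nat and k :: real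
  assumes fin: "finite Y" "finite Z" and yA: "y \<in> A" "A \<subseteq> Y" and cA: "card A = D"
    and cZ: "real (card Z) = k * card Y" and Dk: "real D = k * d" and k0: "0 < k"
    and d2: "2 \<le> d" and dn: "d \<le> card Y" and Dn: "D \<le> card Y"
begin

definition "p = real d / card Y"
definition "l = real D * p"

abbreviation "\<G> \<equiv> bireg Y Z D d"
abbreviation "fibre B \<equiv> {G \<in> \<G>. G `` {y} = B}"

lemma n0: "0 < card Y"
  using d2 dn by simp

lemma p0: "0 < p"
  using d2 n0 by (simp add: p_def)

lemma D0: "0 < D"
  using Dk k0 d2 by (metis mult_pos_pos of_nat_0_less_iff zero_less_numeral less_le_trans)

lemma l0: "0 < l"
  using p0 D0 by (simp add: l_def)

lemma finA: "finite A"
  using yA fin finite_subset by blast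

lemma D_le_cZ: "D \<le> card Z"
proof -
  have "real D \<le> real (card Z)"
    unfolding Dk cZ using k0 dn by simp
  then show ?thesis
    by simp
qed

lemma l_eq: "l = real D * real d / card Y" "l = real D * real D / card Z" "l = k * card Y * p\<^sup>2" "l / d = k * p"
  using k0 n0 d2 by (simp_all add: l_def p_def Dk cZ power2_eq_square)

lemma nonempty: "\<G> \<noteq> {}"
proof (rule bireg_nonempty[OF fin _ D_le_cZ D0])
  have "real (card Y * D) = real (card Z * d)"
    by (simp add: Dk cZ)
  then show "card Y * D = card Z * d"
    by (simp only: of_nat_eq_iff)
qed

text \<open>The law of total probability over the neighbourhood of \<open>y\<close>; the constant
  \<open>c\<close> is the same for every fibre.\<close>

lemma fibre_average:
  fixes c :: real
  assumes "\<And>B. B \<subseteq> Z \<Longrightarrow> card B = D \<Longrightarrow> card {G \<in> fibre B. Q G} \<le> c * card (fibre B)"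
  shows "card {G \<in> \<G>. Q G} \<le> c * card \<G>"
proof -
  let ?f = "\<lambda>G. G `` {y}"
  have finG: "finite \<G>"
    by (rule finite_bireg[OF fin])
  have sum_fibres: "(\<Sum>B\<in>?f ` \<G>. real (card {G \<in> \<G>. ?f G = B \<and> R G})) = card {G \<in> \<G>. R G}" for R
  proof -
    have "(\<Sum>B\<in>?f ` \<G>. \<Sum>G\<in>{G \<in> {G \<in> \<G>. R G}. ?f G = B}. 1 :: real) = (\<Sum>G\<in>{G \<in> \<G>. R G}. 1)"
      by (rule sum.group) (use finG in auto)
    then show ?thesis
      by (simp add: conj_commute conj_left_commute)
  qed
  have "real (card {G \<in> \<G>. Q G}) = (\<Sum>B\<in>?f ` \<G>. real (card {G \<in> \<G>. ?f G = B \<and> Q G}))"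
    by (rule sum_fibres[symmetric])
  also have "\<dots> \<le> (\<Sum>B\<in>?f ` \<G>. c * real (card {G \<in> \<G>. ?f G = B \<and> True}))"
  proof (rule sum_mono)
    fix B assume "B \<in> ?f ` \<G>"
    then have "B \<subseteq> Z" "card B = D"
      using yA by (auto simp: bireg_def)
    then show "real (card {G \<in> \<G>. ?f G = B \<and> Q G}) \<le> c * real (card {G \<in> \<G>. ?f G = B \<and> True})"
      using assms[of B] by (simp add: conj_assoc)
  qed
  also have "\<dots> = c * card \<G>"
    unfolding sum_distrib_left[symmetric] sum_fibres by simp
  finally show ?thesis .
qed

lemma matched_fibre:
  assumes "G \<in> fibre B" "matched A y G" "a \<in> A"
  shows "B \<inter> G `` {a} \<noteq> {}"
  using assms perfect_matching_not_isolated[of A B G _ a] finA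
  unfolding matched_def out_nbrs_def by auto

definition "K = card Z * d - (2 * D + 3 * D * d + D * D)"
definition "\<alpha> = real D * real d / real K"
definition "\<beta> r = real (D - r) * real (d - 1 - r) * real K / (real (card Z) * real d)\<^sup>2"

text \<open>The total error in the exponent: k p + (5 + k) l p from (1 + \<open>\<beta> 0\<close>)^D
  and 2 (4 + k) l p from (1 + \<open>\<alpha>\<close>)^D.\<close>

definition "\<delta> = k * p + (3 * (4 + k) + 1) * (l * p)"

context
  assumes small: "(4 + k) * p \<le> 1/2"
begin

lemma odds:
  assumes "B \<subseteq> Z" "card B = D" "R \<le> D"
  shows "edge_odds (fibre B) (A - {y}) B R \<alpha> (\<beta> 0) (\<beta> R)"
  unfolding \<alpha>_def \<beta>_def
  by (rule edge_odds_bireg)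
     (use assms fin yA cA switching_constants[OF k0 cZ Dk d2 n0 small[unfolded p_def]] in \<open>simp_all add: K_def\<close>)

lemma alpha_bounds: "\<alpha> \<le> p * (1 + 2 * ((4 + k) * p))" "\<alpha> \<le> 2 * p" "0 \<le> \<alpha>"
proof -
  show a: "\<alpha> \<le> p * (1 + 2 * ((4 + k) * p))"
    using switching_constants(5)[OF k0 cZ Dk d2 n0 small[unfolded p_def]] by (simp add: \<alpha>_def K_def p_def)
  have "p * (1 + 2 * ((4 + k) * p)) \<le> p * (1 + 2 * (1/2))"
    using small p0 by (intro mult_left_mono add_left_mono) auto
  then show "\<alpha> \<le> 2 * p"
    using a by simp
qed (simp add: \<alpha>_def)

lemma p_small: "p \<le> 1/8"
proof -
  have "4 * p \<le> (4 + k) * p"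
    using k0 p0 by (intro mult_right_mono) auto
  then show ?thesis
    using small by simp
qed

lemma beta_bounds: "\<beta> r \<le> p" "p * (1 - 1 / d - (4 + k) * p) \<le> \<beta> 0" "0 \<le> \<beta> r"
  using switching_odds_bounds(1,2)[OF k0 cZ Dk d2 n0 small[unfolded p_def]]
  by (simp_all add: \<beta>_def K_def p_def)

text \<open>Expanding ln (1 + b) >= b - b^2: the loss k p = l/d stems from d - 1 in place of d, (4 +
  k) l p from the spared edges, and a further l p from b^2.\<close>

lemma ln_beta0: "l - (k * p + (5 + k) * (l * p)) \<le> real D * ln (1 + \<beta> 0)"
proof -
  have "\<beta> 0 - (\<beta> 0)\<^sup>2 \<le> ln (1 + \<beta> 0)"
    using beta_bounds(1,3)[of 0] p_small by (intro ln_one_plus_pos_lower_bound) auto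
  moreover have "(\<beta> 0)\<^sup>2 \<le> p\<^sup>2"
    using beta_bounds by (intro power_mono) auto
  ultimately have "p * (1 - 1 / d - (4 + k) * p) - p\<^sup>2 \<le> ln (1 + \<beta> 0)"
    using beta_bounds(2) by linarith
  then have "real D * (p * (1 - 1 / d - (4 + k) * p) - p\<^sup>2) \<le> real D * ln (1 + \<beta> 0)"
    by (rule mult_left_mono) simp
  moreover have "real D * (p * (1 - 1 / d - (4 + k) * p) - p\<^sup>2) = l - (l / d + (5 + k) * (l * p))"
    by (simp add: l_def algebra_simps power2_eq_square)
  ultimately show ?thesis
    unfolding l_eq(4) by simp
qed

text \<open>The isolation probability of a vertex lies between g and h, both within a factor exp
  \<open>\<delta>\<close> of e^(-l). Only absent edges are involved, so the odds are taken with R =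
  0.\<close>

lemma few_matched:
  assumes "2 \<le> D"
  shows "card {G \<in> \<G>. matched A y G} \<le> (2 * exp (2 * \<delta>) * (exp l / D) + exp (2 * \<delta>) - 1) * card \<G>"
proof (rule fibre_average)
  fix B assume B: "B \<subseteq> Z" "card B = D"
  interpret edge_odds "fibre B" "A - {y}" B 0 \<alpha> "\<beta> 0" "\<beta> 0"
    by (rule odds) (use B in auto)
  define h where "h = 1 / (1 + \<beta> 0) ^ D"
  define g where "g = 1 / (1 + \<alpha>) ^ D"
  have hg0: "0 < h" "0 < g"
    using nonneg by (auto simp: h_def g_def add_pos_nonneg)
  have \<delta>0: "0 \<le> \<delta>"
    using k0 p0 l0 by (simp add: \<delta>_def)
  have h: "h \<le> exp (- (l - (k * p + (5 + k) * (l * p))))"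
    unfolding h_def by (rule inverse_power_le_exp[OF nonneg(2) ln_beta0])
  have "(1 + \<alpha>) ^ D \<le> exp \<alpha> ^ D"
    using nonneg(1) exp_ge_add_one_self[of \<alpha>] by (intro power_mono) auto
  also have "\<dots> = exp (real D * \<alpha>)"
    by (simp add: exp_of_nat_mult)
  also have "\<dots> \<le> exp (l + 2 * (4 + k) * (l * p))"
    using mult_left_mono[OF alpha_bounds(1), of "real D"] by (simp add: l_def algebra_simps)
  finally have g: "1 / g \<le> exp (l + 2 * (4 + k) * (l * p))"
    by (simp add: g_def)
  have "h * (1 / g) \<le> exp (- (l - (k * p + (5 + k) * (l * p)))) * exp (l + 2 * (4 + k) * (l * p))"
    using h g hg0 by (intro mult_mono) auto
  also have "\<dots> = exp \<delta>"
  proof -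
    have "- (l - (k * p + (5 + k) * (l * p))) + (l + 2 * (4 + k) * (l * p)) = \<delta>"
      by (simp add: \<delta>_def algebra_simps)
    then show ?thesis
      by (simp only: exp_add[symmetric])
  qed
  finally have hg: "h / g \<le> exp \<delta>"
    by simp
  have g': "1 / g \<le> exp (l + \<delta>)"
  proof (rule order_trans[OF g])
    have "0 \<le> k * p" "2 * (4 + k) * (l * p) \<le> (3 * (4 + k) + 1) * (l * p)"
      using k0 p0 l0 by (auto intro!: mult_right_mono)
    then show "exp (l + 2 * (4 + k) * (l * p)) \<le> exp (l + \<delta>)"
      unfolding exp_le_cancel_iff \<delta>_def by linarith
  qed
  have M: "real D / 2 \<le> real (D - 1)" "0 < real (D - 1)"
    using assms by (auto simp: of_nat_diff)
  have "h / (real (D - 1) * g\<^sup>2) = (h / g) * (1 / g) / real (D - 1)"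
    by (simp add: power2_eq_square)
  also have "\<dots> \<le> exp \<delta> * exp (l + \<delta>) / (real D / 2)"
    using hg g' M hg0 assms by (intro frac_le mult_mono) auto
  also have "\<dots> = 2 * exp (2 * \<delta>) * (exp l / D)"
  proof -
    have "\<delta> + (l + \<delta>) = 2 * \<delta> + l"
      by simp
    then have "exp \<delta> * exp (l + \<delta>) = exp (2 * \<delta>) * exp l"
      by (simp only: exp_add[symmetric])
    then show ?thesis
      by simp
  qed
  finally have 1: "h / (real (D - 1) * g\<^sup>2) \<le> 2 * exp (2 * \<delta>) * (exp l / D)" .
  have "(h / g)\<^sup>2 \<le> (exp \<delta>)\<^sup>2"
    using hg hg0 by (intro power_mono) auto
  also have "\<dots> = exp (2 * \<delta>)"
    by (rule exp_double[symmetric])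
  finally have 2: "(h / g)\<^sup>2 \<le> exp (2 * \<delta>)" .
  have "card {G \<in> fibre B. matched A y G} \<le> card {G \<in> fibre B. \<forall>a\<in>A - {y}. B \<inter> G `` {a} \<noteq> {}}"
  proof (rule card_mono)
    show "finite {G \<in> fibre B. \<forall>a\<in>A - {y}. B \<inter> G `` {a} \<noteq> {}}"
      by (rule finite_subset[OF _ finite_family]) blast
  qed (use matched_fibre in blast)
  then have "real (card {G \<in> fibre B. matched A y G}) \<le> real (card {G \<in> fibre B. \<forall>a\<in>A - {y}. B \<inter> G `` {a} \<noteq> {}})"
    by (rule of_nat_mono)
  also have "\<dots> \<le> (h / (real (D - 1) * g\<^sup>2) + (h / g)\<^sup>2 - 1) * card (fibre B)"
    unfolding h_def g_def
    by (rule isolated_second_moment) (use assms yA cA finA B in \<open>auto simp: card_Diff_singleton\<close>)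
  also have "\<dots> \<le> (2 * exp (2 * \<delta>) * (exp l / D) + exp (2 * \<delta>) - 1) * card (fibre B)"
    using 1 2 by (intro mult_right_mono) auto
  finally show "real (card {G \<in> fibre B. matched A y G}) \<le>
    (2 * exp (2 * \<delta>) * (exp l / D) + exp (2 * \<delta>) - 1) * card (fibre B)" .
qed

text \<open>One vertex \<open>a\<close> of A other than \<open>y\<close> decides: a matching needs
  an edge from \<open>a\<close> into B, and each of the D candidates has probability at most 2
  p.\<close>

lemma few_matched_bounded:
  assumes "2 \<le> D"
  shows "card {G \<in> \<G>. matched A y G} \<le> (2 * real D * p) * card \<G>"
proof (rule fibre_average)
  fix B assume B: "B \<subseteq> Z" "card B = D"
  interpret edge_odds "fibre B" "A - {y}" B 0 \<alpha> "\<beta> 0" "\<beta> 0"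
    by (rule odds) (use B in auto)
  have "card (A - {y}) \<noteq> 0"
    using assms cA yA finA by (simp add: card_Diff_singleton)
  then obtain a where a: "a \<in> A - {y}"
    by (metis card.empty ex_in_conv)
  have "{G \<in> fibre B. matched A y G} \<subseteq> (\<Union>z\<in>B. cls (fibre B) {(a, z)} {})"
    using matched_fibre[of _ B a] a by (fastforce simp: cls_def)
  then have "card {G \<in> fibre B. matched A y G} \<le> card (\<Union>z\<in>B. cls (fibre B) {(a, z)} {})"
    using finite_Q finite_cls[OF finite_family] by (intro card_mono) auto
  then have "real (card {G \<in> fibre B. matched A y G}) \<le> real (card (\<Union>z\<in>B. cls (fibre B) {(a, z)} {}))"
    by (rule of_nat_mono)
  also have "\<dots> \<le> real (card B) * (2 * p * card (fibre B))"
  proof (rule card_UN_bound[OF finite_Q])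
    fix z assume z: "z \<in> B"
    have "card (cls (fibre B) {(a, z)} {}) \<le> \<alpha> * card (cls (fibre B) {} {(a, z)})"
      using upper[of "{}" "{}" "(a, z)"] a z by simp
    also have "\<dots> \<le> 2 * p * card (fibre B)"
    proof (rule mult_mono[OF alpha_bounds(2)])
      show "real (card (cls (fibre B) {} {(a, z)})) \<le> real (card (fibre B))"
        unfolding of_nat_le_iff by (rule card_mono[OF finite_family]) (auto simp: cls_def)
    qed (use p0 in auto)
    finally show "real (card (cls (fibre B) {(a, z)} {})) \<le> 2 * p * card (fibre B)" .
  qed
  finally show "real (card {G \<in> fibre B. matched A y G}) \<le> 2 * real D * p * card (fibre B)"
    using B by (simp add: mult_ac)
qed

end

lemma unmatched_violator:
  assumes "G \<in> fibre B" "\<not> matched A y G"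
  shows "(\<exists>S\<subseteq>A - {y}. S \<noteq> {} \<and> 2 * card S \<le> D + 1 \<and> card (B \<inter> G `` S) < card S) \<or>
    (\<exists>U\<subseteq>B. U \<noteq> {} \<and> 2 * card U \<le> D + 1 \<and> (\<exists>S\<subseteq>A - {y}. card S = D + 1 - card U \<and> (S \<times> U) \<inter> G = {}))"
proof -
  have G: "G `` {y} = B" "G \<in> \<G>"
    using assms by auto
  have "B \<subseteq> Z" "card B = D"
    using G yA by (auto simp: bireg_def)
  then show ?thesis
    using no_matching_violator[OF G(1) finA _ yA(1) cA] assms(2) fin finite_subset[of B Z]
    unfolding matched_def out_nbrs_def G(1) by blast
qed

text \<open>Patterns are affordable up to R of order min D d / 40, so that \<open>\<beta> R\<close>
  stays near p. Larger violators have s >= min D d / 80, which is \<open>\<rho>\<close> D because d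
  = D / k.\<close>

lemma few_unmatched_sparse:
  defines "\<rho> \<equiv> min 1 (1 / k) / 80"
  assumes large: "200 \<le> d" "200 \<le> D" and small: "(4 + k) * p \<le> 1/100" "k * p + (5 + k) * (l * p) \<le> 1/2"
    and l: "5 \<le> l" "real D \<le> exp l"
    and x: "4 * l\<^sup>2 * (exp 1)\<^sup>2 * exp (- (85/100 * l)) \<le> 1/2"
    and u: "(exp 1 / \<rho>)\<^sup>2 * exp (- (45/100 * l)) \<le> 1/2"
  shows "card {G \<in> \<G>. \<not> matched A y G} \<le>
    (2 * (16 * (real D * exp (- l)) + 8 * exp 1 ^ 6 * l\<^sup>2 * exp (- (l / 2))
        + 2 * ((exp 1 / \<rho>)\<^sup>2 * exp (- (45/100 * l))))) * card \<G>"
proof (rule fibre_average)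
  fix B assume B: "B \<subseteq> Z" "card B = D"
  define R where "R = min D d div 40"
  let ?c = "16 * (real D * exp (- l)) + 8 * exp 1 ^ 6 * l\<^sup>2 * exp (- (l / 2))
        + 2 * ((exp 1 / \<rho>)\<^sup>2 * exp (- (45/100 * l)))"
  have R: "40 * R \<le> D" "40 * R \<le> d"
    by (auto simp: R_def)
  have small': "(4 + k) * p \<le> 1/2"
    using small by simp
  interpret edge_odds "fibre B" "A - {y}" B R \<alpha> "\<beta> 0" "\<beta> R"
    by (rule odds[OF small']) (use B R in auto)
  interpret conv: edge_odds "converse ` fibre B" B "A - {y}" R \<alpha> "\<beta> 0" "\<beta> R"
    by (rule edge_odds_converse)
  have rho0: "0 < \<rho>"
    using k0 by (simp add: \<rho>_def)
  have rho: "\<rho> * D \<le> real s" if "R < 2 * (s - j)" for s j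
  proof -
    have "min D d < 40 * (R + 1)"
      unfolding R_def by (simp add: dividend_less_times_div)
    also have "\<dots> \<le> 80 * s"
      using that by simp
    finally have "real (min D d) \<le> 80 * real s"
      by linarith
    moreover have "min 1 (1 / k) * real D = real (min D d)"
    proof (cases "k \<le> 1")
      case True
      then have "real D \<le> real d"
        using Dk d2 by simp
      moreover have "1 \<le> 1 / k"
        using True k0 by simp
      ultimately show ?thesis
        by simp
    next
      case False
      then have "real d \<le> real D" "1 / k \<le> 1"
        using Dk d2 by simp_all
      moreover have "1 / k * real D = real d"
        using Dk k0 by simp
      ultimately show ?thesis
        by (simp add: min_absorb2)
    qed
    ultimately show ?thesis
      by (simp add: \<rho>_def)
  qed
  have p1: "p \<le> 1/400"
  proof -
    have "4 * p \<le> (4 + k) * p"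
      using k0 p0 by (intro mult_right_mono) auto
    then show ?thesis
      using small by simp
  qed
  have b0: "l - 1/2 \<le> real D * ln (1 + \<beta> 0)"
    using ln_beta0[OF small'] small by linarith
  have b1: "9/10 * p \<le> ln (1 + \<beta> R)"
  proof -
    have "93/100 * p \<le> \<beta> R"
      using switching_odds_bounds(3)[OF k0 cZ Dk d2 n0 small'[unfolded p_def] R(1) R(2) large(1) small(1)[unfolded p_def]]
      by (simp add: \<beta>_def K_def p_def)
    then have "ln (1 + 93/100 * p) \<le> ln (1 + \<beta> R)"
      using p0 by simp
    moreover have "93/100 * p - (93/100 * p)\<^sup>2 \<le> ln (1 + 93/100 * p)"
      using p0 p1 by (intro ln_one_plus_pos_lower_bound) auto
    moreover have "(93/100 * p)\<^sup>2 \<le> 3/100 * p"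
    proof -
      have "p * p \<le> 1/400 * p"
        using p0 p1 by (intro mult_right_mono) auto
      then show ?thesis
        using p0 by (simp add: power2_eq_square)
    qed
    ultimately show ?thesis
      by linarith
  qed
  have b00: "\<beta> 0 \<le> 1"
    using beta_bounds(1)[OF small', of 0] p1 by simp
  have cA': "card (A - {y}) = D - 1"
    using cA yA finA by (simp add: card_Diff_singleton)
  let ?V1 = "{G \<in> fibre B. \<exists>S\<subseteq>A - {y}. card (B \<inter> G `` S) + 1 \<le> card S \<and> 2 * card S \<le> D + 1}"
  \<comment> \<open>The deficiency is 2, as A - {y} has D - 1 vertices against the D vertices of
    B.\<close>
  let ?V2 = "{H \<in> converse ` fibre B. \<exists>U\<subseteq>B. card ((A - {y}) \<inter> H `` U) + 2 \<le> card U \<and> 2 * card U \<le> D + 1}"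
  have V1: "card ?V1 \<le> ?c * card (fibre B)"
    by (rule sparse_violators[OF _ _ _ large(2) l_def l p0 alpha_bounds(2)[OF small'] b00 b0 b1 R(1) rho0 rho x u])
       (use cA' B in auto)
  have "card ?V2 \<le> ?c * card (converse ` fibre B)"
    by (rule conv.sparse_violators[OF _ _ _ large(2) l_def l p0 alpha_bounds(2)[OF small'] b00 b0 b1 R(1) rho0 rho x u])
       (use cA' B D0 in auto)
  then have V2: "card ?V2 \<le> ?c * card (fibre B)"
    by (simp only: card_image_converse)
  have "{G \<in> fibre B. \<not> matched A y G} \<subseteq> ?V1 \<union> converse ` ?V2"
  proof
    fix G assume "G \<in> {G \<in> fibre B. \<not> matched A y G}"
    then have G: "G \<in> fibre B" "\<not> matched A y G"
      by blast+
    from unmatched_violator[OF this] show "G \<in> ?V1 \<union> converse ` ?V2"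
    proof (elim disjE exE conjE)
      fix S assume "S \<subseteq> A - {y}" "2 * card S \<le> D + 1" "card (B \<inter> G `` S) < card S"
      then have "\<exists>S\<subseteq>A - {y}. card (B \<inter> G `` S) + 1 \<le> card S \<and> 2 * card S \<le> D + 1"
        by (intro exI[of _ S] conjI) simp_all
      with G(1) show ?thesis
        by (intro UnI1 CollectI conjI) auto
    next
      fix U S assume U: "U \<subseteq> B" "2 * card U \<le> D + 1" and S: "S \<subseteq> A - {y}" "card S = D + 1 - card U" "(S \<times> U) \<inter> G = {}"
      have fS: "finite S"
        using finite_subset[OF S(1)] finA by simp
      have "(A - {y}) \<inter> G\<inverse> `` U \<subseteq> (A - {y}) - S"
        using S by auto
      then have "card ((A - {y}) \<inter> G\<inverse> `` U) \<le> card ((A - {y}) - S)"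
        using finA by (intro card_mono) auto
      also have "\<dots> = D - 1 - card S"
        using S fS cA' by (simp add: card_Diff_subset)
      finally have "card ((A - {y}) \<inter> G\<inverse> `` U) \<le> D - 1 - card S" .
      moreover have "card S \<le> D - 1"
        using card_mono[OF _ S(1)] finA cA' by simp
      ultimately have "card ((A - {y}) \<inter> G\<inverse> `` U) + 2 \<le> card U"
        using S U D0 by linarith
      with U have "\<exists>U\<subseteq>B. card ((A - {y}) \<inter> G\<inverse> `` U) + 2 \<le> card U \<and> 2 * card U \<le> D + 1"
        by (intro exI[of _ U] conjI)
      then have "G\<inverse> \<in> ?V2"
        unfolding mem_Collect_eq[of "G\<inverse>"] using imageI[OF G(1), of converse] by (rule conjI[rotated])
      then show ?thesis
        by (intro UnI2 image_eqI[where x = "G\<inverse>"]) (simp only: converse_converse)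
    qed
  qed
  moreover have "finite ?V1"
    by (rule finite_subset[OF _ finite_family]) blast
  moreover have "finite ?V2"
    by (rule finite_subset[OF _ conv.finite_family]) blast
  ultimately have "card {G \<in> fibre B. \<not> matched A y G} \<le> card (?V1 \<union> converse ` ?V2)"
    by (intro card_mono finite_UnI finite_imageI)
  also have "\<dots> \<le> card ?V1 + card (converse ` ?V2)"
    by (rule card_Un_le)
  also have "\<dots> = card ?V1 + card ?V2"
    by (simp only: card_image_converse)
  finally have "real (card {G \<in> fibre B. \<not> matched A y G}) \<le> real (card ?V1 + card ?V2)"
    by (rule of_nat_mono)
  also have "\<dots> = real (card ?V1) + real (card ?V2)"
    by simp
  also have "\<dots> \<le> ?c * card (fibre B) + ?c * card (fibre B)"
    using V1 V2 by (rule add_mono)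
  also have "\<dots> = 2 * ?c * card (fibre B)"
    by (simp only: mult_2 distrib_right)
  finally show "real (card {G \<in> fibre B. \<not> matched A y G}) \<le> 2 * ?c * card (fibre B)" .
qed

lemma few_unmatched_dense:
  fixes M :: real
  assumes n9: "9 \<le> card Y" "9 \<le> card Z" and M: "card Y \<le> M" "card Z \<le> M"
    and x: "M ^ 3 * 2 powr (- l / 8) \<le> 1/2"
  shows "card {G \<in> \<G>. \<not> matched A y G} \<le> (4 * (M ^ 3 * 2 powr (- l / 8))) * card \<G>"
proof -
  let ?x = "M ^ 3 * 2 powr (- l / 8)"
  let ?row = "\<lambda>G. \<exists>S\<subseteq>A - {y}. S \<noteq> {} \<and> 2 * card S \<le> D + 1 \<and> card (G `` {y} \<inter> G `` S) < card S"
  let ?col = "\<lambda>G. \<exists>U\<subseteq>Z. U \<noteq> {} \<and> 2 * card U \<le> D + 1 \<and>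
      (\<exists>S\<subseteq>A - {y}. card S = D + 1 - card U \<and> (S \<times> U) \<inter> G = {})"
  have row: "card {G \<in> \<G>. ?row G} \<le> (2 * ?x) * card \<G>"
  proof (rule fibre_average)
    fix B assume B: "B \<subseteq> Z" "card B = D"
    have "{G \<in> fibre B. ?row G} = {G \<in> fibre B. \<exists>S\<subseteq>A - {y}. S \<noteq> {} \<and> 2 * card S \<le> D + 1 \<and> card (B \<inter> G `` S) < card S}"
      by (rule Collect_cong) (rule conj_cong[OF refl], simp)
    then show "real (card {G \<in> fibre B. ?row G}) \<le> 2 * ?x * card (fibre B)"
      using dense_row_violators[OF fin yA B(2) cA d2 n9(1) Dn M(1)] x by (simp only: l_eq(1))
  qed
  have col: "card {G \<in> \<G>. ?col G} \<le> (2 * ?x) * card \<G>"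
    using dense_column_violators[OF fin yA cA n9(2) D_le_cZ M(2)] x by (simp only: l_eq(2))
  have "{G \<in> \<G>. \<not> matched A y G} \<subseteq> {G \<in> \<G>. ?row G} \<union> {G \<in> \<G>. ?col G}"
  proof
    fix G assume G: "G \<in> {G \<in> \<G>. \<not> matched A y G}"
    then have G': "G \<in> fibre (G `` {y})" "\<not> matched A y G"
      by blast+
    have GZ: "G `` {y} \<subseteq> Z"
      using G by (intro bireg_image_subset) blast
    from unmatched_violator[OF G'] have "?row G \<or> ?col G"
    proof (elim disjE exE conjE)
      fix S assume "S \<subseteq> A - {y}" "S \<noteq> {}" "2 * card S \<le> D + 1" "card (G `` {y} \<inter> G `` S) < card S"
      then show ?thesis
        by (intro disjI1 exI[of _ S] conjI)
    next
      fix U S assume "U \<subseteq> G `` {y}" "U \<noteq> {}" "2 * card U \<le> D + 1"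
        "S \<subseteq> A - {y}" "card S = D + 1 - card U" "(S \<times> U) \<inter> G = {}"
      moreover from this have "U \<subseteq> Z"
        using GZ by (metis subset_trans)
      ultimately show ?thesis
        by (intro disjI2 exI[of _ U] conjI exI[of _ S])
    qed
    then show "G \<in> {G \<in> \<G>. ?row G} \<union> {G \<in> \<G>. ?col G}"
      using G by blast
  qed
  then have "card {G \<in> \<G>. \<not> matched A y G} \<le> card ({G \<in> \<G>. ?row G} \<union> {G \<in> \<G>. ?col G})"
    using finite_bireg[OF fin, of D d] by (intro card_mono) auto
  also have "\<dots> \<le> card {G \<in> \<G>. ?row G} + card {G \<in> \<G>. ?col G}"
    by (rule card_Un_le)
  finally have "real (card {G \<in> \<G>. \<not> matched A y G}) \<le> real (card {G \<in> \<G>. ?row G} + card {G \<in> \<G>. ?col G})"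
    by (rule of_nat_mono)
  also have "\<dots> \<le> (2 * ?x) * card \<G> + (2 * ?x) * card \<G>"
    using row col by (simp only: of_nat_add add_mono)
  also have "\<dots> = (4 * ?x) * card \<G>"
    by simp
  finally show ?thesis .
qed

end

section \<open>The threshold\<close>

lemma whp_pmf_of_set:
  fixes f :: "nat \<Rightarrow> real"
  assumes S: "\<And>i. finite (S i)" "\<And>i. S i \<noteq> {}"
    and bad: "eventually (\<lambda>i. card {G \<in> S i. \<not> Q i G} \<le> f i * card (S i)) sequentially"
    and f: "f \<longlonglongrightarrow> 0"
  shows "whp (\<lambda>i. pmf_of_set (S i)) Q"
proof -
  let ?pr = "\<lambda>i. measure_pmf.prob (pmf_of_set (S i)) {G. Q i G}"
  have 1: "eventually (\<lambda>i. 1 - f i \<le> ?pr i) sequentially"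
    using bad
  proof (rule eventually_mono)
    fix i assume i: "card {G \<in> S i. \<not> Q i G} \<le> f i * card (S i)"
    have c: "0 < real (card (S i))"
      using S by (simp add: card_gt_0_iff)
    have "card (S i) = card (S i \<inter> {G. Q i G}) + card {G \<in> S i. \<not> Q i G}"
    proof -
      have "S i = (S i \<inter> {G. Q i G}) \<union> {G \<in> S i. \<not> Q i G}"
        by blast
      moreover have "card ((S i \<inter> {G. Q i G}) \<union> {G \<in> S i. \<not> Q i G})
          = card (S i \<inter> {G. Q i G}) + card {G \<in> S i. \<not> Q i G}"
        by (rule card_Un_disjoint) (use S(1)[of i] in auto)
      ultimately show ?thesis
        by simp
    qed
    then have "real (card (S i)) = real (card (S i \<inter> {G. Q i G})) + real (card {G \<in> S i. \<not> Q i G})"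
      by (simp only: of_nat_add)
    then have "(1 - f i) * card (S i) \<le> card (S i \<inter> {G. Q i G})"
      using i by (simp add: algebra_simps)
    then show "1 - f i \<le> ?pr i"
      using c S by (simp add: measure_pmf_of_set pos_le_divide_eq)
  qed
  have 2: "(\<lambda>i. 1 - f i) \<longlonglongrightarrow> 1"
    using tendsto_diff[OF tendsto_const f, of 1] by simp
  have 3: "eventually (\<lambda>i. ?pr i \<le> 1) sequentially"
    by simp
  show ?thesis
    unfolding whp_def by (rule tendsto_sandwich[OF 1 3 2 tendsto_const])
qed

context biregular_setting
begin

text \<open>Solves l = k n p^2 for p.\<close>

lemma p_le_of_l_le:
  assumes "l \<le> 60 * ln (card Y)"
  shows "p \<le> sqrt (60 * ln (card Y) / (k * card Y))"
    and "l * p \<le> 60 * ln (card Y) * sqrt (60 * ln (card Y) / (k * card Y))"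
proof -
  have kn: "0 < k * card Y"
    using k0 n0 by simp
  have "p\<^sup>2 \<le> 60 * ln (card Y) / (k * card Y)"
    using assms kn l_eq(3) by (simp add: pos_le_divide_eq mult.commute)
  then show p: "p \<le> sqrt (60 * ln (card Y) / (k * card Y))"
    by (rule real_le_rsqrt)
  show "l * p \<le> 60 * ln (card Y) * sqrt (60 * ln (card Y) / (k * card Y))"
    using p assms p0 l0 by (intro mult_mono) auto
qed

text \<open>The origin of 60: with ln 2 >= 2/3, the exponent is (60 ln n / 8) (2/3) = 5 ln n, two
  powers of n more than the cube of (1 + k) n.\<close>

lemma dense_bound:
  assumes "60 * ln (card Y) \<le> l"
  shows "((1 + k) * card Y) ^ 3 * 2 powr (- l / 8) \<le> (1 + k) ^ 3 / (real (card Y))\<^sup>2"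
proof -
  have n: "0 < real (card Y)"
    using n0 by simp
  have "2 powr (- l / 8) = exp (- (l / 8 * ln 2))"
    by (simp add: powr_def)
  also have "\<dots> \<le> exp (- (5 * ln (card Y)))"
  proof -
    have "5 * ln (card Y) \<le> l / 8 * (2 / 3)"
      using assms by simp
    also have "\<dots> \<le> l / 8 * ln 2"
      using l0 ln2_ge_two_thirds by (intro mult_left_mono) auto
    finally show ?thesis
      by simp
  qed
  also have "\<dots> = 1 / real (card Y) ^ 5"
    using n exp_of_nat_mult[of 5 "ln (real (card Y))"] by (simp add: exp_minus inverse_eq_divide)
  finally have "((1 + k) * card Y) ^ 3 * 2 powr (- l / 8) \<le> ((1 + k) * card Y) ^ 3 * (1 / real (card Y) ^ 5)"
    using k0 by (intro mult_left_mono) auto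
  also have "\<dots> = (1 + k) ^ 3 / (real (card Y))\<^sup>2"
    using n by (simp add: power_mult_distrib field_simps eval_nat_numeral)
  finally show ?thesis .
qed

end

text \<open>The case of constant d excludes k d = 1: then A = {y}, and the edge from
  \<open>y\<close> to its only out-neighbour is always a perfect matching.\<close>

theorem theorem2:
  fixes k :: rat
    and n d :: "nat \<Rightarrow> nat"
    and Y A :: "nat \<Rightarrow> 'a set"
    and Z :: "nat \<Rightarrow> 'b set"
    and y :: "nat \<Rightarrow> 'a"
  assumes k_pos: "k > 0"
    and n_lim: "filterlim n at_top sequentially"
    and n_pos: "\<And>i. n i > 0"
    and d_range: "\<And>i. d i \<in> {2..n i}"
    and kn_int: "\<And>i. k * of_nat (n i) \<in> \<int>"
    and kd_int: "\<And>i. k * of_nat (d i) \<in> \<int>"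
    and kd_le: "\<And>i. k * of_nat (d i) \<le> of_nat (n i)"
    and Y_fin: "\<And>i. finite (Y i)"
    and Y_card: "\<And>i. card (Y i) = n i"
    and Z_fin: "\<And>i. finite (Z i)"
    and Z_card: "\<And>i. of_nat (card (Z i)) = k * of_nat (n i)"
    and A_sub: "\<And>i. A i \<subseteq> Y i"
    and A_card: "\<And>i. of_nat (card (A i)) = k * of_nat (d i)"
    and y_in: "\<And>i. y i \<in> A i"
  shows
    "((filterlim (\<lambda>i. real_of_rat k * real (d i) ^ 2 / real (n i)
                        - ln (real_of_rat k * real (d i))) at_bot sequentially
       \<or> (\<exists>c. k * of_nat c \<noteq> 1 \<and> (\<forall>i. d i = c)))
      \<longrightarrow> whp (\<lambda>i. random_biregular_graph k (d i) (Y i) (Z i))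
            (\<lambda>i G. \<not> (\<exists>M. perfect_matching (A i) (out_nbrs G (y i))
                            (induced_bipartite G (A i) (out_nbrs G (y i))) M)))
     \<and> (filterlim (\<lambda>i. real_of_rat k * real (d i) ^ 2 / real (n i)
                        - ln (real_of_rat k * real (d i))) at_top sequentially
      \<longrightarrow> whp (\<lambda>i. random_biregular_graph k (d i) (Y i) (Z i))
            (\<lambda>i G. \<exists>M. perfect_matching (A i) (out_nbrs G (y i))
                            (induced_bipartite G (A i) (out_nbrs G (y i))) M))"
proof -
  define kr where "kr = real_of_rat k"
  define D where "D i = card (A i)" for i
  define p where "p i = real (d i) / n i" for i
  define l where "l i = real (D i) * p i" for i
  define e where "e i = kr * real (d i) ^ 2 / real (n i) - ln (kr * real (d i))" for i
  have kr: "0 < kr"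
    using k_pos by (simp add: kr_def)
  have D: "real (D i) = kr * d i" for i
    using arg_cong[OF A_card[of i], of real_of_rat] by (simp add: D_def kr_def of_rat_mult)
  have Zr: "real (card (Z i)) = kr * n i" for i
    using arg_cong[OF Z_card[of i], of real_of_rat] by (simp add: kr_def of_rat_mult)
  have Dn: "D i \<le> n i" for i
  proof -
    have "(of_nat (D i) :: rat) \<le> of_nat (n i)"
      using kd_le[of i] A_card[of i] by (simp add: D_def)
    then show ?thesis
      by simp
  qed
  have S: "biregular_setting (Y i) (A i) (Z i) (y i) (D i) (d i) kr" for i
    by unfold_locales (use Y_fin Z_fin y_in A_sub Y_card Zr D kr d_range[of i] Dn in \<open>auto simp: D_def\<close>)
  have p_eq: "biregular_setting.p (Y i) (d i) = p i" for i
    by (simp add: biregular_setting.p_def[OF S] p_def Y_card)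
  have l_eq: "biregular_setting.l (Y i) (D i) (d i) = l i" for i
    by (simp add: biregular_setting.l_def[OF S] l_def p_eq)
  have p0: "0 < p i" and l0: "0 < l i" and D0: "0 < D i" for i
    using biregular_setting.p0[OF S] biregular_setting.l0[OF S] biregular_setting.D0[OF S] p_eq l_eq by auto
  have e_eq: "e i = l i - ln (D i)" for i
    by (simp add: e_def l_def p_def D power2_eq_square)
  have pmf_eq: "random_biregular_graph k (d i) (Y i) (Z i) = pmf_of_set (bireg (Y i) (Z i) (D i) (d i))" for i
  proof -
    have "biregular_graphs k (d i) (Y i) (Z i) = bireg (Y i) (Z i) (D i) (d i)"
      unfolding biregular_graphs_def bireg_def out_nbrs_def in_nbrs_def A_card[symmetric] D_def
      by (simp only: of_nat_eq_iff)
    then show ?thesis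
      by (simp add: random_biregular_graph_def)
  qed
  have fam: "finite (bireg (Y i) (Z i) (D i) (d i))" "bireg (Y i) (Z i) (D i) (d i) \<noteq> {}" for i
    using finite_bireg[OF Y_fin Z_fin] biregular_setting.nonempty[OF S] by blast+
  have matched_eq: "(\<exists>M. perfect_matching (A i) (out_nbrs G (y i)) (induced_bipartite G (A i) (out_nbrs G (y i))) M)
      = matched (A i) (y i) G" for i G
    by (simp add: matched_def)
  have n_real: "filterlim (\<lambda>i. real (n i)) at_top sequentially"
    by (rule filterlim_compose[OF filterlim_real_sequentially n_lim])
  \<comment> \<open>In the sparse range \<open>b1\<close> bounds p and \<open>b2\<close> bounds l p;
    both tend to 0, and with them all relative errors.\<close>
  define b1 where "b1 i = sqrt (60 * ln (n i) / (kr * n i))" for i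
  define b2 where "b2 i = 60 * ln (n i) * b1 i" for i
  have "((\<lambda>x. sqrt (60 * ln x / (kr * x))) \<longlongrightarrow> 0) at_top"
    "((\<lambda>x. 60 * ln x * sqrt (60 * ln x / (kr * x))) \<longlongrightarrow> 0) at_top"
    using kr by real_asymp+
  then have b: "b1 \<longlonglongrightarrow> 0" "b2 \<longlonglongrightarrow> 0"
    unfolding b1_def b2_def by (auto intro: filterlim_compose[OF _ n_real])
  have p_le: "p i \<le> b1 i" "l i * p i \<le> b2 i" if "l i \<le> 60 * ln (n i)" for i
    using biregular_setting.p_le_of_l_le[OF S, of i] that
    by (simp_all add: l_eq p_eq Y_card b1_def b2_def)

  \<comment> \<open>Below the threshold: isolated vertices\<close>
  have "whp (\<lambda>i. pmf_of_set (bireg (Y i) (Z i) (D i) (d i))) (\<lambda>i G. \<not> matched (A i) (y i) G)"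
    if lim: "filterlim e at_bot sequentially"
  proof -
    define \<delta> where "\<delta> i = kr * p i + (3 * (4 + kr) + 1) * (l i * p i)" for i
    have ev: "eventually (\<lambda>i. e i \<le> -1) sequentially"
      using lim by (simp add: filterlim_at_bot)
    \<comment> \<open>Below the threshold l <= ln D <= ln n, so the sparse range is
      automatic.\<close>
    have sparse: "eventually (\<lambda>i. l i \<le> 60 * ln (n i)) sequentially"
      using ev
    proof (rule eventually_mono)
      fix i assume "e i \<le> -1"
      then have "l i \<le> ln (D i)"
        by (simp add: e_eq)
      also have "\<dots> \<le> ln (n i)"
        using D0[of i] Dn[of i] n_pos[of i] by simp
      also have "\<dots> \<le> 60 * ln (n i)"
        using n_pos[of i] by simp
      finally show "l i \<le> 60 * ln (n i)" .
    qed
    have \<delta>: "\<delta> \<longlonglongrightarrow> 0"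
    proof (rule tendsto_sandwich[OF _ _ tendsto_const])
      show "eventually (\<lambda>i. 0 \<le> \<delta> i) sequentially"
        using kr p0 l0 by (auto simp: \<delta>_def less_imp_le)
      show "eventually (\<lambda>i. \<delta> i \<le> kr * b1 i + (3 * (4 + kr) + 1) * b2 i) sequentially"
        using sparse
        by (rule eventually_mono) (use kr p_le in \<open>auto simp: \<delta>_def intro!: add_mono mult_left_mono\<close>)
      show "(\<lambda>i. kr * b1 i + (3 * (4 + kr) + 1) * b2 i) \<longlonglongrightarrow> 0"
        using tendsto_add[OF tendsto_mult_left[OF b(1), of kr] tendsto_mult_left[OF b(2), of "3 * (4 + kr) + 1"]] by simp
    qed
    have "eventually (\<lambda>i. (4 + kr) * b1 i < 1/2) sequentially"
      using tendsto_mult_left[OF b(1), of "4 + kr"] by (intro order_tendstoD) auto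
    then have small: "eventually (\<lambda>i. (4 + kr) * p i \<le> 1/2) sequentially"
      using sparse
    proof eventually_elim
      case (elim i)
      have "(4 + kr) * p i \<le> (4 + kr) * b1 i"
        using p_le(1)[OF elim(2)] kr by (intro mult_left_mono) auto
      then show ?case
        using elim by linarith
    qed
    show ?thesis
    proof (rule whp_pmf_of_set[OF fam])
      show "eventually (\<lambda>i. card {G \<in> bireg (Y i) (Z i) (D i) (d i). \<not> \<not> matched (A i) (y i) G}
        \<le> (2 * exp (2 * \<delta> i) * exp (e i) + exp (2 * \<delta> i) - 1) * card (bireg (Y i) (Z i) (D i) (d i))) sequentially"
        using ev small
      proof eventually_elim
        case (elim i)
        \<comment> \<open>Since l is positive, e <= -1 forces ln D >= 1; this rules out D =
          1.\<close>
        have "1 \<le> ln (D i)"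
          using elim(1) l0[of i] by (simp add: e_eq)
        then have "exp 1 \<le> real (D i)"
          using D0[of i] by (simp add: ln_ge_iff)
        then have D2: "2 \<le> D i"
          using exp_ge_add_one_self[of "1 :: real"] by linarith
        have "exp (e i) = exp (l i) / D i"
          using D0[of i] by (simp add: e_eq exp_diff)
        then show ?case
          using biregular_setting.few_matched[OF S, of i] elim(2) D2
          by (simp add: p_eq l_eq biregular_setting.\<delta>_def[OF S] \<delta>_def)
      qed
      have 1: "(\<lambda>i. exp (2 * \<delta> i)) \<longlonglongrightarrow> exp (2 * 0)"
        by (intro tendsto_intros \<delta>)
      have 2: "(\<lambda>i. exp (e i)) \<longlonglongrightarrow> 0"
        by (rule filterlim_compose[OF exp_at_bot lim])
      have "(\<lambda>i. 2 * exp (2 * \<delta> i) * exp (e i) + exp (2 * \<delta> i) - 1) \<longlonglongrightarrow> 2 * exp (2 * 0) * 0 + exp (2 * 0) - 1"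
        by (intro tendsto_diff tendsto_add tendsto_mult tendsto_const 1 2)
      then show "(\<lambda>i. 2 * exp (2 * \<delta> i) * exp (e i) + exp (2 * \<delta> i) - 1) \<longlonglongrightarrow> 0"
        by simp
    qed
  qed

  \<comment> \<open>Constant degree\<close>
  moreover have "whp (\<lambda>i. pmf_of_set (bireg (Y i) (Z i) (D i) (d i))) (\<lambda>i G. \<not> matched (A i) (y i) G)"
    if c: "k * of_nat c \<noteq> 1" "\<And>i. d i = c" for c
  proof -
    have D2: "2 \<le> D i" for i
    proof -
      have "(of_nat (D i) :: rat) \<noteq> 1"
        using A_card[of i] c by (simp add: D_def)
      then show ?thesis
        using D0[of i] by (cases "D i = 1") auto
    qed
    have p: "p \<longlonglongrightarrow> 0"
      unfolding p_def c(2) by (rule real_tendsto_divide_at_top[OF tendsto_const n_real])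
    have "eventually (\<lambda>i. (4 + kr) * p i < 1/2) sequentially"
      using tendsto_mult_left[OF p, of "4 + kr"] by (intro order_tendstoD) auto
    then have ev: "eventually (\<lambda>i. card {G \<in> bireg (Y i) (Z i) (D i) (d i). \<not> \<not> matched (A i) (y i) G}
        \<le> (2 * (kr * c) * p i) * card (bireg (Y i) (Z i) (D i) (d i))) sequentially"
    proof (rule eventually_mono)
      fix i assume "(4 + kr) * p i < 1/2"
      then have "card {G \<in> bireg (Y i) (Z i) (D i) (d i). matched (A i) (y i) G}
        \<le> (2 * real (D i) * p i) * card (bireg (Y i) (Z i) (D i) (d i))"
        using biregular_setting.few_matched_bounded[OF S, of i] D2[of i] by (simp add: p_eq)
      moreover have "real (D i) = kr * c"
        using D[of i] c(2)[of i] by simp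
      ultimately show "card {G \<in> bireg (Y i) (Z i) (D i) (d i). \<not> \<not> matched (A i) (y i) G}
        \<le> (2 * (kr * c) * p i) * card (bireg (Y i) (Z i) (D i) (d i))"
        by (simp only: not_not)
    qed
    show ?thesis
      by (rule whp_pmf_of_set[OF fam ev]) (use tendsto_mult_left[OF p, of "2 * (kr * c)"] in simp)
  qed

  \<comment> \<open>Above the threshold: no Hall violators\<close>
  moreover have "whp (\<lambda>i. pmf_of_set (bireg (Y i) (Z i) (D i) (d i))) (\<lambda>i G. matched (A i) (y i) G)"
    if lim: "filterlim e at_top sequentially"
  proof -
    define \<rho> where "\<rho> = min 1 (1 / kr) / 80"
    define f1 where "f1 i = (1 + kr) ^ 3 / (real (n i))\<^sup>2" for i
    define f2 where "f2 i = 16 * exp (- e i) + 8 * exp 1 ^ 6 * (l i)\<^sup>2 * exp (- (l i / 2))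
        + 2 * ((exp 1 / \<rho>)\<^sup>2 * exp (- (45/100 * l i)))" for i
    have e_le: "e i \<le> l i" for i
      using D0[of i] by (simp add: e_eq)
    have l_lim: "filterlim l at_top sequentially"
      by (rule filterlim_at_top_mono[OF lim]) (simp add: e_le)
    \<comment> \<open>As l tends to infinity, these bounds make d and D large; this supplies the
      constant 200.\<close>
    have l_le: "l i \<le> D i" "l i \<le> d i" for i
    proof -
      have "p i \<le> 1"
        using d_range[of i] n_pos[of i] by (simp add: p_def)
      then show "l i \<le> D i"
        by (simp add: l_def mult_left_le)
      have "real (D i) / n i \<le> 1"
        using Dn[of i] n_pos[of i] by simp
      then have "d i * (real (D i) / n i) \<le> d i"
        by (intro mult_left_le) simp_all
      then show "l i \<le> d i"
        by (simp add: l_def p_def mult_ac)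
    qed
    have "f1 \<longlonglongrightarrow> 0"
    proof -
      have "((\<lambda>x. (1 + kr) ^ 3 / x\<^sup>2) \<longlongrightarrow> 0) at_top"
        by real_asymp
      then show ?thesis
        unfolding f1_def by (rule filterlim_compose[OF _ n_real])
    qed
    have exps: "((\<lambda>x::real. 4 * x\<^sup>2 * (exp 1)\<^sup>2 * exp (- (85/100 * x))) \<longlongrightarrow> 0) at_top"
      "((\<lambda>x::real. 8 * exp 1 ^ 6 * x\<^sup>2 * exp (- (x / 2))) \<longlongrightarrow> 0) at_top"
      "((\<lambda>x::real. exp (- (45/100 * x))) \<longlongrightarrow> 0) at_top"
      "((\<lambda>x::real. exp (- x)) \<longlongrightarrow> 0) at_top"
      by real_asymp+
    have u_lim: "(\<lambda>i. (exp 1 / \<rho>)\<^sup>2 * exp (- (45/100 * l i))) \<longlonglongrightarrow> 0"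
      using tendsto_mult_left[OF filterlim_compose[OF exps(3) l_lim], of "(exp 1 / \<rho>)\<^sup>2"] by simp
    have "f2 \<longlonglongrightarrow> 16 * 0 + 0 + 2 * 0"
      unfolding f2_def
      by (intro tendsto_add tendsto_mult_left u_lim filterlim_compose[OF exps(2) l_lim] filterlim_compose[OF exps(4) lim])
    then have f2: "f2 \<longlonglongrightarrow> 0"
      by simp
    have f_nonneg: "0 \<le> f1 i" "0 \<le> f2 i" for i
      using kr by (auto simp: f1_def f2_def)
    have "eventually (\<lambda>i. (4 + kr) * b1 i < 1/100) sequentially"
      using tendsto_mult_left[OF b(1), of "4 + kr"] by (intro order_tendstoD) auto
    moreover have "eventually (\<lambda>i. kr * b1 i + (5 + kr) * b2 i < 1/2) sequentially"
      using tendsto_add[OF tendsto_mult_left[OF b(1), of kr] tendsto_mult_left[OF b(2), of "5 + kr"]]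
      by (intro order_tendstoD) auto
    moreover have "eventually (\<lambda>i. 4 * (l i)\<^sup>2 * (exp 1)\<^sup>2 * exp (- (85/100 * l i)) < 1/2) sequentially"
      using filterlim_compose[OF exps(1) l_lim] by (intro order_tendstoD) auto
    moreover have "eventually (\<lambda>i. (exp 1 / \<rho>)\<^sup>2 * exp (- (45/100 * l i)) < 1/2) sequentially"
      using u_lim by (intro order_tendstoD) auto
    moreover have "eventually (\<lambda>i. f1 i < 1/2) sequentially"
      using \<open>f1 \<longlonglongrightarrow> 0\<close> by (intro order_tendstoD) auto
    moreover have "eventually (\<lambda>i. 200 \<le> l i) sequentially" "eventually (\<lambda>i. 0 \<le> e i) sequentially"
      using l_lim lim by (simp_all add: filterlim_at_top)
    moreover have "eventually (\<lambda>i. 9 \<le> real (n i)) sequentially" "eventually (\<lambda>i. 9 / kr \<le> real (n i)) sequentially"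
      using n_real unfolding filterlim_at_top by blast+
    ultimately have ev: "eventually (\<lambda>i. card {G \<in> bireg (Y i) (Z i) (D i) (d i). \<not> matched (A i) (y i) G}
        \<le> (4 * f1 i + 2 * f2 i) * card (bireg (Y i) (Z i) (D i) (d i))) sequentially"
    proof eventually_elim
      case (elim i)
      let ?g = "real (card (bireg (Y i) (Z i) (D i) (d i)))"
      show ?case
      \<comment> \<open>The sequence may alternate between the two ranges, so the case is decided
        separately for each index and the bound adds the errors of both.\<close>
      proof (cases "60 * ln (n i) \<le> l i")
        case True
        have x: "((1 + kr) * n i) ^ 3 * 2 powr (- l i / 8) \<le> f1 i"
          using biregular_setting.dense_bound[OF S, of i] True by (simp add: l_eq Y_card f1_def)
        have "9 \<le> kr * n i"
          using elim(9) kr by (simp add: pos_divide_le_eq mult.commute)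
        then have "9 \<le> card (Y i)" "9 \<le> card (Z i)"
          using elim(8) Zr[of i] Y_card[of i] by linarith+
        then have "card {G \<in> bireg (Y i) (Z i) (D i) (d i). \<not> matched (A i) (y i) G}
            \<le> (4 * (((1 + kr) * n i) ^ 3 * 2 powr (- l i / 8))) * ?g"
          using biregular_setting.few_unmatched_dense[OF S, of i "(1 + kr) * n i"] x elim(5) kr
          by (simp add: l_eq Y_card Zr distrib_right)
        also have "\<dots> \<le> (4 * f1 i + 2 * f2 i) * ?g"
          using x f_nonneg[of i] by (intro mult_right_mono) auto
        finally show ?thesis .
      next
        case False
        then have sparse: "l i \<le> 60 * ln (n i)"
          by simp
        have "(4 + kr) * p i \<le> (4 + kr) * b1 i"
          using p_le(1)[OF sparse] kr by (intro mult_left_mono) auto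
        then have s1: "(4 + kr) * p i \<le> 1/100"
          using elim(1) by linarith
        have "kr * p i + (5 + kr) * (l i * p i) \<le> kr * b1 i + (5 + kr) * b2 i"
          using p_le[OF sparse] kr by (intro add_mono mult_left_mono) auto
        then have s2: "kr * p i + (5 + kr) * (l i * p i) \<le> 1/2"
          using elim(2) by linarith
        have large: "200 \<le> d i" "200 \<le> D i"
          using l_le[of i] elim(6) by linarith+
        have De: "real (D i) = exp (ln (D i))"
          using D0[of i] by simp
        have "ln (D i) \<le> l i"
          using elim(7) e_eq[of i] by simp
        then have Dl: "real (D i) \<le> exp (l i)"
          by (subst De) simp
        have De': "real (D i) * exp (- l i) = exp (- e i)"
          by (subst De) (simp only: exp_add[symmetric] e_eq, simp)
        have "card {G \<in> bireg (Y i) (Z i) (D i) (d i). \<not> matched (A i) (y i) G} \<le> (2 * f2 i) * ?g"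
          using biregular_setting.few_unmatched_sparse[OF S, of i] large s1 s2 Dl elim(3,4,6)
          unfolding p_eq l_eq De' f2_def \<rho>_def by simp
        also have "\<dots> \<le> (4 * f1 i + 2 * f2 i) * ?g"
          using f_nonneg[of i] by (intro mult_right_mono) auto
        finally show ?thesis .
      qed
    qed
    have "(\<lambda>i. 4 * f1 i + 2 * f2 i) \<longlonglongrightarrow> 4 * 0 + 2 * 0"
      by (intro tendsto_add tendsto_mult_left \<open>f1 \<longlonglongrightarrow> 0\<close> f2)
    then have lim0: "(\<lambda>i. 4 * f1 i + 2 * f2 i) \<longlonglongrightarrow> 0"
      by simp
    show ?thesis
      by (rule whp_pmf_of_set[OF fam ev lim0])
  qed

  ultimately show ?thesis
    unfolding pmf_eq matched_eq e_def[abs_def, symmetric] kr_def[symmetric] by blast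
qed

end
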